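(* Let $(\mathcal{N}, \mathcal{I}, \partial\mathcal{I}, \mathcal{I}^\circ)$ be the data for an iterated gluing diagram, with induced iterated gluing category $\mathcal{I}_\infty$, and let $\mathcal{E}$ be a category admitting all limits indexed by the categories of elements $\oint_{j \in \mathcal{I}_{<n}} \mathcal{I}^\circ_n(i,j)$ for $n \in \mathcal{N}$ and $i \in \partial\mathcal{I}_n$. Further assume that $\mathcal{E}$ has all finite limits and that each $\mathcal{E}^{\partial\mathcal{I}_n}$ is equipped with a subobject classifier $\overline{\Omega}_n$ along with a truth map $\overline{\mathrm{true}}_n : 1 \to \overline{\Omega}_n$. Then $\mathcal{E}^{\mathcal{I}_\infty}$ has a subobject classifier $\Omega_\infty$ and a truth map $\mathrm{true}_\infty : 1 \to \Omega_\infty$. For each $n \in \mathcal{N}$ and $i \in \partial\mathcal{I}_n$, $\Omega_\infty[i]_n$ is the equaliser in $\mathcal{E}$ $$\Omega_\infty[i]_n \hookrightarrow \overline{\Omega}_n i \times M_i\Omega_\infty \rightrightarrows \overline{\Omega}_n i$$ of the maps $\pi_1$ and $\wedge_i \circ (\mathrm{id} \times (\chi_{M_n(\mathrm{true}_\infty)})_i)$, where $\chi_{M_n(\mathrm{true}_\infty)} : M_n\Omega_\infty \to \overline{\Omega}_n$ is the characteristic map of $M_n(\mathrm{true}_\infty) : 1 \cong M_n 1 \hookrightarrow M_n\Omega_\infty$ in $\mathcal{E}^{\partial\mathcal{I}_n}$ and $\wedge : \overline{\Omega}_n \times \overline{\Omega}_n \to \overline{\Omega}_n$ is the internal meet. Moreover,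 the composite of $(\mathrm{true}_\infty)_{[i]_n} : 1 \to \Omega_\infty[i]_n$ with $\Omega_\infty[i]_n \hookrightarrow \overline{\Omega}_n i \times M_i\Omega_\infty$ has first component $(\overline{\mathrm{true}}_n)_i : 1 \to \overline{\Omega}_n i$ and second component $M_i(\mathrm{true}_\infty) : 1 \cong M_i 1 \to M_i\Omega_\infty$.
   Context: *Iterated gluing diagrams.* A *strict inverse category* is a category $\mathcal{N}$ with a function $\deg : \mathrm{ob}\,\mathcal{N} \to \mathbb{N}$ such that every non-identity map $n \to n'$ has $\deg n > \deg n'$. For $n \in \mathcal{N}$ let $(n/\mathcal{N})^\circ$ be the full subcategory of the coslice $n/\mathcal{N}$ on all objects except $\mathrm{id}_n$. The data $(\mathcal{N}, \mathcal{I}, \partial\mathcal{I}, \mathcal{I}^\circ)$ of an *iterated gluing diagram* consists of: a strict inverse category $\mathcal{N}$; a functor $\mathcal{I} : \mathcal{N}^{\mathrm{op}} \to \mathrm{Cat}$, $n \mapsto \mathcal{I}_n$ (so $\alpha : n \to n'$ induces $\mathcal{I}_\alpha : \mathcal{I}_{n'} \to \mathcal{I}_n$); a family of categories $\partial\mathcal{I}_n$, $n \in \mathrm{ob}\,\mathcal{N}$; and a family of profunctors $\mathcal{I}^\circ_n : (\partial\mathcal{I}_n)^{\mathrm{op}} \times \mathcal{I}_{<n} \to \mathrm{Set}$, where $\mathcal{I}_{<n} := \mathrm{colim}\big(((n/\mathcal{N})^\circ)^{\mathrm{op}} \to \mathcal{N}^{\mathrm{op}} \xrightarrow{\mathcal{I}}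 \mathrm{Cat}\big)$ (equivalently the colimit of $\mathcal{I}$ weighted by $\mathcal{N}(n,-)$ with the identity removed); such that each $\mathcal{I}_n$ is the collage of $\mathcal{I}_n^\circ$: its objects are $\mathrm{ob}\,\mathcal{I}_{<n} \sqcup \mathrm{ob}\,\partial\mathcal{I}_n$, it contains $\mathcal{I}_{<n}$ and $\partial\mathcal{I}_n$ as full subcategories, $\mathcal{I}_n(i,j) = \mathcal{I}_n^\circ(i,j)$ and $\mathcal{I}_n(j,i) = \emptyset$ for $i \in \partial\mathcal{I}_n$, $j \in \mathcal{I}_{<n}$, with composition given by functoriality of $\mathcal{I}^\circ_n$; and the inclusion $\mathcal{I}_{<n} \hookrightarrow \mathcal{I}_n$ is the canonical map induced by the $\mathcal{I}_\alpha$. The *induced iterated gluing category* is $\mathcal{I}_\infty := \mathrm{colim}_{n \in \mathcal{N}^{\mathrm{op}}} \mathcal{I}_n$. For $i \in \partial\mathcal{I}_n$, $[i]_n \in \mathcal{I}_\infty$ denotes the image of $i$ under $\partial\mathcal{I}_n \hookrightarrow \mathcal{I}_n \to \mathcal{I}_\infty$. *Matching objects.* $\oint_{j \in \mathcal{I}_{<n}} \mathcal{I}^\circ_n(i,j)$ is the category of elements of $\mathcal{I}^\circ_n(i,-)$: objects are pairs $(j, u)$ with $j \in \mathcal{I}_{<n}$ and $u \in \mathcal{I}_n^\circ(i,j)$. The *$n$-th matching object functor* $M_n : \mathcal{E}^{\mathcal{I}_{<n}} \to \mathcal{E}^{\partial\mathcal{I}_n}$ is right Kan extension along $\mathcal{I}_{<n}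 \hookrightarrow \mathcal{I}_n$ followed by restriction along $\partial\mathcal{I}_n \hookrightarrow \mathcal{I}_n$; explicitly $(M_n X)i = \lim\big(\oint_{j \in \mathcal{I}_{<n}} \mathcal{I}^\circ_n(i,j) \to \mathcal{I}_{<n} \xrightarrow{X} \mathcal{E}\big)$. For $X \in \mathcal{E}^{\mathcal{I}_\infty}$, $M_n X$ means $M_n$ applied to the restriction of $X$ along $\mathcal{I}_{<n} \hookrightarrow \mathcal{I}_n \to \mathcal{I}_\infty$, and $M_i X := (M_n X)i$ for $i \in \partial\mathcal{I}_n$ (similarly for maps). The internal meet on a subobject classifier is the characteristic map of $(\mathrm{true},\mathrm{true})$. *)

theory Defs
  imports "HOL-Library.FuncSet"
begin

section \<open>Categories, functors, natural transformations\<close>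

record ('o, 'a) cat =
  ob :: "'o set"
  ar :: "'a set"
  src :: "'a \<Rightarrow> 'o"
  tgt :: "'a \<Rightarrow> 'o"
  idt :: "'o \<Rightarrow> 'a"
  cmp :: "'a \<Rightarrow> 'a \<Rightarrow> 'a"  (infixr "\<cdot>\<index>" 70)

definition hom :: "('o, 'a) cat \<Rightarrow> 'o \<Rightarrow> 'o \<Rightarrow> 'a set" where
  "hom C x y = {f \<in> ar C. src C f = x \<and> tgt C f = y}"

locale category =
  fixes C :: "('o, 'a) cat"  (structure)
  assumes src_ob: "f \<in> ar C \<Longrightarrow> src C f \<in> ob C"
    and tgt_ob: "f \<in> ar C \<Longrightarrow> tgt C f \<in> ob C"
    and idt_hom: "x \<in> ob C \<Longrightarrow> idt C x \<in> hom C x x"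
    and cmp_hom: "\<lbrakk>f \<in> hom C x y; g \<in> hom C y z\<rbrakk> \<Longrightarrow> g \<cdot> f \<in> hom C x z"
    and idt_left: "f \<in> hom C x y \<Longrightarrow> idt C y \<cdot> f = f"
    and idt_right: "f \<in> hom C x y \<Longrightarrow> f \<cdot> idt C x = f"
    and assoc: "\<lbrakk>f \<in> hom C w x; g \<in> hom C x y; h \<in> hom C y z\<rbrakk> \<Longrightarrow> (h \<cdot> g) \<cdot> f = h \<cdot> (g \<cdot> f)"

definition op_cat :: "('o, 'a) cat \<Rightarrow> ('o, 'a) cat" where
  "op_cat C = \<lparr>ob = ob C, ar = ar C, src = tgt C, tgt = src C, idt = idt C,
     cmp = (\<lambda>g f. f \<cdot>\<^bsub>C\<^esub> g)\<rparr>"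

definition prod_cat :: "('o, 'a) cat \<Rightarrow> ('p, 'b) cat \<Rightarrow> ('o \<times> 'p, 'a \<times> 'b) cat" where
  "prod_cat C D = \<lparr>ob = ob C \<times> ob D, ar = ar C \<times> ar D,
     src = map_prod (src C) (src D), tgt = map_prod (tgt C) (tgt D),
     idt = map_prod (idt C) (idt D),
     cmp = (\<lambda>(g, g') (f, f'). (g \<cdot>\<^bsub>C\<^esub> f, g' \<cdot>\<^bsub>D\<^esub> f'))\<rparr>"

definition full_subcat :: "('o, 'a) cat \<Rightarrow> 'o set \<Rightarrow> ('o, 'a) cat" where
  "full_subcat C S = C\<lparr>ob := ob C \<inter> S, ar := {f \<in> ar C. src C f \<in> S \<and> tgt C f \<in> S}\<rparr>"

text \<open>An arrow of the coslice from \<open>f\<close> to \<open>g\<close> is a triple \<open>(f, h, g)\<close> with \<open>h \<cdot> f = g\<close>.\<close>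

definition coslice :: "('o, 'a) cat \<Rightarrow> 'o \<Rightarrow> ('a, 'a \<times> 'a \<times> 'a) cat" where
  "coslice C x = \<lparr>ob = {f \<in> ar C. src C f = x},
     ar = {(f, h, g). f \<in> ar C \<and> src C f = x \<and> h \<in> ar C \<and> src C h = tgt C f \<and> g = h \<cdot>\<^bsub>C\<^esub> f},
     src = (\<lambda>(f, h, g). f), tgt = (\<lambda>(f, h, g). g),
     idt = (\<lambda>f. (f, idt C (tgt C f), f)),
     cmp = (\<lambda>(_, k, g') (f, h, _). (f, k \<cdot>\<^bsub>C\<^esub> h, g'))\<rparr>"

definition punctured_coslice :: "('o, 'a) cat \<Rightarrow> 'o \<Rightarrow> ('a, 'a \<times> 'a \<times> 'a) cat" where
  "punctured_coslice C x = full_subcat (coslice C x) (- {idt C x})"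

text \<open>Functors and transformations take the value \<open>undefined\<close> outside the domain category, so
  that equality of functors and of natural transformations is equality in HOL.\<close>

record ('o, 'a, 'p, 'b) fctr =
  fob :: "'o \<Rightarrow> 'p"
  far :: "'a \<Rightarrow> 'b"

definition is_functor :: "('o, 'a) cat \<Rightarrow> ('p, 'b) cat \<Rightarrow> ('o, 'a, 'p, 'b) fctr \<Rightarrow> bool" where
  "is_functor C D F \<longleftrightarrow>
     fob F \<in> ob C \<rightarrow>\<^sub>E ob D \<and> far F \<in> extensional (ar C) \<and>
     (\<forall>f \<in> ar C. far F f \<in> hom D (fob F (src C f)) (fob F (tgt C f))) \<and>
     (\<forall>x \<in> ob C. far F (idt C x) = idt D (fob F x)) \<and>
     (\<forall>f \<in> ar C. \<forall>g \<in> ar C. src C g = tgt C f \<longrightarrow> far F (g \<cdot>\<^bsub>C\<^esub> f) = far F g \<cdot>\<^bsub>D\<^esub> far F f)"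

definition id_fctr :: "('o, 'a) cat \<Rightarrow> ('o, 'a, 'o, 'a) fctr" where
  "id_fctr C = \<lparr>fob = restrict (\<lambda>x. x) (ob C), far = restrict (\<lambda>f. f) (ar C)\<rparr>"

text \<open>\<open>comp_fctr C G F\<close> is \<open>G\<close> after \<open>F\<close>, where \<open>C\<close> is the domain of \<open>F\<close>.\<close>

definition comp_fctr ::
  "('o, 'a) cat \<Rightarrow> ('p, 'b, 'q, 'c) fctr \<Rightarrow> ('o, 'a, 'p, 'b) fctr \<Rightarrow> ('o, 'a, 'q, 'c) fctr" where
  "comp_fctr C G F = \<lparr>fob = compose (ob C) (fob G) (fob F), far = compose (ar C) (far G) (far F)\<rparr>"

definition is_iso_fctr :: "('o, 'a) cat \<Rightarrow> ('p, 'b) cat \<Rightarrow> ('o, 'a, 'p, 'b) fctr \<Rightarrow> bool" where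
  "is_iso_fctr C D F \<longleftrightarrow> is_functor C D F \<and>
     (\<exists>G. is_functor D C G \<and> comp_fctr C G F = id_fctr C \<and> comp_fctr D F G = id_fctr D)"

record ('o, 'a, 'p, 'b) ntrans =
  nsrc :: "('o, 'a, 'p, 'b) fctr"
  ntgt :: "('o, 'a, 'p, 'b) fctr"
  cpt :: "'o \<Rightarrow> 'b"

definition is_ntrans :: "('o, 'a) cat \<Rightarrow> ('p, 'b) cat \<Rightarrow> ('o, 'a, 'p, 'b) ntrans \<Rightarrow> bool" where
  "is_ntrans C D t \<longleftrightarrow>
     is_functor C D (nsrc t) \<and> is_functor C D (ntgt t) \<and> cpt t \<in> extensional (ob C) \<and>
     (\<forall>x \<in> ob C. cpt t x \<in> hom D (fob (nsrc t) x) (fob (ntgt t) x)) \<and>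
     (\<forall>f \<in> ar C. far (ntgt t) f \<cdot>\<^bsub>D\<^esub> cpt t (src C f) = cpt t (tgt C f) \<cdot>\<^bsub>D\<^esub> far (nsrc t) f)"

definition fun_cat ::
  "('o, 'a) cat \<Rightarrow> ('p, 'b) cat \<Rightarrow> (('o, 'a, 'p, 'b) fctr, ('o, 'a, 'p, 'b) ntrans) cat" where
  "fun_cat C D = \<lparr>ob = {F. is_functor C D F}, ar = {t. is_ntrans C D t}, src = nsrc, tgt = ntgt,
     idt = (\<lambda>F. \<lparr>nsrc = F, ntgt = F, cpt = \<lambda>x\<in>ob C. idt D (fob F x)\<rparr>),
     cmp = (\<lambda>t s. \<lparr>nsrc = nsrc s, ntgt = ntgt t, cpt = \<lambda>x\<in>ob C. cpt t x \<cdot>\<^bsub>D\<^esub> cpt s x\<rparr>)\<rparr>"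

definition whisker ::
  "('o, 'a) cat \<Rightarrow> ('p, 'b, 'q, 'c) ntrans \<Rightarrow> ('o, 'a, 'p, 'b) fctr \<Rightarrow> ('o, 'a, 'q, 'c) ntrans" where
  "whisker C t F = \<lparr>nsrc = comp_fctr C (nsrc t) F, ntgt = comp_fctr C (ntgt t) F,
     cpt = compose (ob C) (cpt t) (fob F)\<rparr>"


section \<open>Limits and subobject classifiers\<close>

record ('o, 'p, 'b) cone =
  apex :: "'p"
  leg :: "'o \<Rightarrow> 'b"

definition is_cone ::
  "('o, 'a) cat \<Rightarrow> ('p, 'b) cat \<Rightarrow> ('o, 'a, 'p, 'b) fctr \<Rightarrow> ('o, 'p, 'b) cone \<Rightarrow> bool" where
  "is_cone J E X c \<longleftrightarrow> apex c \<in> ob E \<and> (\<forall>j \<in> ob J. leg c j \<in> hom E (apex c) (fob X j)) \<and>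
     (\<forall>f \<in> ar J. far X f \<cdot>\<^bsub>E\<^esub> leg c (src J f) = leg c (tgt J f))"

definition is_limit ::
  "('o, 'a) cat \<Rightarrow> ('p, 'b) cat \<Rightarrow> ('o, 'a, 'p, 'b) fctr \<Rightarrow> ('o, 'p, 'b) cone \<Rightarrow> bool" where
  "is_limit J E X c \<longleftrightarrow> is_cone J E X c \<and>
     (\<forall>d. is_cone J E X d \<longrightarrow>
        (\<exists>!h. h \<in> hom E (apex d) (apex c) \<and> (\<forall>j \<in> ob J. leg c j \<cdot>\<^bsub>E\<^esub> h = leg d j)))"

definition limit_choice ::
  "('o, 'a) cat \<Rightarrow> ('p, 'b) cat \<Rightarrow> (('o, 'a, 'p, 'b) fctr \<Rightarrow> ('o, 'p, 'b) cone) \<Rightarrow> bool" where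
  "limit_choice J E l \<longleftrightarrow> (\<forall>X. is_functor J E X \<longrightarrow> is_limit J E X (l X))"

text \<open>Every finite category is isomorphic to one whose objects and arrows are natural numbers.\<close>

definition has_finite_limits :: "('p, 'b) cat \<Rightarrow> bool" where
  "has_finite_limits E \<longleftrightarrow>
     (\<forall>J :: (nat, nat) cat. category J \<longrightarrow> finite (ob J) \<longrightarrow> finite (ar J) \<longrightarrow>
        (\<forall>X. is_functor J E X \<longrightarrow> (\<exists>c. is_limit J E X c)))"

definition is_terminal :: "('o, 'a) cat \<Rightarrow> 'o \<Rightarrow> bool" where
  "is_terminal C t \<longleftrightarrow> t \<in> ob C \<and> (\<forall>x \<in> ob C. \<exists>!f. f \<in> hom C x t)"

definition bang :: "('o, 'a) cat \<Rightarrow> 'o \<Rightarrow> 'o \<Rightarrow> 'a" where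
  "bang C x t = (THE f. f \<in> hom C x t)"

definition is_mono :: "('o, 'a) cat \<Rightarrow> 'a \<Rightarrow> bool" where
  "is_mono C m \<longleftrightarrow> m \<in> ar C \<and>
     (\<forall>x. \<forall>f \<in> hom C x (src C m). \<forall>g \<in> hom C x (src C m). m \<cdot>\<^bsub>C\<^esub> f = m \<cdot>\<^bsub>C\<^esub> g \<longrightarrow> f = g)"

text \<open>\<open>is_pullback C p q f g\<close>: the square \<open>f \<cdot> p = g \<cdot> q\<close> is a pullback.\<close>

definition is_pullback :: "('o, 'a) cat \<Rightarrow> 'a \<Rightarrow> 'a \<Rightarrow> 'a \<Rightarrow> 'a \<Rightarrow> bool" where
  "is_pullback C p q f g \<longleftrightarrow>
     p \<in> ar C \<and> q \<in> ar C \<and> f \<in> ar C \<and> g \<in> ar C \<and>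
     src C p = src C q \<and> tgt C p = src C f \<and> tgt C q = src C g \<and> tgt C f = tgt C g \<and>
     f \<cdot>\<^bsub>C\<^esub> p = g \<cdot>\<^bsub>C\<^esub> q \<and>
     (\<forall>x. \<forall>a \<in> hom C x (src C f). \<forall>b \<in> hom C x (src C g). f \<cdot>\<^bsub>C\<^esub> a = g \<cdot>\<^bsub>C\<^esub> b \<longrightarrow>
        (\<exists>!h. h \<in> hom C x (src C p) \<and> p \<cdot>\<^bsub>C\<^esub> h = a \<and> q \<cdot>\<^bsub>C\<^esub> h = b))"

definition is_equaliser :: "('o, 'a) cat \<Rightarrow> 'a \<Rightarrow> 'a \<Rightarrow> 'a \<Rightarrow> bool" where
  "is_equaliser C e f g \<longleftrightarrow>
     e \<in> ar C \<and> f \<in> ar C \<and> g \<in> ar C \<and>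
     src C f = tgt C e \<and> src C g = tgt C e \<and> tgt C f = tgt C g \<and> f \<cdot>\<^bsub>C\<^esub> e = g \<cdot>\<^bsub>C\<^esub> e \<and>
     (\<forall>x. \<forall>a \<in> hom C x (tgt C e). f \<cdot>\<^bsub>C\<^esub> a = g \<cdot>\<^bsub>C\<^esub> a \<longrightarrow>
        (\<exists>!h. h \<in> hom C x (src C e) \<and> e \<cdot>\<^bsub>C\<^esub> h = a))"

record ('o, 'a) span =
  vertex :: "'o"
  pr1 :: "'a"
  pr2 :: "'a"

definition is_product :: "('o, 'a) cat \<Rightarrow> 'o \<Rightarrow> 'o \<Rightarrow> ('o, 'a) span \<Rightarrow> bool" where
  "is_product C x y s \<longleftrightarrow> vertex s \<in> ob C \<and> pr1 s \<in> hom C (vertex s) x \<and> pr2 s \<in> hom C (vertex s) y \<and>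
     (\<forall>z. \<forall>a \<in> hom C z x. \<forall>b \<in> hom C z y.
        (\<exists>!h. h \<in> hom C z (vertex s) \<and> pr1 s \<cdot>\<^bsub>C\<^esub> h = a \<and> pr2 s \<cdot>\<^bsub>C\<^esub> h = b))"

definition pairing :: "('o, 'a) cat \<Rightarrow> ('o, 'a) span \<Rightarrow> 'a \<Rightarrow> 'a \<Rightarrow> 'a" where
  "pairing C s a b =
     (THE h. h \<in> hom C (src C a) (vertex s) \<and> pr1 s \<cdot>\<^bsub>C\<^esub> h = a \<and> pr2 s \<cdot>\<^bsub>C\<^esub> h = b)"

text \<open>\<open>prod_map C s s' f g\<close> is \<open>f \<times> g\<close>, from the product \<open>s\<close> to the product \<open>s'\<close>.\<close>

definition prod_map :: "('o, 'a) cat \<Rightarrow> ('o, 'a) span \<Rightarrow> ('o, 'a) span \<Rightarrow> 'a \<Rightarrow> 'a \<Rightarrow> 'a" where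
  "prod_map C s s' f g = pairing C s' (f \<cdot>\<^bsub>C\<^esub> pr1 s) (g \<cdot>\<^bsub>C\<^esub> pr2 s)"

definition span_at ::
  "(('o, 'a, 'p, 'b) fctr, ('o, 'a, 'p, 'b) ntrans) span \<Rightarrow> 'o \<Rightarrow> ('p, 'b) span" where
  "span_at s i = \<lparr>vertex = fob (vertex s) i, pr1 = cpt (pr1 s) i, pr2 = cpt (pr2 s) i\<rparr>"

text \<open>The domain \<open>one\<close> of the truth map may be any terminal object.\<close>

definition classifies :: "('o, 'a) cat \<Rightarrow> 'o \<Rightarrow> 'o \<Rightarrow> 'a \<Rightarrow> 'a \<Rightarrow> 'a \<Rightarrow> bool" where
  "classifies C one Om tr m k \<longleftrightarrow>
     k \<in> hom C (tgt C m) Om \<and> is_pullback C m (bang C (src C m) one) k tr"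

definition subobject_classifier :: "('o, 'a) cat \<Rightarrow> 'o \<Rightarrow> 'o \<Rightarrow> 'a \<Rightarrow> bool" where
  "subobject_classifier C one Om tr \<longleftrightarrow>
     is_terminal C one \<and> Om \<in> ob C \<and> tr \<in> hom C one Om \<and>
     (\<forall>m. is_mono C m \<longrightarrow> (\<exists>!k. classifies C one Om tr m k))"

definition char_map :: "('o, 'a) cat \<Rightarrow> 'o \<Rightarrow> 'o \<Rightarrow> 'a \<Rightarrow> 'a \<Rightarrow> 'a" where
  "char_map C one Om tr m = (THE k. classifies C one Om tr m k)"

definition meet :: "('o, 'a) cat \<Rightarrow> 'o \<Rightarrow> 'o \<Rightarrow> 'a \<Rightarrow> ('o, 'a) span \<Rightarrow> 'a" where
  "meet C one Om tr s = char_map C one Om tr (pairing C s tr tr)"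


section \<open>Set-valued functors, categories of elements, collages\<close>

record 'u setmap =
  sdom :: "'u set"
  scod :: "'u set"
  sfun :: "'u \<Rightarrow> 'u"

definition set_cat :: "('u set, 'u setmap) cat" where
  "set_cat = \<lparr>ob = UNIV, ar = {s. sfun s \<in> sdom s \<rightarrow>\<^sub>E scod s}, src = sdom, tgt = scod,
     idt = (\<lambda>A. \<lparr>sdom = A, scod = A, sfun = \<lambda>x\<in>A. x\<rparr>),
     cmp = (\<lambda>t s. \<lparr>sdom = sdom s, scod = scod t, sfun = compose (sdom s) (sfun t) (sfun s)\<rparr>)\<rparr>"

definition elements ::
  "('o, 'a) cat \<Rightarrow> ('o, 'a, 'u set, 'u setmap) fctr
    \<Rightarrow> ('o \<times> 'u, ('o \<times> 'u) \<times> 'a \<times> ('o \<times> 'u)) cat" where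
  "elements C W = \<lparr>ob = {(x, u). x \<in> ob C \<and> u \<in> fob W x},
     ar = {((x, u), f, (y, v)). f \<in> hom C x y \<and> u \<in> fob W x \<and> v = sfun (far W f) u},
     src = (\<lambda>(p, f, q). p), tgt = (\<lambda>(p, f, q). q),
     idt = (\<lambda>(x, u). ((x, u), idt C x, (x, u))),
     cmp = (\<lambda>(_, g, r) (p, f, _). (p, g \<cdot>\<^bsub>C\<^esub> f, r))\<rparr>"

definition elements_proj ::
  "('o, 'a) cat \<Rightarrow> ('o, 'a, 'u set, 'u setmap) fctr
    \<Rightarrow> ('o \<times> 'u, ('o \<times> 'u) \<times> 'a \<times> ('o \<times> 'u), 'o, 'a) fctr" where
  "elements_proj C W = \<lparr>fob = restrict fst (ob (elements C W)),
     far = restrict (\<lambda>(p, f, q). f) (ar (elements C W))\<rparr>"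

text \<open>A profunctor \<open>W : A\<^sup>o\<^sup>p \<times> B \<rightarrow> Set\<close> is a functor on \<open>prod_cat (op_cat A) B\<close>.\<close>

type_synonym ('d, 'e, 'j, 'k, 'u) profctr = "('d \<times> 'j, 'e \<times> 'k, 'u set, 'u setmap) fctr"

definition profctr_at ::
  "('d, 'e) cat \<Rightarrow> ('j, 'k) cat \<Rightarrow> ('d, 'e, 'j, 'k, 'u) profctr \<Rightarrow> 'd
    \<Rightarrow> ('j, 'k, 'u set, 'u setmap) fctr" where
  "profctr_at A B W i = \<lparr>fob = \<lambda>j\<in>ob B. fob W (i, j), far = \<lambda>g\<in>ar B. far W (idt A i, g)\<rparr>"

text \<open>\<open>Het i j u\<close> is the element \<open>u\<close> of \<open>W(i, j)\<close> regarded as an arrow from \<open>i\<close> to \<open>j\<close>.\<close>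

datatype ('d, 'e, 'j, 'k, 'u) collage_ar = Base 'k | Bdry 'e | Het 'd 'j 'u

fun collage_src :: "('d, 'e) cat \<Rightarrow> ('j, 'k) cat \<Rightarrow> ('d, 'e, 'j, 'k, 'u) collage_ar \<Rightarrow> 'j + 'd" where
  "collage_src A B (Base g) = Inl (src B g)"
| "collage_src A B (Bdry f) = Inr (src A f)"
| "collage_src A B (Het i j u) = Inr i"

fun collage_tgt :: "('d, 'e) cat \<Rightarrow> ('j, 'k) cat \<Rightarrow> ('d, 'e, 'j, 'k, 'u) collage_ar \<Rightarrow> 'j + 'd" where
  "collage_tgt A B (Base g) = Inl (tgt B g)"
| "collage_tgt A B (Bdry f) = Inr (tgt A f)"
| "collage_tgt A B (Het i j u) = Inl j"

fun collage_idt :: "('d, 'e) cat \<Rightarrow> ('j, 'k) cat \<Rightarrow> 'j + 'd \<Rightarrow> ('d, 'e, 'j, 'k, 'u) collage_ar" where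
  "collage_idt A B (Inl j) = Base (idt B j)"
| "collage_idt A B (Inr i) = Bdry (idt A i)"

fun collage_cmp ::
  "('d, 'e) cat \<Rightarrow> ('j, 'k) cat \<Rightarrow> ('d, 'e, 'j, 'k, 'u) profctr \<Rightarrow> ('d, 'e, 'j, 'k, 'u) collage_ar
    \<Rightarrow> ('d, 'e, 'j, 'k, 'u) collage_ar \<Rightarrow> ('d, 'e, 'j, 'k, 'u) collage_ar" where
  "collage_cmp A B W (Base g) (Base f) = Base (g \<cdot>\<^bsub>B\<^esub> f)"
| "collage_cmp A B W (Bdry g) (Bdry f) = Bdry (g \<cdot>\<^bsub>A\<^esub> f)"
| "collage_cmp A B W (Base g) (Het i j u) = Het i (tgt B g) (sfun (far W (idt A i, g)) u)"
| "collage_cmp A B W (Het i j u) (Bdry f) = Het (src A f) j (sfun (far W (f, idt B j)) u)"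
| "collage_cmp A B W _ _ = undefined"

definition collage ::
  "('d, 'e) cat \<Rightarrow> ('j, 'k) cat \<Rightarrow> ('d, 'e, 'j, 'k, 'u) profctr
    \<Rightarrow> ('j + 'd, ('d, 'e, 'j, 'k, 'u) collage_ar) cat" where
  "collage A B W = \<lparr>ob = Inl ` ob B \<union> Inr ` ob A,
     ar = Base ` ar B \<union> Bdry ` ar A \<union> {Het i j u | i j u. i \<in> ob A \<and> j \<in> ob B \<and> u \<in> fob W (i, j)},
     src = collage_src A B, tgt = collage_tgt A B,
     idt = collage_idt A B, cmp = collage_cmp A B W\<rparr>"

definition collage_base :: "('j, 'k) cat \<Rightarrow> ('j, 'k, 'j + 'd, ('d, 'e, 'j, 'k, 'u) collage_ar) fctr" where
  "collage_base B = \<lparr>fob = restrict Inl (ob B), far = restrict Base (ar B)\<rparr>"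

definition collage_bdry :: "('d, 'e) cat \<Rightarrow> ('d, 'e, 'j + 'd, ('d, 'e, 'j, 'k, 'u) collage_ar) fctr" where
  "collage_bdry A = \<lparr>fob = restrict Inr (ob A), far = restrict Bdry (ar A)\<rparr>"


section \<open>Colimits of categories\<close>

definition is_cat_diagram ::
  "('j, 'k) cat \<Rightarrow> ('j \<Rightarrow> ('o, 'a) cat) \<Rightarrow> ('k \<Rightarrow> ('o, 'a, 'o, 'a) fctr) \<Rightarrow> bool" where
  "is_cat_diagram J D T \<longleftrightarrow>
     (\<forall>j \<in> ob J. category (D j)) \<and>
     (\<forall>a \<in> ar J. is_functor (D (src J a)) (D (tgt J a)) (T a)) \<and>
     (\<forall>j \<in> ob J. T (idt J j) = id_fctr (D j)) \<and>
     (\<forall>a \<in> ar J. \<forall>b \<in> ar J. src J b = tgt J a \<longrightarrow>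
        T (b \<cdot>\<^bsub>J\<^esub> a) = comp_fctr (D (src J a)) (T b) (T a))"

text \<open>
  The colimit of a diagram \<open>D\<close> of categories with transition functors \<open>T\<close>, up to isomorphism:
  its objects are the objects \<open>(j, x)\<close> of the \<open>D j\<close> modulo the equivalence relation generated
  by the transition functors, and its arrows are paths of arrows \<open>(j, f)\<close> of the \<open>D j\<close>
  (listed in diagrammatic order) modulo the congruence generated by the transition functors and
  by the identities and composites of the \<open>D j\<close>.  Its universal property is proved below.
\<close>

inductive colim_eq ::
  "('j, 'k) cat \<Rightarrow> ('j \<Rightarrow> ('o, 'a) cat) \<Rightarrow> ('k \<Rightarrow> ('o, 'a, 'o, 'a) fctr) \<Rightarrow> 'j \<times> 'o \<Rightarrow> 'j \<times> 'o \<Rightarrow> bool"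
  for J D T where
  colim_eq_refl: "\<lbrakk>j \<in> ob J; x \<in> ob (D j)\<rbrakk> \<Longrightarrow> colim_eq J D T (j, x) (j, x)"
| colim_eq_step: "\<lbrakk>a \<in> ar J; x \<in> ob (D (src J a))\<rbrakk>
    \<Longrightarrow> colim_eq J D T (src J a, x) (tgt J a, fob (T a) x)"
| colim_eq_sym: "colim_eq J D T p q \<Longrightarrow> colim_eq J D T q p"
| colim_eq_trans: "\<lbrakk>colim_eq J D T p q; colim_eq J D T q r\<rbrakk> \<Longrightarrow> colim_eq J D T p r"

type_synonym ('j, 'o) colim_ob = "('j \<times> 'o) set"

definition colim_cls ::
  "('j, 'k) cat \<Rightarrow> ('j \<Rightarrow> ('o, 'a) cat) \<Rightarrow> ('k \<Rightarrow> ('o, 'a, 'o, 'a) fctr) \<Rightarrow> 'j \<times> 'o \<Rightarrow> ('j, 'o) colim_ob" where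
  "colim_cls J D T p = {q. colim_eq J D T p q}"

fun colim_path ::
  "('j, 'k) cat \<Rightarrow> ('j \<Rightarrow> ('o, 'a) cat) \<Rightarrow> ('k \<Rightarrow> ('o, 'a, 'o, 'a) fctr)
    \<Rightarrow> ('j, 'o) colim_ob \<Rightarrow> ('j \<times> 'a) list \<Rightarrow> ('j, 'o) colim_ob \<Rightarrow> bool" where
  "colim_path J D T A [] B \<longleftrightarrow> A = B \<and> (\<exists>j \<in> ob J. \<exists>x \<in> ob (D j). A = colim_cls J D T (j, x))"
| "colim_path J D T A ((j, f) # ws) B \<longleftrightarrow> j \<in> ob J \<and> f \<in> ar (D j) \<and>
     A = colim_cls J D T (j, src (D j) f) \<and> colim_path J D T (colim_cls J D T (j, tgt (D j) f)) ws B"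

inductive colim_rel ::
  "('j, 'k) cat \<Rightarrow> ('j \<Rightarrow> ('o, 'a) cat) \<Rightarrow> ('k \<Rightarrow> ('o, 'a, 'o, 'a) fctr)
    \<Rightarrow> ('j \<times> 'a) list \<Rightarrow> ('j \<times> 'a) list \<Rightarrow> bool"
  for J D T where
  colim_rel_idt: "\<lbrakk>j \<in> ob J; x \<in> ob (D j)\<rbrakk> \<Longrightarrow> colim_rel J D T [(j, idt (D j) x)] []"
| colim_rel_cmp: "\<lbrakk>j \<in> ob J; f \<in> ar (D j); g \<in> ar (D j); src (D j) g = tgt (D j) f\<rbrakk>
    \<Longrightarrow> colim_rel J D T [(j, f), (j, g)] [(j, g \<cdot>\<^bsub>D j\<^esub> f)]"
| colim_rel_trans: "\<lbrakk>a \<in> ar J; f \<in> ar (D (src J a))\<rbrakk>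
    \<Longrightarrow> colim_rel J D T [(src J a, f)] [(tgt J a, far (T a) f)]"

inductive colim_cong ::
  "('j, 'k) cat \<Rightarrow> ('j \<Rightarrow> ('o, 'a) cat) \<Rightarrow> ('k \<Rightarrow> ('o, 'a, 'o, 'a) fctr)
    \<Rightarrow> ('j, 'o) colim_ob \<Rightarrow> ('j, 'o) colim_ob \<Rightarrow> ('j \<times> 'a) list \<Rightarrow> ('j \<times> 'a) list \<Rightarrow> bool"
  for J D T A B where
  colim_cong_refl: "colim_path J D T A ws B \<Longrightarrow> colim_cong J D T A B ws ws"
| colim_cong_step: "\<lbrakk>colim_path J D T A (us @ l @ vs) B; colim_rel J D T l r\<rbrakk>
    \<Longrightarrow> colim_cong J D T A B (us @ l @ vs) (us @ r @ vs)"
| colim_cong_sym: "colim_cong J D T A B vs ws \<Longrightarrow> colim_cong J D T A B ws vs"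
| colim_cong_trans: "\<lbrakk>colim_cong J D T A B us vs; colim_cong J D T A B vs ws\<rbrakk>
    \<Longrightarrow> colim_cong J D T A B us ws"

text \<open>An arrow of the colimit is a triple of its source, its target and its congruence class.\<close>

type_synonym ('j, 'o, 'a) colim_ar = "('j, 'o) colim_ob \<times> ('j, 'o) colim_ob \<times> ('j \<times> 'a) list set"

definition colim_mk ::
  "('j, 'k) cat \<Rightarrow> ('j \<Rightarrow> ('o, 'a) cat) \<Rightarrow> ('k \<Rightarrow> ('o, 'a, 'o, 'a) fctr)
    \<Rightarrow> ('j, 'o) colim_ob \<Rightarrow> ('j, 'o) colim_ob \<Rightarrow> ('j \<times> 'a) list \<Rightarrow> ('j, 'o, 'a) colim_ar" where
  "colim_mk J D T A B ws = (A, B, {vs. colim_cong J D T A B ws vs})"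

definition colim_cat ::
  "('j, 'k) cat \<Rightarrow> ('j \<Rightarrow> ('o, 'a) cat) \<Rightarrow> ('k \<Rightarrow> ('o, 'a, 'o, 'a) fctr)
    \<Rightarrow> (('j, 'o) colim_ob, ('j, 'o, 'a) colim_ar) cat" where
  "colim_cat J D T = \<lparr>ob = {colim_cls J D T (j, x) | j x. j \<in> ob J \<and> x \<in> ob (D j)},
     ar = {colim_mk J D T A B ws | A B ws. colim_path J D T A ws B},
     src = (\<lambda>(A, B, c). A), tgt = (\<lambda>(A, B, c). B),
     idt = (\<lambda>A. colim_mk J D T A A []),
     cmp = (\<lambda>(_, B, d) (A, _, c).
       (A, B, {ws. \<exists>us \<in> c. \<exists>vs \<in> d. colim_cong J D T A B (us @ vs) ws}))\<rparr>"

definition colim_in ::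
  "('j, 'k) cat \<Rightarrow> ('j \<Rightarrow> ('o, 'a) cat) \<Rightarrow> ('k \<Rightarrow> ('o, 'a, 'o, 'a) fctr) \<Rightarrow> 'j
    \<Rightarrow> ('o, 'a, ('j, 'o) colim_ob, ('j, 'o, 'a) colim_ar) fctr" where
  "colim_in J D T j = \<lparr>fob = \<lambda>x\<in>ob (D j). colim_cls J D T (j, x),
     far = \<lambda>f\<in>ar (D j). colim_mk J D T (colim_cls J D T (j, src (D j) f))
       (colim_cls J D T (j, tgt (D j) f)) [(j, f)]\<rparr>"


context
  fixes J :: "('j, 'k) cat" and D :: "'j \<Rightarrow> ('o, 'a) cat" and T :: "'k \<Rightarrow> ('o, 'a, 'o, 'a) fctr"
  assumes J: "category J" and diag: "is_cat_diagram J D T"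
begin

lemma diag_cat: "j \<in> ob J \<Longrightarrow> category (D j)"
  using diag by (auto simp: is_cat_diagram_def)

lemma diag_fctr: "a \<in> ar J \<Longrightarrow> is_functor (D (src J a)) (D (tgt J a)) (T a)"
  using diag by (auto simp: is_cat_diagram_def)

lemma colim_eq_ob: "colim_eq J D T p q \<Longrightarrow>
    fst p \<in> ob J \<and> snd p \<in> ob (D (fst p)) \<and> fst q \<in> ob J \<and> snd q \<in> ob (D (fst q))"
proof (induction rule: colim_eq.induct)
  case (colim_eq_step a x)
  then show ?case
    using diag_fctr[of a] category.src_ob[OF J] category.tgt_ob[OF J]
    by (auto simp: is_functor_def)
qed auto

lemma colim_cls_eq_iff: "\<lbrakk>j \<in> ob J; x \<in> ob (D j)\<rbrakk> \<Longrightarrow>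
    colim_cls J D T (j, x) = colim_cls J D T q \<longleftrightarrow> colim_eq J D T (j, x) q"
  unfolding colim_cls_def
  by (smt (verit, best) Collect_cong colim_eq_refl colim_eq_sym colim_eq_trans mem_Collect_eq)

lemma colim_cls_tran: "\<lbrakk>a \<in> ar J; x \<in> ob (D (src J a))\<rbrakk> \<Longrightarrow>
    colim_cls J D T (tgt J a, fob (T a) x) = colim_cls J D T (src J a, x)"
  using colim_cls_eq_iff category.src_ob[OF J] colim_eq_step by metis

lemma diag_src_tgt:
  assumes "a \<in> ar J" "f \<in> ar (D (src J a))"
  shows "far (T a) f \<in> ar (D (tgt J a))"
    "src (D (tgt J a)) (far (T a) f) = fob (T a) (src (D (src J a)) f)"
    "tgt (D (tgt J a)) (far (T a) f) = fob (T a) (tgt (D (src J a)) f)"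
  using diag_fctr[OF assms(1)] assms(2) by (auto simp: is_functor_def hom_def)

lemma colim_path_append: "colim_path J D T A (us @ vs) C \<longleftrightarrow>
    (\<exists>B. colim_path J D T A us B \<and> colim_path J D T B vs C)"
proof (induction us arbitrary: A)
  case Nil
  have "colim_path J D T A vs C \<Longrightarrow> \<exists>j \<in> ob J. \<exists>x \<in> ob (D j). A = colim_cls J D T (j, x)"
    by (cases vs) (auto, metis category.src_ob diag_cat)
  then show ?case by auto
next
  case (Cons w us)
  then show ?case by (cases w) auto
qed

lemma colim_path_ob:
  assumes "colim_path J D T A ws B"
  shows "A \<in> ob (colim_cat J D T)" "B \<in> ob (colim_cat J D T)"
proof -
  have "A \<in> ob (colim_cat J D T) \<and> B \<in> ob (colim_cat J D T)"
    using assms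
  proof (induction ws arbitrary: A)
    case Nil
    then show ?case by (auto simp: colim_cat_def)
  next
    case (Cons w ws)
    then show ?case
      by (cases w) (auto simp: colim_cat_def, metis category.src_ob diag_cat)
  qed
  then show "A \<in> ob (colim_cat J D T)" "B \<in> ob (colim_cat J D T)" by auto
qed

lemma colim_rel_path:
  assumes "colim_rel J D T l r"  "colim_path J D T A l B"
  shows "colim_path J D T A r B"
  using assms
proof (cases rule: colim_rel.cases)
  case (colim_rel_idt j x)
  then show ?thesis
    using assms(2) category.idt_hom[OF diag_cat, of j x] by (auto simp: hom_def)
next
  case (colim_rel_cmp j f g)
  then have "g \<cdot>\<^bsub>D j\<^esub> f \<in> hom (D j) (src (D j) f) (tgt (D j) g)"
    by (intro category.cmp_hom[OF diag_cat]) (auto simp: hom_def)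
  then show ?thesis
    using assms(2) colim_rel_cmp by (auto simp: hom_def)
next
  case (colim_rel_trans a f)
  have c: "category (D (src J a))"
    by (simp add: J category.src_ob diag_cat colim_rel_trans)
  show ?thesis
    using assms(2) colim_rel_trans diag_src_tgt[of a f] category.tgt_ob[OF J]
      colim_cls_tran[of a] category.src_ob[OF c] category.tgt_ob[OF c]
    by (auto intro!: bexI[of _ "tgt J a"])
qed

lemma colim_cong_path:
  "colim_cong J D T A B us vs \<Longrightarrow> colim_path J D T A us B \<and> colim_path J D T A vs B"
proof (induction rule: colim_cong.induct)
  case (colim_cong_step us l vs r)
  then show ?case
    by (auto simp: colim_path_append) (metis colim_rel_path)
qed auto

lemma colim_cong_append_right:
  assumes "colim_cong J D T A B us vs" "colim_path J D T B ws C"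
  shows "colim_cong J D T A C (us @ ws) (vs @ ws)"
  using assms
proof (induction rule: colim_cong.induct)
  case (colim_cong_refl us)
  then show ?case by (metis colim_cong.colim_cong_refl colim_path_append)
next
  case (colim_cong_step us l vs r)
  then have "colim_path J D T A (us @ l @ (vs @ ws)) C"
    by (metis append.assoc colim_path_append)
  from colim_cong.colim_cong_step[OF this colim_cong_step(2)] show ?case by simp
next
  case (colim_cong_sym vs ws)
  then show ?case by (metis colim_cong.colim_cong_sym)
next
  case (colim_cong_trans us vs ws)
  then show ?case by (metis colim_cong.colim_cong_trans)
qed

lemma colim_cong_append_left:
  assumes "colim_cong J D T B C us vs" "colim_path J D T A ws B"
  shows "colim_cong J D T A C (ws @ us) (ws @ vs)"
  using assms
proof (induction rule: colim_cong.induct)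
  case (colim_cong_refl us)
  then show ?case by (metis colim_cong.colim_cong_refl colim_path_append)
next
  case (colim_cong_step us l vs r)
  then have "colim_path J D T A ((ws @ us) @ l @ vs) C"
    by (metis append.assoc colim_path_append)
  from colim_cong.colim_cong_step[OF this colim_cong_step(2)] show ?case by simp
next
  case (colim_cong_sym vs ws)
  then show ?case by (metis colim_cong.colim_cong_sym)
next
  case (colim_cong_trans us vs ws)
  then show ?case by (metis colim_cong.colim_cong_trans)
qed

lemma colim_mk_eq: "colim_cong J D T A B us vs \<Longrightarrow> colim_mk J D T A B us = colim_mk J D T A B vs"
  unfolding colim_mk_def by (auto intro: colim_cong_sym colim_cong_trans)

lemma colim_mk_cong: "colim_path J D T A us B \<Longrightarrow>
    colim_mk J D T A B us = colim_mk J D T A B vs \<Longrightarrow> colim_cong J D T A B us vs"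
  unfolding colim_mk_def using colim_cong_sym colim_cong_refl
  by (metis (mono_tags, lifting) mem_Collect_eq prod.inject)

lemma colim_ar_cases:
  assumes "w \<in> hom (colim_cat J D T) A B"
  obtains ws where "colim_path J D T A ws B" "w = colim_mk J D T A B ws"
  using assms by (auto simp: hom_def colim_cat_def colim_mk_def)

lemma colim_arE:
  assumes "w \<in> ar (colim_cat J D T)"
  obtains ws where "colim_path J D T (src (colim_cat J D T) w) ws (tgt (colim_cat J D T) w)"
    "w = colim_mk J D T (src (colim_cat J D T) w) (tgt (colim_cat J D T) w) ws"
  using assms colim_ar_cases[of w "src (colim_cat J D T) w" "tgt (colim_cat J D T) w"]
  by (auto simp: hom_def)

lemma colim_mk_hom: "colim_path J D T A ws B \<Longrightarrow> colim_mk J D T A B ws \<in> hom (colim_cat J D T) A B"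
  by (auto simp: hom_def colim_cat_def colim_mk_def)

lemma colim_mk_cmp:
  assumes "colim_path J D T A us B" "colim_path J D T B vs C"
  shows "colim_mk J D T B C vs \<cdot>\<^bsub>colim_cat J D T\<^esub> colim_mk J D T A B us = colim_mk J D T A C (us @ vs)"
proof -
  have "(\<exists>us' vs'. colim_cong J D T A B us us' \<and> colim_cong J D T B C vs vs' \<and>
      colim_cong J D T A C (us' @ vs') ws) \<longleftrightarrow> colim_cong J D T A C (us @ vs) ws" for ws
    using assms colim_cong_append_left colim_cong_append_right colim_cong_path
      colim_cong_refl colim_cong_trans by meson
  then show ?thesis by (auto simp: colim_cat_def colim_mk_def)
qed

lemma colim_path_Nil: "A \<in> ob (colim_cat J D T) \<Longrightarrow> colim_path J D T A [] A"
  by (auto simp: colim_cat_def)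

lemma colim_idt: "idt (colim_cat J D T) A = colim_mk J D T A A []"
  by (simp add: colim_cat_def)

theorem colim_category: "category (colim_cat J D T)"
proof
  fix w assume w: "w \<in> ar (colim_cat J D T)"
  then have "w \<in> hom (colim_cat J D T) (src (colim_cat J D T) w) (tgt (colim_cat J D T) w)"
    by (simp add: hom_def)
  then show "src (colim_cat J D T) w \<in> ob (colim_cat J D T)"
    "tgt (colim_cat J D T) w \<in> ob (colim_cat J D T)"
    by (metis colim_ar_cases colim_path_ob)+
next
  fix A assume "A \<in> ob (colim_cat J D T)"
  then show "idt (colim_cat J D T) A \<in> hom (colim_cat J D T) A A"
    by (simp only: colim_idt colim_mk_hom colim_path_Nil)
next
  fix v w A B C assume "v \<in> hom (colim_cat J D T) A B" "w \<in> hom (colim_cat J D T) B C"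
  then show "w \<cdot>\<^bsub>colim_cat J D T\<^esub> v \<in> hom (colim_cat J D T) A C"
    by (metis colim_ar_cases colim_mk_cmp colim_mk_hom colim_path_append)
next
  fix w A B assume w: "w \<in> hom (colim_cat J D T) A B"
  then obtain ws where *: "colim_path J D T A ws B" "w = colim_mk J D T A B ws"
    by (rule colim_ar_cases)
  from * colim_path_Nil[OF colim_path_ob(2)] show "idt (colim_cat J D T) B \<cdot>\<^bsub>colim_cat J D T\<^esub> w = w"
    by (simp add: colim_idt colim_mk_cmp del: colim_path.simps)
  from * colim_path_Nil[OF colim_path_ob(1)] show "w \<cdot>\<^bsub>colim_cat J D T\<^esub> idt (colim_cat J D T) A = w"
    by (simp add: colim_idt colim_mk_cmp del: colim_path.simps)
next
  fix u v w A B C E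
  assume "u \<in> hom (colim_cat J D T) A B" "v \<in> hom (colim_cat J D T) B C"
    "w \<in> hom (colim_cat J D T) C E"
  then obtain us vs ws where *: "colim_path J D T A us B" "u = colim_mk J D T A B us"
    "colim_path J D T B vs C" "v = colim_mk J D T B C vs"
    "colim_path J D T C ws E" "w = colim_mk J D T C E ws"
    by (metis colim_ar_cases)
  moreover have "colim_path J D T A (us @ vs) C" "colim_path J D T B (vs @ ws) E"
    using * colim_path_append by blast+
  ultimately show "(w \<cdot>\<^bsub>colim_cat J D T\<^esub> v) \<cdot>\<^bsub>colim_cat J D T\<^esub> u =
      w \<cdot>\<^bsub>colim_cat J D T\<^esub> (v \<cdot>\<^bsub>colim_cat J D T\<^esub> u)"
    by (simp add: colim_mk_cmp)
qed

lemma colim_path_single: "\<lbrakk>j \<in> ob J; f \<in> ar (D j)\<rbrakk> \<Longrightarrow>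
    colim_path J D T (colim_cls J D T (j, src (D j) f)) [(j, f)] (colim_cls J D T (j, tgt (D j) f))"
  using category.tgt_ob[OF diag_cat] by auto

theorem colim_in_functor:
  assumes j: "j \<in> ob J"
  shows "is_functor (D j) (colim_cat J D T) (colim_in J D T j)"
  unfolding is_functor_def
proof (intro conjI ballI impI)
  show "fob (colim_in J D T j) \<in> ob (D j) \<rightarrow>\<^sub>E ob (colim_cat J D T)"
    using j by (auto simp: colim_in_def colim_cat_def)
  show "far (colim_in J D T j) \<in> extensional (ar (D j))"
    by (simp add: colim_in_def)
next
  fix f assume f: "f \<in> ar (D j)"
  then show "far (colim_in J D T j) f \<in> hom (colim_cat J D T)
      (fob (colim_in J D T j) (src (D j) f)) (fob (colim_in J D T j) (tgt (D j) f))"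
    using colim_mk_hom[OF colim_path_single[OF j f]] category.src_ob[OF diag_cat[OF j] f]
      category.tgt_ob[OF diag_cat[OF j] f]
    by (simp add: colim_in_def)
next
  fix x assume x: "x \<in> ob (D j)"
  have i: "idt (D j) x \<in> ar (D j)" "src (D j) (idt (D j) x) = x" "tgt (D j) (idt (D j) x) = x"
    using category.idt_hom[OF diag_cat[OF j] x] by (auto simp: hom_def)
  have "colim_cong J D T (colim_cls J D T (j, x)) (colim_cls J D T (j, x))
      ([] @ [(j, idt (D j) x)] @ []) ([] @ [] @ [])"
    using colim_path_single[OF j i(1)] i
    by (intro colim_cong_step colim_rel_idt[where D = D, OF j x]) simp
  from colim_mk_eq[OF this] show "far (colim_in J D T j) (idt (D j) x) =
      idt (colim_cat J D T) (fob (colim_in J D T j) x)"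
    using i x by (simp add: colim_in_def colim_idt)
next
  fix f g assume f: "f \<in> ar (D j)" and g: "g \<in> ar (D j)" and fg: "src (D j) g = tgt (D j) f"
  have gf: "g \<cdot>\<^bsub>D j\<^esub> f \<in> hom (D j) (src (D j) f) (tgt (D j) g)"
    using f g fg by (intro category.cmp_hom[OF diag_cat[OF j]]) (auto simp: hom_def)
  let ?A = "colim_cls J D T (j, src (D j) f)" and ?B = "colim_cls J D T (j, tgt (D j) f)"
    and ?C = "colim_cls J D T (j, tgt (D j) g)"
  have p: "colim_path J D T ?A [(j, f)] ?B" "colim_path J D T ?B [(j, g)] ?C"
    using colim_path_single[OF j f] colim_path_single[OF j g] fg by simp_all
  have "colim_path J D T ?A ([(j, f)] @ [(j, g)]) ?C"
    using p colim_path_append by blast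
  then have "colim_cong J D T ?A ?C ([] @ [(j, f), (j, g)] @ []) ([] @ [(j, g \<cdot>\<^bsub>D j\<^esub> f)] @ [])"
    by (intro colim_cong_step colim_rel_cmp[where D = D, OF j f g fg]) simp
  from colim_mk_eq[OF this] colim_mk_cmp[OF p]
  show "far (colim_in J D T j) (g \<cdot>\<^bsub>D j\<^esub> f) =
      far (colim_in J D T j) g \<cdot>\<^bsub>colim_cat J D T\<^esub> far (colim_in J D T j) f"
    using gf f g fg by (simp add: colim_in_def hom_def)
qed

theorem colim_in_cocone:
  assumes a: "a \<in> ar J"
  shows "comp_fctr (D (src J a)) (colim_in J D T (tgt J a)) (T a) = colim_in J D T (src J a)"
proof -
  have s: "src J a \<in> ob J" by (rule category.src_ob[OF J a])
  have t: "fob (T a) x \<in> ob (D (tgt J a))" if "x \<in> ob (D (src J a))" for x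
    using diag_fctr[OF a] that by (auto simp: is_functor_def)
  have "colim_mk J D T (colim_cls J D T (src J a, src (D (src J a)) f))
      (colim_cls J D T (src J a, tgt (D (src J a)) f)) [(tgt J a, far (T a) f)] =
    colim_mk J D T (colim_cls J D T (src J a, src (D (src J a)) f))
      (colim_cls J D T (src J a, tgt (D (src J a)) f)) [(src J a, f)]"
    if f: "f \<in> ar (D (src J a))" for f
    using colim_cong_step[of J D T _ "[]" "[(src J a, f)]" "[]", OF _ colim_rel_trans[where D = D, OF a f]]
      colim_path_single[OF s f] colim_mk_eq by fastforce
  then show ?thesis
    using t diag_src_tgt[OF a] category.src_ob[OF diag_cat[OF s]] category.tgt_ob[OF diag_cat[OF s]]
    by (auto simp: comp_fctr_def colim_in_def compose_def fun_eq_iff colim_cls_tran[OF a] restrict_def)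
qed

context
  fixes K :: "('p, 'b) cat" and F :: "'j \<Rightarrow> ('o, 'a, 'p, 'b) fctr"
  assumes K: "category K"
    and F: "\<And>j. j \<in> ob J \<Longrightarrow> is_functor (D j) K (F j)"
    and cocone: "\<And>a. a \<in> ar J \<Longrightarrow> comp_fctr (D (src J a)) (F (tgt J a)) (T a) = F (src J a)"
begin

lemma cocone_ob: "\<lbrakk>a \<in> ar J; x \<in> ob (D (src J a))\<rbrakk> \<Longrightarrow> fob (F (tgt J a)) (fob (T a) x) = fob (F (src J a)) x"
  using arg_cong[OF cocone, of a "\<lambda>G. fob G x"] by (simp add: comp_fctr_def compose_def)

lemma cocone_ar: "\<lbrakk>a \<in> ar J; f \<in> ar (D (src J a))\<rbrakk> \<Longrightarrow> far (F (tgt J a)) (far (T a) f) = far (F (src J a)) f"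
  using arg_cong[OF cocone, of a "\<lambda>G. far G f"] by (simp add: comp_fctr_def compose_def)

lemma colim_eq_cocone: "colim_eq J D T p q \<Longrightarrow> fob (F (fst p)) (snd p) = fob (F (fst q)) (snd q)"
  by (induction rule: colim_eq.induct) (auto simp: cocone_ob)

definition desc_ob :: "('j, 'o) colim_ob \<Rightarrow> 'p" where
  "desc_ob A = (THE y. \<exists>p \<in> A. y = fob (F (fst p)) (snd p))"

lemma desc_ob_cls: "\<lbrakk>j \<in> ob J; x \<in> ob (D j)\<rbrakk> \<Longrightarrow> desc_ob (colim_cls J D T (j, x)) = fob (F j) x"
  unfolding desc_ob_def colim_cls_def
  by (rule the_equality) (use colim_eq_refl colim_eq_cocone in fastforce)+

fun desc_word :: "('j, 'o) colim_ob \<Rightarrow> ('j \<times> 'a) list \<Rightarrow> 'b" where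
  "desc_word A [] = idt K (desc_ob A)"
| "desc_word A ((j, f) # ws) = desc_word (colim_cls J D T (j, tgt (D j) f)) ws \<cdot>\<^bsub>K\<^esub> far (F j) f"

lemma F_hom: "\<lbrakk>j \<in> ob J; f \<in> ar (D j)\<rbrakk> \<Longrightarrow> far (F j) f \<in> hom K
    (desc_ob (colim_cls J D T (j, src (D j) f))) (desc_ob (colim_cls J D T (j, tgt (D j) f)))"
  using F[of j] category.src_ob[OF diag_cat] category.tgt_ob[OF diag_cat]
  by (simp add: is_functor_def desc_ob_cls)

lemma F_ob: "\<lbrakk>j \<in> ob J; x \<in> ob (D j)\<rbrakk> \<Longrightarrow> fob (F j) x \<in> ob K"
  using F[of j] by (auto simp: is_functor_def)

lemma desc_ob_in: "A \<in> ob (colim_cat J D T) \<Longrightarrow> desc_ob A \<in> ob K"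
  by (auto simp: colim_cat_def desc_ob_cls F_ob)

lemma desc_word_hom: "colim_path J D T A ws B \<Longrightarrow> desc_word A ws \<in> hom K (desc_ob A) (desc_ob B)"
proof (induction ws arbitrary: A)
  case Nil
  then show ?case
    using desc_ob_in[OF colim_path_ob(1)[OF Nil]] category.idt_hom[OF K] by auto
next
  case (Cons w ws)
  then show ?case
    by (cases w) (auto intro!: category.cmp_hom[OF K] F_hom)
qed

lemma desc_word_append: "\<lbrakk>colim_path J D T A us B; colim_path J D T B vs C\<rbrakk> \<Longrightarrow>
    desc_word A (us @ vs) = desc_word B vs \<cdot>\<^bsub>K\<^esub> desc_word A us"
proof (induction us arbitrary: A)
  case Nil
  then show ?case
    using desc_word_hom[OF Nil(2)] category.idt_right[OF K] by auto
next
  case (Cons w us)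
  obtain j f where w: "w = (j, f)" by (cases w)
  let ?M = "colim_cls J D T (j, tgt (D j) f)"
  have *: "j \<in> ob J" "f \<in> ar (D j)" "A = colim_cls J D T (j, src (D j) f)" "colim_path J D T ?M us B"
    using Cons(2) w by auto
  show ?case
    using w Cons(1)[OF *(4) Cons(3)] category.assoc[OF K F_hom[OF *(1,2)] desc_word_hom[OF *(4)] desc_word_hom[OF Cons(3)]]
    by simp
qed

lemma desc_word_single: "\<lbrakk>j \<in> ob J; f \<in> ar (D j)\<rbrakk> \<Longrightarrow> desc_word A [(j, f)] = far (F j) f"
  using category.idt_left[OF K F_hom] by simp

lemma desc_word_rel:
  assumes "colim_rel J D T l r" "colim_path J D T A l B"
  shows "desc_word A l = desc_word A r"
  using assms
proof (cases rule: colim_rel.cases)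
  case (colim_rel_idt j x)
  have i: "idt (D j) x \<in> ar (D j)" "src (D j) (idt (D j) x) = x" "tgt (D j) (idt (D j) x) = x"
    using category.idt_hom[OF diag_cat] colim_rel_idt by (auto simp: hom_def)
  have "far (F j) (idt (D j) x) = idt K (fob (F j) x)"
    using F colim_rel_idt by (auto simp: is_functor_def)
  moreover have "A = colim_cls J D T (j, x)"
    using colim_rel_idt i assms(2) by auto
  moreover have "desc_word A l = far (F j) (idt (D j) x)"
    using colim_rel_idt i desc_word_single by (simp del: desc_word.simps)
  ultimately show ?thesis
    using colim_rel_idt by (simp add: desc_ob_cls)
next
  case (colim_rel_cmp j f g)
  have "g \<cdot>\<^bsub>D j\<^esub> f \<in> hom (D j) (src (D j) f) (tgt (D j) g)"
    using colim_rel_cmp by (intro category.cmp_hom[OF diag_cat]) (auto simp: hom_def)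
  moreover have "far (F j) (g \<cdot>\<^bsub>D j\<^esub> f) = far (F j) g \<cdot>\<^bsub>K\<^esub> far (F j) f"
    using F colim_rel_cmp by (auto simp: is_functor_def)
  moreover have "desc_word A l = desc_word (colim_cls J D T (j, tgt (D j) f)) [(j, g)] \<cdot>\<^bsub>K\<^esub> far (F j) f"
    using colim_rel_cmp by simp
  ultimately show ?thesis
    using colim_rel_cmp desc_word_single by (auto simp: hom_def simp del: desc_word.simps)
next
  case (colim_rel_trans a f)
  then show ?thesis
    using desc_word_single diag_src_tgt(1) cocone_ar category.src_ob[OF J] category.tgt_ob[OF J]
    by (simp del: desc_word.simps)
qed

lemma desc_word_cong: "colim_cong J D T A B us vs \<Longrightarrow> desc_word A us = desc_word A vs"
proof (induction rule: colim_cong.induct)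
  case (colim_cong_step us l vs r)
  then obtain X Y where *: "colim_path J D T A us X" "colim_path J D T X l Y" "colim_path J D T Y vs B"
    by (auto simp: colim_path_append)
  have r: "colim_path J D T X r Y" by (rule colim_rel_path[OF colim_cong_step(2) *(2)])
  have "colim_path J D T X (l @ vs) B" "colim_path J D T X (r @ vs) B"
    using * r colim_path_append by blast+
  then show ?case
    using desc_word_rel[OF colim_cong_step(2) *(2)] * r by (simp add: desc_word_append)
qed auto

definition desc :: "(('j, 'o) colim_ob, ('j, 'o, 'a) colim_ar, 'p, 'b) fctr" where
  "desc = \<lparr>fob = restrict desc_ob (ob (colim_cat J D T)),
     far = (\<lambda>w\<in>ar (colim_cat J D T). desc_word (fst w) (SOME ws. ws \<in> snd (snd w)))\<rparr>"

lemma desc_mk: "colim_path J D T A ws B \<Longrightarrow> far desc (colim_mk J D T A B ws) = desc_word A ws"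
proof -
  assume ws: "colim_path J D T A ws B"
  let ?v = "SOME vs. colim_cong J D T A B ws vs"
  have "colim_cong J D T A B ws ?v"
    using someI[of "\<lambda>vs. colim_cong J D T A B ws vs", OF colim_cong_refl[OF ws]] .
  then show ?thesis
    using colim_mk_hom[OF ws] desc_word_cong by (simp add: desc_def colim_mk_def hom_def)
qed

lemma desc_functor: "is_functor (colim_cat J D T) K desc"
  unfolding is_functor_def
proof (intro conjI ballI impI)
  show "fob desc \<in> ob (colim_cat J D T) \<rightarrow>\<^sub>E ob K"
    using desc_ob_in by (auto simp: desc_def)
  show "far desc \<in> extensional (ar (colim_cat J D T))"
    by (simp add: desc_def)
next
  fix w assume "w \<in> ar (colim_cat J D T)"
  then have "w \<in> hom (colim_cat J D T) (src (colim_cat J D T) w) (tgt (colim_cat J D T) w)"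
    by (simp add: hom_def)
  then obtain ws where "colim_path J D T (src (colim_cat J D T) w) ws (tgt (colim_cat J D T) w)"
    "w = colim_mk J D T (src (colim_cat J D T) w) (tgt (colim_cat J D T) w) ws"
    by (rule colim_ar_cases)
  then show "far desc w \<in> hom K (fob desc (src (colim_cat J D T) w)) (fob desc (tgt (colim_cat J D T) w))"
    using desc_word_hom desc_mk colim_path_ob
    by (metis (no_types, lifting) desc_def fctr.select_convs(1) restrict_apply')
next
  fix A assume A: "A \<in> ob (colim_cat J D T)"
  show "far desc (idt (colim_cat J D T) A) = idt K (fob desc A)"
    using desc_mk[OF colim_path_Nil[OF A]] A by (simp add: colim_idt) (simp add: desc_def)
next
  fix v w assume vw: "v \<in> ar (colim_cat J D T)" "w \<in> ar (colim_cat J D T)"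
    "src (colim_cat J D T) w = tgt (colim_cat J D T) v"
  then obtain vs ws where
    v: "colim_path J D T (src (colim_cat J D T) v) vs (tgt (colim_cat J D T) v)"
       "v = colim_mk J D T (src (colim_cat J D T) v) (tgt (colim_cat J D T) v) vs" and
    w: "colim_path J D T (tgt (colim_cat J D T) v) ws (tgt (colim_cat J D T) w)"
       "w = colim_mk J D T (tgt (colim_cat J D T) v) (tgt (colim_cat J D T) w) ws"
    using colim_arE[OF vw(1)] colim_arE[OF vw(2)] unfolding vw(3) by metis
  have "w \<cdot>\<^bsub>colim_cat J D T\<^esub> v =
      colim_mk J D T (src (colim_cat J D T) v) (tgt (colim_cat J D T) w) (vs @ ws)"
    using colim_mk_cmp[OF v(1) w(1)] v(2) w(2) by simp
  moreover have "colim_path J D T (src (colim_cat J D T) v) (vs @ ws) (tgt (colim_cat J D T) w)"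
    using v w colim_path_append by blast
  ultimately show "far desc (w \<cdot>\<^bsub>colim_cat J D T\<^esub> v) = far desc w \<cdot>\<^bsub>K\<^esub> far desc v"
    using desc_mk desc_word_append v w by metis
qed

lemma desc_in: "j \<in> ob J \<Longrightarrow> comp_fctr (D j) desc (colim_in J D T j) = F j"
proof -
  assume j: "j \<in> ob J"
  have *: "fob (F j) \<in> extensional (ob (D j))" "far (F j) \<in> extensional (ar (D j))"
    using F[OF j] by (auto simp: is_functor_def PiE_def)
  have "compose (ob (D j)) (fob desc) (fob (colim_in J D T j)) = fob (F j)"
  proof (rule extensionalityI[OF compose_extensional *(1)])
    fix x assume x: "x \<in> ob (D j)"
    then have "colim_cls J D T (j, x) \<in> ob (colim_cat J D T)"
      using j by (auto simp: colim_cat_def)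
    then show "compose (ob (D j)) (fob desc) (fob (colim_in J D T j)) x = fob (F j) x"
      using j x by (simp add: compose_def colim_in_def desc_def desc_ob_cls)
  qed
  moreover have "compose (ar (D j)) (far desc) (far (colim_in J D T j)) = far (F j)"
  proof (rule extensionalityI[OF compose_extensional *(2)])
    fix f assume f: "f \<in> ar (D j)"
    show "compose (ar (D j)) (far desc) (far (colim_in J D T j)) f = far (F j) f"
      using desc_mk[OF colim_path_single[OF j f]] desc_word_single[OF j f] f
      by (simp add: compose_def colim_in_def)
  qed
  ultimately show ?thesis by (simp add: comp_fctr_def)
qed

lemma desc_unique:
  assumes H: "is_functor (colim_cat J D T) K H"
    and HF: "\<And>j. j \<in> ob J \<Longrightarrow> comp_fctr (D j) H (colim_in J D T j) = F j"
  shows "H = desc"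
proof -
  have o: "fob H (colim_cls J D T (j, x)) = fob (F j) x" if "j \<in> ob J" "x \<in> ob (D j)" for j x
    using arg_cong[OF HF[OF that(1)], of "\<lambda>G. fob G x"] that
    by (simp add: comp_fctr_def compose_def colim_in_def)
  have ar1: "far H (colim_mk J D T (colim_cls J D T (j, src (D j) f)) (colim_cls J D T (j, tgt (D j) f)) [(j, f)])
      = far (F j) f" if "j \<in> ob J" "f \<in> ar (D j)" for j f
    using arg_cong[OF HF[OF that(1)], of "\<lambda>G. far G f"] that
    by (simp add: comp_fctr_def compose_def colim_in_def)
  have ob_eq: "fob H A = desc_ob A" if "A \<in> ob (colim_cat J D T)" for A
    using that by (auto simp: colim_cat_def o desc_ob_cls)
  have w: "far H (colim_mk J D T A B ws) = desc_word A ws" if "colim_path J D T A ws B" for A B ws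
    using that
  proof (induction ws arbitrary: A)
    case Nil
    then have "A = B" "A \<in> ob (colim_cat J D T)" using colim_path_ob(1)[OF Nil] by auto
    then show ?case using H ob_eq colim_idt by (auto simp: is_functor_def)
  next
    case (Cons w ws)
    obtain j f where w: "w = (j, f)" by (cases w)
    let ?M = "colim_cls J D T (j, tgt (D j) f)"
    have *: "j \<in> ob J" "f \<in> ar (D j)" "A = colim_cls J D T (j, src (D j) f)" "colim_path J D T ?M ws B"
      using Cons(2) w by auto
    have s: "colim_path J D T A [(j, f)] ?M" using colim_path_single * by simp
    have "colim_mk J D T A B (w # ws) = colim_mk J D T ?M B ws \<cdot>\<^bsub>colim_cat J D T\<^esub> colim_mk J D T A ?M [(j, f)]"
      using colim_mk_cmp[OF s *(4)] w by simp
    moreover have "far H (colim_mk J D T ?M B ws \<cdot>\<^bsub>colim_cat J D T\<^esub> colim_mk J D T A ?M [(j, f)]) =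
        far H (colim_mk J D T ?M B ws) \<cdot>\<^bsub>K\<^esub> far H (colim_mk J D T A ?M [(j, f)])"
      using H colim_mk_hom[OF s] colim_mk_hom[OF *(4)] by (auto simp: is_functor_def hom_def)
    ultimately show ?case
      using Cons(1)[OF *(4)] ar1[OF *(1,2)] *(3) w by simp
  qed
  have "fob H = fob desc"
  proof (rule extensionalityI)
    show "fob H \<in> extensional (ob (colim_cat J D T))" "fob desc \<in> extensional (ob (colim_cat J D T))"
      using H desc_functor by (auto simp: is_functor_def PiE_def)
  qed (simp add: ob_eq, simp add: desc_def)
  moreover have "far H = far desc"
  proof (rule extensionalityI)
    show "far H \<in> extensional (ar (colim_cat J D T))" "far desc \<in> extensional (ar (colim_cat J D T))"
      using H desc_functor by (auto simp: is_functor_def)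
    fix v assume "v \<in> ar (colim_cat J D T)"
    then show "far H v = far desc v"
      using w desc_mk by (metis colim_arE)
  qed
  ultimately show ?thesis by simp
qed

end

theorem colim_universal:
  fixes K :: "('p, 'b) cat"
  assumes "category K" "\<And>j. j \<in> ob J \<Longrightarrow> is_functor (D j) K (F j)"
    "\<And>a. a \<in> ar J \<Longrightarrow> comp_fctr (D (src J a)) (F (tgt J a)) (T a) = F (src J a)"
  shows "\<exists>!H. is_functor (colim_cat J D T) K H \<and>
    (\<forall>j \<in> ob J. comp_fctr (D j) H (colim_in J D T j) = F j)"
  using desc_functor[OF assms] desc_in[OF assms] desc_unique[OF assms] by metis

end

section \<open>Matching objects\<close>

text \<open>
  In this section \<open>W\<close> is a profunctor from \<open>A\<close> to \<open>B\<close>, and \<open>l i X\<close> is a chosen limit cone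
  of a diagram \<open>X\<close> indexed by the category of elements of \<open>W(i, -)\<close>.
\<close>

abbreviation elements_at ::
  "('d, 'e) cat \<Rightarrow> ('j, 'k) cat \<Rightarrow> ('d, 'e, 'j, 'k, 'u) profctr \<Rightarrow> 'd
    \<Rightarrow> ('j \<times> 'u, ('j \<times> 'u) \<times> 'k \<times> ('j \<times> 'u)) cat" where
  "elements_at A B W i \<equiv> elements B (profctr_at A B W i)"

type_synonym ('d, 'j, 'k, 'u, 'p, 'b) elements_lims =
  "'d \<Rightarrow> ('j \<times> 'u, ('j \<times> 'u) \<times> 'k \<times> ('j \<times> 'u), 'p, 'b) fctr \<Rightarrow> ('j \<times> 'u, 'p, 'b) cone"

definition matching_cone ::
  "('d, 'e) cat \<Rightarrow> ('j, 'k) cat \<Rightarrow> ('d, 'e, 'j, 'k, 'u) profctr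
    \<Rightarrow> ('d, 'j, 'k, 'u, 'p, 'b) elements_lims \<Rightarrow> ('j, 'k, 'p, 'b) fctr \<Rightarrow> 'd
    \<Rightarrow> ('j \<times> 'u, 'p, 'b) cone" where
  "matching_cone A B W l X i =
     l i (comp_fctr (elements_at A B W i) X (elements_proj B (profctr_at A B W i)))"

definition matching_ob ::
  "('d, 'e) cat \<Rightarrow> ('j, 'k) cat \<Rightarrow> ('d, 'e, 'j, 'k, 'u) profctr \<Rightarrow> ('p, 'b) cat
    \<Rightarrow> ('d, 'j, 'k, 'u, 'p, 'b) elements_lims \<Rightarrow> ('j, 'k, 'p, 'b) fctr \<Rightarrow> ('d, 'e, 'p, 'b) fctr" where
  "matching_ob A B W E l X = \<lparr>
     fob = \<lambda>i\<in>ob A. apex (matching_cone A B W l X i),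
     far = \<lambda>f\<in>ar A.
       let c = matching_cone A B W l X (src A f); c' = matching_cone A B W l X (tgt A f)
       in THE h. h \<in> hom E (apex c) (apex c') \<and>
            (\<forall>(j, u) \<in> ob (elements_at A B W (tgt A f)).
               leg c' (j, u) \<cdot>\<^bsub>E\<^esub> h = leg c (j, sfun (far W (f, idt B j)) u))\<rparr>"

definition matching_ar ::
  "('d, 'e) cat \<Rightarrow> ('j, 'k) cat \<Rightarrow> ('d, 'e, 'j, 'k, 'u) profctr \<Rightarrow> ('p, 'b) cat
    \<Rightarrow> ('d, 'j, 'k, 'u, 'p, 'b) elements_lims \<Rightarrow> ('j, 'k, 'p, 'b) ntrans \<Rightarrow> ('d, 'e, 'p, 'b) ntrans" where
  "matching_ar A B W E l t = \<lparr>
     nsrc = matching_ob A B W E l (nsrc t), ntgt = matching_ob A B W E l (ntgt t),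
     cpt = \<lambda>i\<in>ob A.
       let c = matching_cone A B W l (nsrc t) i; c' = matching_cone A B W l (ntgt t) i
       in THE h. h \<in> hom E (apex c) (apex c') \<and>
            (\<forall>(j, u) \<in> ob (elements_at A B W i). leg c' (j, u) \<cdot>\<^bsub>E\<^esub> h = cpt t j \<cdot>\<^bsub>E\<^esub> leg c (j, u))\<rparr>"


section \<open>Iterated gluing diagrams\<close>

definition strict_inverse_category :: "('n, 'm) cat \<Rightarrow> ('n \<Rightarrow> nat) \<Rightarrow> bool" where
  "strict_inverse_category N deg \<longleftrightarrow> category N \<and>
     (\<forall>f \<in> ar N. f \<noteq> idt N (src N f) \<longrightarrow> deg (src N f) > deg (tgt N f))"

text \<open>
  The index category \<open>\<N>\<close> with its degree function, the functor \<open>\<I>\<close> on \<open>\<N>\<^sup>o\<^sup>p\<close> given by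
  \<open>cats\<close> and \<open>tran\<close>, the categories \<open>\<partial>\<I>\<^sub>n\<close> and the profunctors \<open>\<I>\<^sup>\<circ>\<^sub>n\<close>.  The objects of
  \<open>\<I>\<^sub>n\<close> and of \<open>\<I>\<^sub><\<^sub>n\<close> necessarily have different types, so that \<open>\<I>\<^sub>n\<close> is identified with
  the collage of \<open>\<I>\<^sup>\<circ>\<^sub>n\<close> by means of an isomorphism, \<open>glue n\<close>.
\<close>

record ('n, 'm, 'o, 'a, 'd, 'e, 'u) gluing =
  idx :: "('n, 'm) cat"
  deg :: "'n \<Rightarrow> nat"
  cats :: "'n \<Rightarrow> ('o, 'a) cat"
  tran :: "'m \<Rightarrow> ('o, 'a, 'o, 'a) fctr"
  bdry :: "'n \<Rightarrow> ('d, 'e) cat"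
  prof :: "'n \<Rightarrow> ('d, 'e, ('m, 'o) colim_ob, ('m, 'o, 'a) colim_ar, 'u) profctr"
  glue :: "'n \<Rightarrow> (('m, 'o) colim_ob + 'd,
            ('d, 'e, ('m, 'o) colim_ob, ('m, 'o, 'a) colim_ar, 'u) collage_ar, 'o, 'a) fctr"

definition below :: "('n, 'm, 'o, 'a, 'd, 'e, 'u) gluing \<Rightarrow> 'n
    \<Rightarrow> (('m, 'o) colim_ob, ('m, 'o, 'a) colim_ar) cat" where
  "below G n = colim_cat (op_cat (punctured_coslice (idx G) n))
     (\<lambda>a. cats G (tgt (idx G) a)) (\<lambda>(_, b, _). tran G b)"

definition below_in :: "('n, 'm, 'o, 'a, 'd, 'e, 'u) gluing \<Rightarrow> 'n \<Rightarrow> 'm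
    \<Rightarrow> ('o, 'a, ('m, 'o) colim_ob, ('m, 'o, 'a) colim_ar) fctr" where
  "below_in G n = colim_in (op_cat (punctured_coslice (idx G) n))
     (\<lambda>a. cats G (tgt (idx G) a)) (\<lambda>(_, b, _). tran G b)"

definition below_incl :: "('n, 'm, 'o, 'a, 'd, 'e, 'u) gluing \<Rightarrow> 'n
    \<Rightarrow> (('m, 'o) colim_ob, ('m, 'o, 'a) colim_ar, 'o, 'a) fctr" where
  "below_incl G n = comp_fctr (below G n) (glue G n) (collage_base (below G n))"

definition bdry_incl :: "('n, 'm, 'o, 'a, 'd, 'e, 'u) gluing \<Rightarrow> 'n \<Rightarrow> ('d, 'e, 'o, 'a) fctr" where
  "bdry_incl G n = comp_fctr (bdry G n) (glue G n) (collage_bdry (bdry G n))"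

text \<open>The last condition says that \<open>below_incl G n\<close> is the functor induced by the \<open>\<I>\<^sub>\<alpha>\<close>.\<close>

definition iterated_gluing :: "('n, 'm, 'o, 'a, 'd, 'e, 'u) gluing \<Rightarrow> bool" where
  "iterated_gluing G \<longleftrightarrow>
     strict_inverse_category (idx G) (deg G) \<and>
     is_cat_diagram (op_cat (idx G)) (cats G) (tran G) \<and>
     (\<forall>n \<in> ob (idx G).
        category (bdry G n) \<and>
        is_functor (prod_cat (op_cat (bdry G n)) (below G n)) set_cat (prof G n) \<and>
        is_iso_fctr (collage (bdry G n) (below G n) (prof G n)) (cats G n) (glue G n) \<and>
        (\<forall>a \<in> ob (punctured_coslice (idx G) n).
           comp_fctr (cats G (tgt (idx G) a)) (below_incl G n) (below_in G n a) = tran G a))"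

definition glued :: "('n, 'm, 'o, 'a, 'd, 'e, 'u) gluing
    \<Rightarrow> (('n, 'o) colim_ob, ('n, 'o, 'a) colim_ar) cat" where
  "glued G = colim_cat (op_cat (idx G)) (cats G) (tran G)"

definition glued_in :: "('n, 'm, 'o, 'a, 'd, 'e, 'u) gluing \<Rightarrow> 'n
    \<Rightarrow> ('o, 'a, ('n, 'o) colim_ob, ('n, 'o, 'a) colim_ar) fctr" where
  "glued_in G = colim_in (op_cat (idx G)) (cats G) (tran G)"

definition below_glued :: "('n, 'm, 'o, 'a, 'd, 'e, 'u) gluing \<Rightarrow> 'n
    \<Rightarrow> (('m, 'o) colim_ob, ('m, 'o, 'a) colim_ar, ('n, 'o) colim_ob, ('n, 'o, 'a) colim_ar) fctr" where
  "below_glued G n = comp_fctr (below G n) (glued_in G n) (below_incl G n)"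

text \<open>The object \<open>[i]\<^sub>n\<close> of the glued category.\<close>

definition bdry_pt :: "('n, 'm, 'o, 'a, 'd, 'e, 'u) gluing \<Rightarrow> 'n \<Rightarrow> 'd \<Rightarrow> ('n, 'o) colim_ob" where
  "bdry_pt G n i = fob (glued_in G n) (fob (bdry_incl G n) i)"

abbreviation gluing_elements :: "('n, 'm, 'o, 'a, 'd, 'e, 'u) gluing \<Rightarrow> 'n \<Rightarrow> 'd
    \<Rightarrow> (('m, 'o) colim_ob \<times> 'u,
       (('m, 'o) colim_ob \<times> 'u) \<times> ('m, 'o, 'a) colim_ar \<times> (('m, 'o) colim_ob \<times> 'u)) cat" where
  "gluing_elements G n i \<equiv> elements_at (bdry G n) (below G n) (prof G n) i"

type_synonym ('n, 'm, 'o, 'a, 'd, 'u, 'p, 'b) gluing_lims =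
  "'n \<Rightarrow> ('d, ('m, 'o) colim_ob, ('m, 'o, 'a) colim_ar, 'u, 'p, 'b) elements_lims"

definition Match_ob :: "('n, 'm, 'o, 'a, 'd, 'e, 'u) gluing \<Rightarrow> ('p, 'b) cat
    \<Rightarrow> ('n, 'm, 'o, 'a, 'd, 'u, 'p, 'b) gluing_lims \<Rightarrow> 'n
    \<Rightarrow> (('n, 'o) colim_ob, ('n, 'o, 'a) colim_ar, 'p, 'b) fctr \<Rightarrow> ('d, 'e, 'p, 'b) fctr" where
  "Match_ob G E l n X = matching_ob (bdry G n) (below G n) (prof G n) E (l n)
     (comp_fctr (below G n) X (below_glued G n))"

definition Match_ar :: "('n, 'm, 'o, 'a, 'd, 'e, 'u) gluing \<Rightarrow> ('p, 'b) cat
    \<Rightarrow> ('n, 'm, 'o, 'a, 'd, 'u, 'p, 'b) gluing_lims \<Rightarrow> 'n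
    \<Rightarrow> (('n, 'o) colim_ob, ('n, 'o, 'a) colim_ar, 'p, 'b) ntrans \<Rightarrow> ('d, 'e, 'p, 'b) ntrans" where
  "Match_ar G E l n t = matching_ar (bdry G n) (below G n) (prof G n) E (l n)
     (whisker (below G n) t (below_glued G n))"

end

theory Submission
  imports Defs
begin

text \<open>
  A functor on the glued category is a compatible family of functors on the categories
  \<open>\<I>\<^sub>n\<close>, and as \<open>\<I>\<^sub>n\<close> is a collage, a functor on it consists of a functor \<open>X\<close> on
  \<open>\<I>\<^sub><\<^sub>n\<close>, a functor \<open>Y\<close> on \<open>\<partial>\<I>\<^sub>n\<close> and a transformation \<open>Y \<rightarrow> M\<^sub>n X\<close>.  The classifier is
  therefore built by recursion on the degree.  Pullbacks of functors are pointwise, so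
  restriction preserves classified squares, and as characteristic maps are unique, compatible
  classifiers on the categories of a diagram induce one on its colimit.  Applied to the
  categories of lower degree this gives a classifier on \<open>\<I>\<^sub><\<^sub>n\<close>, which extends to \<open>\<I>\<^sub>n\<close> by
  the formula for Artin gluing; applied to all \<open>\<I>\<^sub>n\<close> it gives the theorem.  Of the colimits
  only the universal property is used, and that their arrows are composites of arrows of
  the \<open>\<I>\<^sub>n\<close>.
\<close>

section \<open>Limits in a category\<close>

text \<open>The colimits of categories are strict, so the classifiers at different stages have to
  agree as functors and not merely up to isomorphism. Two choices follow from this. Every truth map
  starts at the constant functor on one fixed terminal object \<open>pt\<close>, because restriction
  preserves constant functors exactly. And the classifier at \<open>n\<close> extends the very
  functor already obtained on the lower part, so that it restricts to it exactly. The classifiers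
  given on the boundary categories have arbitrary terminal objects, and the maps \<open>bang\<close>
  mediate between these and the constant one. The gluing formula has the following origin. A
  subobject of a functor on a collage is a subobject of the lower part together with one of the
  boundary part, where the latter lies in the pullback, along the structure map, of the matching
  object of the former. If a is the characteristic map of the boundary part and y is the matching
  map of the characteristic map of the lower part, composed with the structure map, this containment
  says a \<le> chi(y), where chi classifies M(true). Written as an equation it is a = a \<and>
  chi(y), which is the equaliser of the statement.\<close>

context category begin

lemma homD: "f \<in> hom C x y \<Longrightarrow> f \<in> ar C" "f \<in> hom C x y \<Longrightarrow> src C f = x" "f \<in> hom C x y \<Longrightarrow> tgt C f = y"
  by (auto simp: hom_def)

lemma homI: "f \<in> ar C \<Longrightarrow> f \<in> hom C (src C f) (tgt C f)"
  by (auto simp: hom_def)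

lemma hom_ob: "f \<in> hom C x y \<Longrightarrow> x \<in> ob C" "f \<in> hom C x y \<Longrightarrow> y \<in> ob C"
  using src_ob tgt_ob by (auto simp: hom_def)

section \<open>Pullback squares: lifting, transport and pasting\<close>

lemma pullback_hom:
  assumes "is_pullback C p q f g"
  shows "p \<in> hom C (src C p) (src C f)" "q \<in> hom C (src C p) (src C g)"
    "f \<in> hom C (src C f) (tgt C f)" "g \<in> hom C (src C g) (tgt C f)" "f \<cdot> p = g \<cdot> q"
  using assms by (auto simp: is_pullback_def hom_def)

lemma pullback_lift:
  assumes "is_pullback C p q f g" "a \<in> hom C x (src C f)" "b \<in> hom C x (src C g)" "f \<cdot> a = g \<cdot> b"
  obtains h where "h \<in> hom C x (src C p)" "p \<cdot> h = a" "q \<cdot> h = b"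
  using assms unfolding is_pullback_def by blast

lemma pullback_joint_mono:
  assumes pb: "is_pullback C p q f g" and h: "h \<in> hom C x (src C p)" and k: "k \<in> hom C x (src C p)"
    and eq: "p \<cdot> h = p \<cdot> k" "q \<cdot> h = q \<cdot> k"
  shows "h = k"
proof -
  note pb' = pullback_hom[OF pb]
  have "p \<cdot> k \<in> hom C x (src C f)" "q \<cdot> k \<in> hom C x (src C g)"
    using cmp_hom[OF k] pb' by blast+
  moreover have "f \<cdot> (p \<cdot> k) = g \<cdot> (q \<cdot> k)"
    using assoc[OF k pb'(1,3)] assoc[OF k pb'(2,4)] pb'(5) by simp
  ultimately have "\<exists>!h. h \<in> hom C x (src C p) \<and> p \<cdot> h = p \<cdot> k \<and> q \<cdot> h = q \<cdot> k"
    using pb unfolding is_pullback_def by blast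
  then show ?thesis using h k eq by blast
qed

lemma pullbackI:
  assumes "p \<in> hom C v x" "q \<in> hom C v y" "f \<in> hom C x z" "g \<in> hom C y z" "f \<cdot> p = g \<cdot> q"
    and ex: "\<And>w a b. \<lbrakk>a \<in> hom C w x; b \<in> hom C w y;
      f \<cdot> a = g \<cdot> b\<rbrakk> \<Longrightarrow> \<exists>h \<in> hom C w v. p \<cdot> h = a \<and> q \<cdot> h = b"
    and un: "\<And>w h k. \<lbrakk>h \<in> hom C w v; k \<in> hom C w v; p \<cdot> h = p \<cdot> k; q \<cdot> h = q \<cdot> k\<rbrakk> \<Longrightarrow> h = k"
  shows "is_pullback C p q f g"
proof -
  have "\<exists>!h. h \<in> hom C w v \<and> p \<cdot> h = a \<and> q \<cdot> h = b"
    if ab: "a \<in> hom C w x" "b \<in> hom C w y" "f \<cdot> a = g \<cdot> b" for w a b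
  proof -
    obtain h where h: "h \<in> hom C w v" "p \<cdot> h = a" "q \<cdot> h = b" using ex[OF ab] by blast
    show ?thesis
    proof (rule ex1I[of _ h])
      fix k assume "k \<in> hom C w v \<and> p \<cdot> k = a \<and> q \<cdot> k = b"
      then show "k = h" using un[OF _ h(1), of k] h by simp
    qed (use h in blast)
  qed
  then show ?thesis using assms(1-5) unfolding is_pullback_def by (simp add: homD)
qed

text \<open>Serves \<open>pullback_pointwise\<close>: a pullback that is merely isomorphic to the
  one built at each object inherits its properties along the isomorphism.\<close>

lemma pullback_iso:
  assumes pb: "is_pullback C p q f g" and h: "h \<in> hom C v (src C p)" and k: "k \<in> hom C (src C p) v"
    and hk: "h \<cdot> k = idt C (src C p)" and kh: "k \<cdot> h = idt C v"
  shows "is_pullback C (p \<cdot> h) (q \<cdot> h) f g"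
proof -
  note pb' = pullback_hom[OF pb]
  show ?thesis
  proof (rule pullbackI)
    show "p \<cdot> h \<in> hom C v (src C f)" "q \<cdot> h \<in> hom C v (src C g)" "f \<in> hom C (src C f) (tgt C f)"
      "g \<in> hom C (src C g) (tgt C f)"
      using cmp_hom[OF h] pb' by blast+
    show "f \<cdot> (p \<cdot> h) = g \<cdot> (q \<cdot> h)"
      using assoc[OF h pb'(1,3)] assoc[OF h pb'(2,4)] pb'(5) by simp
  next
    fix w a b assume ab: "a \<in> hom C w (src C f)" "b \<in> hom C w (src C g)" "f \<cdot> a = g \<cdot> b"
    obtain u where u: "u \<in> hom C w (src C p)" "p \<cdot> u = a" "q \<cdot> u = b"
      using pullback_lift[OF pb ab] by blast
    have ku: "k \<cdot> u \<in> hom C w v" by (rule cmp_hom[OF u(1) k])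
    have "h \<cdot> (k \<cdot> u) = u" using assoc[OF u(1) k h] hk idt_left[OF u(1)] by simp
    then have "(p \<cdot> h) \<cdot> (k \<cdot> u) = a" "(q \<cdot> h) \<cdot> (k \<cdot> u) = b"
      using assoc[OF ku h] pb' u by metis+
    then show "\<exists>u\<in>hom C w v. (p \<cdot> h) \<cdot> u = a \<and> (q \<cdot> h) \<cdot> u = b" using ku by blast
  next
    fix w u u' assume u: "u \<in> hom C w v" "u' \<in> hom C w v"
      and eq: "(p \<cdot> h) \<cdot> u = (p \<cdot> h) \<cdot> u'" "(q \<cdot> h) \<cdot> u = (q \<cdot> h) \<cdot> u'"
    have "h \<cdot> u = h \<cdot> u'"
      by (rule pullback_joint_mono[OF pb cmp_hom[OF u(1) h] cmp_hom[OF u(2) h]])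
        (use eq assoc[OF u(1) h] assoc[OF u(2) h] pb' in metis)+
    then show "u = u'"
      using assoc[OF u(1) h k] assoc[OF u(2) h k] kh idt_left u by metis
  qed
qed

lemma pullback_paste:
  assumes l: "is_pullback C m u k n" and r: "is_pullback C n v k' t" and kk': "src C k' = tgt C k"
  shows "is_pullback C m (v \<cdot> u) (k' \<cdot> k) t"
proof -
  note l' = pullback_hom[OF l] and r' = pullback_hom[OF r]
  have n: "n \<in> hom C (src C n) (tgt C k)" using r'(1) kk' by simp
  have k': "k' \<in> hom C (tgt C k) (tgt C k')" using r'(3) kk' by simp
  show ?thesis
  proof (rule pullbackI)
    show "m \<in> hom C (src C m) (src C k)" "v \<cdot> u \<in> hom C (src C m) (src C t)"
      "k' \<cdot> k \<in> hom C (src C k) (tgt C k')" "t \<in> hom C (src C t) (tgt C k')"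
      using l' r' cmp_hom[OF l'(2) r'(2)] cmp_hom[OF l'(3) k'] by auto
    show "(k' \<cdot> k) \<cdot> m = t \<cdot> (v \<cdot> u)"
      using assoc[OF l'(1,3) k'] assoc[OF l'(2) n k'] assoc[OF l'(2) r'(2) r'(4)] l'(5) r'(5) by simp
  next
    fix w a b assume a: "a \<in> hom C w (src C k)" and b: "b \<in> hom C w (src C t)"
      and ab: "(k' \<cdot> k) \<cdot> a = t \<cdot> b"
    have ka: "k \<cdot> a \<in> hom C w (src C k')" using cmp_hom[OF a l'(3)] kk' by simp
    have "k' \<cdot> (k \<cdot> a) = t \<cdot> b" using ab assoc[OF a l'(3) k'] by simp
    then obtain c where c: "c \<in> hom C w (src C n)" "n \<cdot> c = k \<cdot> a" "v \<cdot> c = b"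
      using pullback_lift[OF r ka b] by blast
    obtain h where h: "h \<in> hom C w (src C m)" "m \<cdot> h = a" "u \<cdot> h = c"
      using pullback_lift[OF l a c(1)] c(2) by metis
    have "(v \<cdot> u) \<cdot> h = b" using assoc[OF h(1) l'(2) r'(2)] h c by simp
    then show "\<exists>h\<in>hom C w (src C m). m \<cdot> h = a \<and> (v \<cdot> u) \<cdot> h = b" using h by blast
  next
    fix w h h' assume h: "h \<in> hom C w (src C m)" and h': "h' \<in> hom C w (src C m)"
      and eq: "m \<cdot> h = m \<cdot> h'" "(v \<cdot> u) \<cdot> h = (v \<cdot> u) \<cdot> h'"
    have "u \<cdot> h = u \<cdot> h'"
    proof (rule pullback_joint_mono[OF r cmp_hom[OF h l'(2)] cmp_hom[OF h' l'(2)]])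
      show "n \<cdot> (u \<cdot> h) = n \<cdot> (u \<cdot> h')"
        using assoc[OF h l'(2) n] assoc[OF h' l'(2) n] assoc[OF h l'(1,3)] assoc[OF h' l'(1,3)]
          l'(5) eq(1) by simp
      show "v \<cdot> (u \<cdot> h) = v \<cdot> (u \<cdot> h')"
        using assoc[OF h l'(2) r'(2)] assoc[OF h' l'(2) r'(2)] eq(2) by simp
    qed
    then show "h = h'" using pullback_joint_mono[OF l h h' eq(1)] by simp
  qed
qed

section \<open>Monomorphisms and terminal objects\<close>

lemma monoD: "\<lbrakk>is_mono C m; f \<in> hom C x (src C m); g \<in> hom C x (src C m); m \<cdot> f = m \<cdot> g\<rbrakk> \<Longrightarrow> f = g"
  unfolding is_mono_def by blast

text \<open>The kernel pair of a mono is trivial. Expressed as a pullback, being mono can be tested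
  pointwise in a functor category as soon as pullbacks can.\<close>

lemma mono_iff_pullback:
  assumes m: "m \<in> ar C"
  shows "is_mono C m \<longleftrightarrow> is_pullback C (idt C (src C m)) (idt C (src C m)) m m"
proof
  have i: "idt C (src C m) \<in> hom C (src C m) (src C m)" by (rule idt_hom[OF src_ob[OF m]])
  assume mm: "is_mono C m"
  show "is_pullback C (idt C (src C m)) (idt C (src C m)) m m"
  proof (rule pullbackI[OF i i homI[OF m] homI[OF m] refl])
    fix w a b assume ab: "a \<in> hom C w (src C m)" "b \<in> hom C w (src C m)" "m \<cdot> a = m \<cdot> b"
    then show "\<exists>h\<in>hom C w (src C m). idt C (src C m) \<cdot> h = a \<and> idt C (src C m) \<cdot> h = b"
      using monoD[OF mm ab] idt_left by blast
  qed (simp add: idt_left)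
next
  assume pb: "is_pullback C (idt C (src C m)) (idt C (src C m)) m m"
  show "is_mono C m"
    unfolding is_mono_def
  proof (intro conjI ballI allI impI)
    fix w a b assume ab: "a \<in> hom C w (src C m)" "b \<in> hom C w (src C m)" "m \<cdot> a = m \<cdot> b"
    from pb this show "a = b" by (rule pullback_lift) (metis homD(2) idt_hom idt_left src_ob m)
  qed (rule m)
qed

lemma terminal_eq: "\<lbrakk>is_terminal C t; f \<in> hom C x t; g \<in> hom C x t\<rbrakk> \<Longrightarrow> f = g"
  unfolding is_terminal_def using hom_ob by blast

lemma bang_hom: "\<lbrakk>is_terminal C t; x \<in> ob C\<rbrakk> \<Longrightarrow> bang C x t \<in> hom C x t"
  unfolding is_terminal_def bang_def by (metis theI')

lemma bang_eq: "\<lbrakk>is_terminal C t; f \<in> hom C x t\<rbrakk> \<Longrightarrow> bang C x t = f"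
  using terminal_eq bang_hom hom_ob by metis

lemma mono_from_terminal: "\<lbrakk>is_terminal C t; m \<in> hom C t x\<rbrakk> \<Longrightarrow> is_mono C m"
  unfolding is_mono_def using terminal_eq by (auto simp: hom_def)

section \<open>Binary products and equalisers\<close>

lemma product_hom:
  assumes "is_product C x y s"
  shows "pr1 s \<in> hom C (vertex s) x" "pr2 s \<in> hom C (vertex s) y" "x \<in> ob C" "y \<in> ob C"
  using assms hom_ob by (auto simp: is_product_def)

lemma product_joint_mono:
  assumes s: "is_product C x y s" and h: "h \<in> hom C z (vertex s)" and k: "k \<in> hom C z (vertex s)"
    and eq: "pr1 s \<cdot> h = pr1 s \<cdot> k" "pr2 s \<cdot> h = pr2 s \<cdot> k"
  shows "h = k"
proof -
  have "pr1 s \<cdot> k \<in> hom C z x" "pr2 s \<cdot> k \<in> hom C z y"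
    using cmp_hom[OF k] product_hom[OF s] by blast+
  then have "\<exists>!h. h \<in> hom C z (vertex s) \<and> pr1 s \<cdot> h = pr1 s \<cdot> k \<and> pr2 s \<cdot> h = pr2 s \<cdot> k"
    using s unfolding is_product_def by blast
  then show ?thesis using h k eq by blast
qed

lemma pairing:
  assumes s: "is_product C x y s" and a: "a \<in> hom C z x" and b: "b \<in> hom C z y"
  shows pairing_hom: "pairing C s a b \<in> hom C z (vertex s)"
    and pr1_pairing: "pr1 s \<cdot> pairing C s a b = a" and pr2_pairing: "pr2 s \<cdot> pairing C s a b = b"
proof -
  have "\<exists>!h. h \<in> hom C z (vertex s) \<and> pr1 s \<cdot> h = a \<and> pr2 s \<cdot> h = b"
    using assms unfolding is_product_def by blast
  from theI'[OF this] show "pairing C s a b \<in> hom C z (vertex s)"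
    "pr1 s \<cdot> pairing C s a b = a" "pr2 s \<cdot> pairing C s a b = b"
    unfolding pairing_def homD(2)[OF a] by auto
qed

lemma pairing_eq:
  assumes s: "is_product C x y s" and a: "a \<in> hom C z x" and b: "b \<in> hom C z y"
    and h: "h \<in> hom C z (vertex s)" "pr1 s \<cdot> h = a" "pr2 s \<cdot> h = b"
  shows "pairing C s a b = h"
  using product_joint_mono[OF s pairing_hom[OF s a b] h(1)] pairing[OF s a b] h by simp

lemma pairing_cmp:
  assumes s: "is_product C x y s" and a: "a \<in> hom C z x" and b: "b \<in> hom C z y" and h: "h \<in> hom C w z"
  shows "pairing C s a b \<cdot> h = pairing C s (a \<cdot> h) (b \<cdot> h)"
proof (rule pairing_eq[OF s, symmetric])
  note p = pairing[OF s a b]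
  show "pairing C s a b \<cdot> h \<in> hom C w (vertex s)" by (rule cmp_hom[OF h p(1)])
  show "pr1 s \<cdot> pairing C s a b \<cdot> h = a \<cdot> h" "pr2 s \<cdot> pairing C s a b \<cdot> h = b \<cdot> h"
    using assoc[OF h p(1)] product_hom[OF s] p by metis+
qed (use cmp_hom[OF h] a b in auto)

text \<open>Any two maps into a terminal object agree, so the commuting condition of the square is
  empty. With \<open>equaliser_iff_pullback\<close> this makes pullbacks the only limit, apart from
  terminal objects, whose pointwise nature needs a direct proof.\<close>

lemma product_iff_pullback:
  assumes t: "is_terminal C t" and s: "pr1 s \<in> hom C (vertex s) x" "pr2 s \<in> hom C (vertex s) y"
  shows "is_product C x y s \<longleftrightarrow> is_pullback C (pr1 s) (pr2 s) (bang C x t) (bang C y t)"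
proof -
  have b: "bang C x t \<in> hom C x t" "bang C y t \<in> hom C y t"
    using bang_hom[OF t] hom_ob s by blast+
  have c: "bang C x t \<cdot> p = bang C y t \<cdot> q" if "p \<in> hom C z x" "q \<in> hom C z y" for p q z
    using terminal_eq[OF t cmp_hom[OF that(1) b(1)] cmp_hom[OF that(2) b(2)]] .
  show ?thesis
    unfolding is_product_def is_pullback_def
    using s b c hom_ob[OF s(1)] by (auto simp: hom_def)
qed

text \<open>The two maps into the product are the graphs of \<open>f\<close> and \<open>g\<close>.
  They agree on a pair \<open>a\<close>, \<open>b\<close> exactly when \<open>a = b\<close> and
  \<open>f \<cdot> a = g \<cdot> a\<close>, so both projections of the pullback are the equalising
  map.\<close>

lemma equaliser_iff_pullback:
  assumes s: "is_product C x y s" and f: "f \<in> hom C x y" and g: "g \<in> hom C x y" and e: "e \<in> hom C z x"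
  shows "is_equaliser C e f g \<longleftrightarrow>
    is_pullback C e e (pairing C s (idt C x) f) (pairing C s (idt C x) g)"
proof -
  have i: "idt C x \<in> hom C x x" using idt_hom hom_ob f by blast
  note pf = pairing[OF s i f] and pg = pairing[OF s i g]
  have eq: "pairing C s (idt C x) f \<cdot> a = pairing C s (idt C x) g \<cdot> b \<longleftrightarrow> a = b \<and> f \<cdot> a = g \<cdot> a"
    if a: "a \<in> hom C w x" and b: "b \<in> hom C w x" for a b w
  proof -
    have u: "u = u' \<and> v = v'"
      if "pairing C s u v = pairing C s u' v'" "u \<in> hom C w x" "u' \<in> hom C w x" "v \<in> hom C w y"
        "v' \<in> hom C w y" for u v u' v'
      using pairing[OF s that(2,4)] pairing[OF s that(3,5)] that(1) by simp
    have "pairing C s (idt C x) f \<cdot> a = pairing C s a (f \<cdot> a)" "pairing C s (idt C x) g \<cdot> b =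
      pairing C s b (g \<cdot> b)"
      using pairing_cmp[OF s i f a] pairing_cmp[OF s i g b] idt_left[OF a] idt_left[OF b] by simp_all
    then show ?thesis using u[of a "f \<cdot> a" b "g \<cdot> b"] cmp_hom[OF a f] cmp_hom[OF b g] a b by auto
  qed
  show ?thesis
  proof
    assume E: "is_equaliser C e f g"
    show "is_pullback C e e (pairing C s (idt C x) f) (pairing C s (idt C x) g)"
    proof (rule pullbackI[OF e e pf(1) pg(1)])
      show "pairing C s (idt C x) f \<cdot> e = pairing C s (idt C x) g \<cdot> e"
        using E eq[OF e e] by (simp add: is_equaliser_def)
    next
      fix w a b assume ab: "a \<in> hom C w x" "b \<in> hom C w x" "pairing C s (idt C x) f \<cdot> a =
        pairing C s (idt C x) g \<cdot> b"
      then show "\<exists>h\<in>hom C w z. e \<cdot> h = a \<and> e \<cdot> h = b"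
        using E eq[OF ab(1,2)] e unfolding is_equaliser_def by (metis homD(2,3))
    next
      fix w h k assume hk: "h \<in> hom C w z" "k \<in> hom C w z" "e \<cdot> h = e \<cdot> k"
      have "f \<cdot> (e \<cdot> k) = g \<cdot> (e \<cdot> k)"
        using assoc[OF hk(2) e f] assoc[OF hk(2) e g] E by (simp add: is_equaliser_def)
      then show "h = k" using E hk e cmp_hom[OF hk(2) e] unfolding is_equaliser_def by (metis homD(2,3))
    qed
  next
    assume P: "is_pullback C e e (pairing C s (idt C x) f) (pairing C s (idt C x) g)"
    have "f \<cdot> e = g \<cdot> e" using eq[OF e e] P by (simp add: is_pullback_def)
    moreover have "\<exists>!h. h \<in> hom C w z \<and> e \<cdot> h = a" if a: "a \<in> hom C w x" "f \<cdot> a = g \<cdot> a" for w a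
    proof -
      obtain h where h: "h \<in> hom C w z" "e \<cdot> h = a"
        using pullback_lift[OF P, of a w a] eq[OF a(1) a(1)] a homD[OF pf(1)] homD[OF pg(1)] homD[OF e]
          by auto
      show ?thesis
      proof (rule ex1I[of _ h])
        fix k assume "k \<in> hom C w z \<and> e \<cdot> k = a"
        then show "k = h"
          using pullback_joint_mono[OF P, of k w h] h homD(2)[OF e] by simp
      qed (use h in blast)
    qed
    ultimately show "is_equaliser C e f g"
      unfolding is_equaliser_def using e f g homD[OF e] homD[OF f] homD[OF g] by auto
  qed
qed

lemma equaliser_mono:
  assumes E: "is_equaliser C e f g"
  shows "is_mono C e"
proof -
  have h: "e \<in> hom C (src C e) (tgt C e)" "f \<in> hom C (tgt C e) (tgt C f)"
    "g \<in> hom C (tgt C e) (tgt C f)"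
    using E by (auto simp: is_equaliser_def hom_def)
  have "u = v" if uv: "u \<in> hom C w (src C e)" "v \<in> hom C w (src C e)" "e \<cdot> u = e \<cdot> v" for w u v
  proof -
    have "f \<cdot> (e \<cdot> v) = g \<cdot> (e \<cdot> v)"
      using assoc[OF uv(2) h(1,2)] assoc[OF uv(2) h(1,3)] E by (simp add: is_equaliser_def)
    then show "u = v" using E uv cmp_hom[OF uv(2) h(1)] unfolding is_equaliser_def by metis
  qed
  then show ?thesis using h unfolding is_mono_def by (auto simp: hom_def)
qed

lemma equaliser_lift:
  assumes "is_equaliser C e f g" "a \<in> hom C x (tgt C e)" "f \<cdot> a = g \<cdot> a"
  obtains h where "h \<in> hom C x (src C e)" "e \<cdot> h = a"
  using assms unfolding is_equaliser_def by blast

text \<open>Moves an equaliser along an isomorphism of the ambient object. It is what allows an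
  arbitrary product to replace the one from which the equaliser was built.\<close>

lemma equaliser_iso:
  assumes e: "is_equaliser C e f g" and s: "s \<in> hom C (tgt C e) x" and r: "r \<in> hom C x (tgt C e)"
    and sr: "s \<cdot> r = idt C x" and rs: "r \<cdot> s = idt C (tgt C e)"
    and f': "f' \<in> hom C x y" and g': "g' \<in> hom C x y" and f: "f' \<cdot> s = f" and g: "g' \<cdot> s = g"
  shows "is_equaliser C (s \<cdot> e) f' g'"
proof -
  have eh: "e \<in> hom C (src C e) (tgt C e)" using e by (simp add: is_equaliser_def hom_def)
  note se = cmp_hom[OF eh s]
  have "f' \<cdot> (s \<cdot> e) = g' \<cdot> (s \<cdot> e)"
    using assoc[OF eh s f'] assoc[OF eh s g'] f g e by (simp add: is_equaliser_def)
  moreover have "\<exists>!h. h \<in> hom C w (src C e) \<and> (s \<cdot> e) \<cdot> h = a"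
    if a: "a \<in> hom C w x" and eq: "f' \<cdot> a = g' \<cdot> a" for w a
  proof -
    note ra = cmp_hom[OF a r]
    have sra: "s \<cdot> (r \<cdot> a) = a" using assoc[OF a r s] sr idt_left[OF a] by simp
    have "f \<cdot> (r \<cdot> a) = g \<cdot> (r \<cdot> a)"
      using assoc[OF ra s f'] assoc[OF ra s g'] f g sra eq by simp
    then obtain h where h: "h \<in> hom C w (src C e)" "e \<cdot> h = r \<cdot> a"
      using equaliser_lift[OF e ra] by blast
    show ?thesis
    proof (rule ex1I[of _ h])
      show "h \<in> hom C w (src C e) \<and> (s \<cdot> e) \<cdot> h = a"
        using h assoc[OF h(1) eh s] sra by simp
      fix k assume k: "k \<in> hom C w (src C e) \<and> (s \<cdot> e) \<cdot> k = a"
      then have kh: "k \<in> hom C w (src C e)" and "s \<cdot> (e \<cdot> k) = a" using assoc[OF _ eh s] by auto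
      then have "e \<cdot> k = r \<cdot> a"
        using assoc[OF cmp_hom[OF kh eh] s r] rs idt_left[OF cmp_hom[OF kh eh]] by simp
      then show "k = h" using monoD[OF equaliser_mono[OF e] kh h(1)] h(2) by simp
    qed
  qed
  ultimately show ?thesis
    unfolding is_equaliser_def using homD[OF se] homD[OF f'] homD[OF g'] by simp
qed

end

definition has_pullbacks :: "('o, 'a) cat \<Rightarrow> bool" where
  "has_pullbacks C \<longleftrightarrow> (\<forall>x y z. \<forall>f \<in> hom C x z. \<forall>g \<in> hom C y z. \<exists>p q. is_pullback C p q f g)"

context category begin

lemma product_exists:
  assumes "has_pullbacks C" and t: "is_terminal C t" and xy: "x \<in> ob C" "y \<in> ob C"
  obtains s where "is_product C x y s"
proof -
  note b = bang_hom[OF t xy(1)] bang_hom[OF t xy(2)]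
  obtain p q where pb: "is_pullback C p q (bang C x t) (bang C y t)"
    using assms(1) b unfolding has_pullbacks_def by blast
  have "is_product C x y \<lparr>vertex = src C p, pr1 = p, pr2 = q\<rparr>"
    by (subst product_iff_pullback[OF t]) (use pb pullback_hom[OF pb] homD(2)[OF b(1)] homD(2)[OF b(2)]
      in auto)
  then show ?thesis by (rule that)
qed

lemma equaliser_exists:
  assumes C: "has_pullbacks C" and t: "is_terminal C t" and f: "f \<in> hom C x y" and g: "g \<in> hom C x y"
  obtains e where "is_equaliser C e f g"
proof -
  obtain s where s: "is_product C x y s"
    using product_exists[OF C t] hom_ob f by metis
  have i: "idt C x \<in> hom C x x" using idt_hom hom_ob f by blast
  note pf = pairing[OF s i f] and pg = pairing[OF s i g]
  obtain p q where pb: "is_pullback C p q (pairing C s (idt C x) f) (pairing C s (idt C x) g)"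
    using C pf(1) pg(1) unfolding has_pullbacks_def by blast
  note h = pullback_hom[OF pb]
  have p: "p \<in> hom C (src C p) x" "q \<in> hom C (src C p) x"
    using h pf pg by (simp_all add: hom_def)
  \<comment> \<open>Both graphs have the identity as first component, so the two projections of the
    pullback coincide.\<close>
  have "pr1 s \<cdot> (pairing C s (idt C x) f \<cdot> p) = p" "pr1 s \<cdot> (pairing C s (idt C x) g \<cdot> q) = q"
    using assoc[OF p(1) pf(1) product_hom(1)[OF s]] assoc[OF p(2) pg(1) product_hom(1)[OF s]]
      pf pg idt_left p by simp_all
  then have "p = q" using h(5) by simp
  then show ?thesis using that equaliser_iff_pullback[OF s f g p(1)] pb by metis
qed

end

section \<open>Subobject classifiers\<close>

locale category_with_classifier = category C for C :: "('o, 'a) cat" (structure) +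
  fixes one Om :: 'o and tr :: 'a
  assumes classifier: "subobject_classifier C one Om tr"
begin

lemma one: "is_terminal C one" and Om: "Om \<in> ob C" and tr: "tr \<in> hom C one Om"
  using classifier by (auto simp: subobject_classifier_def)

text \<open>The everywhere true predicate on \<open>x\<close>: a generalised element
  \<open>c\<close> lies in the subobject classified by \<open>k\<close> when
  \<open>k \<cdot> c\<close> is this map.\<close>

abbreviation true_at :: "'o \<Rightarrow> 'a" where
  "true_at x \<equiv> tr \<cdot> bang C x one"

lemma true_at_hom: "x \<in> ob C \<Longrightarrow> true_at x \<in> hom C x Om"
  using cmp_hom[OF bang_hom[OF one] tr] .

lemma true_cmp: "b \<in> hom C x one \<Longrightarrow> tr \<cdot> b = true_at x"
  using bang_eq[OF one] by simp

lemma true_at_cmp: "f \<in> hom C x y \<Longrightarrow> true_at y \<cdot> f = true_at x"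
  using assoc[OF _ bang_hom[OF one] tr] cmp_hom[OF _ bang_hom[OF one]] true_cmp hom_ob by metis

text \<open>The leg into the terminal object carries no information, so the square can be read
  through generalised elements: those that factor through \<open>m\<close> are the ones on which
  \<open>k\<close> is true.\<close>

lemma classified_iff:
  assumes m: "m \<in> hom C s x" and k: "k \<in> hom C x Om"
  shows "is_pullback C m (bang C s one) k tr \<longleftrightarrow>
    k \<cdot> m = true_at s \<and> is_mono C m \<and> (\<forall>z. \<forall>a \<in> hom C z x. k \<cdot> a = true_at z \<longrightarrow>
      (\<exists>h \<in> hom C z s. m \<cdot> h = a))"
    (is "?L \<longleftrightarrow> ?R")
proof
  have b: "bang C s one \<in> hom C s one" using bang_hom[OF one] hom_ob m by blast
  have bb: "bang C s one \<cdot> h = bang C z one" if "h \<in> hom C z s" for z h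
    using bang_eq[OF one cmp_hom[OF that b]] by simp
  show ?R if L: ?L
  proof (intro conjI)
    show "k \<cdot> m = true_at s" using L by (simp add: is_pullback_def)
    show "is_mono C m"
      unfolding is_mono_def
    proof (intro conjI allI ballI impI)
      fix z f g assume "f \<in> hom C z (src C m)" "g \<in> hom C z (src C m)" "m \<cdot> f = m \<cdot> g"
      then show "f = g"
        using pullback_joint_mono[OF L, of f z g] bb homD(2)[OF m] by simp
    qed (use m homD in blast)
    show "\<forall>z. \<forall>a \<in> hom C z x. k \<cdot> a = true_at z \<longrightarrow> (\<exists>h \<in> hom C z s. m \<cdot> h = a)"
    proof (intro allI ballI impI)
      fix z a assume a: "a \<in> hom C z x" "k \<cdot> a = true_at z"
      have "bang C z one \<in> hom C z one" using bang_hom[OF one] hom_ob a by blast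
      then show "\<exists>h \<in> hom C z s. m \<cdot> h = a"
        using pullback_lift[OF L, of a z "bang C z one"] a m k tr by (metis homD(2))
    qed
  qed
  show ?L if R: ?R
  proof (rule pullbackI[OF m b k tr])
    show "k \<cdot> m = true_at s" using R by blast
    fix w a c assume "a \<in> hom C w x" "c \<in> hom C w one" "k \<cdot> a = tr \<cdot> c"
    then show "\<exists>h\<in>hom C w s. m \<cdot> h = a \<and> bang C s one \<cdot> h = c"
      using R bb bang_eq[OF one] by metis
  next
    fix w h h' assume "h \<in> hom C w s" "h' \<in> hom C w s" "m \<cdot> h = m \<cdot> h'"
    then show "h = h'" using R monoD homD(2)[OF m] by metis
  qed
qed

lemma char_map_classifies: "is_mono C m \<Longrightarrow> classifies C one Om tr m (char_map C one Om tr m)"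
  using classifier theI' unfolding subobject_classifier_def char_map_def by metis

lemma char_map_hom: "\<lbrakk>is_mono C m; m \<in> hom C s x\<rbrakk> \<Longrightarrow> char_map C one Om tr m \<in> hom C x Om"
  using char_map_classifies[of m] homD(3)[of m] by (auto simp: classifies_def)

lemma char_map_pullback: "\<lbrakk>is_mono C m; m \<in> hom C s x\<rbrakk> \<Longrightarrow>
    is_pullback C m (bang C s one) (char_map C one Om tr m) tr"
  using char_map_classifies[of m] homD(2)[of m] by (auto simp: classifies_def)

lemma char_map_eq:
  assumes m: "m \<in> hom C s x" and k: "k \<in> hom C x Om" and pb: "is_pullback C m (bang C s one) k tr"
  shows "char_map C one Om tr m = k"
proof -
  have "is_mono C m" using classified_iff[OF m k] pb by blast
  then have "\<exists>!k. classifies C one Om tr m k"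
    using classifier by (auto simp: subobject_classifier_def)
  moreover have "classifies C one Om tr m k"
    using m k pb by (simp add: classifies_def homD)
  ultimately show ?thesis unfolding char_map_def by blast
qed

section \<open>The internal meet\<close>

lemma tr_pair_hom: "is_product C Om Om R \<Longrightarrow> pairing C R tr tr \<in> hom C one (vertex R)"
  using pairing_hom tr by blast

lemma meet_hom: "is_product C Om Om R \<Longrightarrow> meet C one Om tr R \<in> hom C (vertex R) Om"
  unfolding meet_def using char_map_hom mono_from_terminal[OF one] tr_pair_hom by blast

lemma meet_pullback:
  assumes R: "is_product C Om Om R"
  shows "is_pullback C (pairing C R tr tr) (bang C one one) (meet C one Om tr R) tr"
  unfolding meet_def using char_map_pullback mono_from_terminal[OF one] tr_pair_hom R by blast

text \<open>This is \<open>a \<le> b\<close>, hence a \<and> b = a, for characteristic maps. As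
  \<open>b\<close> is true wherever \<open>a\<close> is, the pair \<open>(a, b)\<close> meets
  \<open>(true, true)\<close> exactly in \<open>m\<close>. Pasting with the square that defines the
  meet shows that the meet of the pair classifies \<open>m\<close> too, and characteristic maps are
  unique.\<close>

lemma meet_absorb:
  assumes R: "is_product C Om Om R" and a: "a \<in> hom C x Om" and b: "b \<in> hom C x Om"
    and m: "m \<in> hom C s x" and pb: "is_pullback C m (bang C s one) a tr" and bm: "b \<cdot> m = true_at s"
  shows "meet C one Om tr R \<cdot> pairing C R a b = a"
proof -
  have bs: "bang C s one \<in> hom C s one" using bang_hom[OF one] hom_ob m by blast
  note tt = tr_pair_hom[OF R]
  have am: "a \<cdot> m = true_at s" using pb by (simp add: is_pullback_def)
  have tp: "pairing C R tr tr \<cdot> c = pairing C R (tr \<cdot> c) (tr \<cdot> c)" if "c \<in> hom C z one" for c z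
    using pairing_cmp[OF R tr tr that] .
  have "is_pullback C m (bang C s one) (pairing C R a b) (pairing C R tr tr)"
  proof (rule pullbackI[OF m bs pairing_hom[OF R a b] tt])
    show "pairing C R a b \<cdot> m = pairing C R tr tr \<cdot> bang C s one"
      using pairing_cmp[OF R a b m] am bm tp[OF bs] by simp
  next
    fix w c d assume c: "c \<in> hom C w x" and d: "d \<in> hom C w one"
      and eq: "pairing C R a b \<cdot> c = pairing C R tr tr \<cdot> d"
    have "a \<cdot> c = tr \<cdot> d"
      using arg_cong[OF eq, of "\<lambda>k. pr1 R \<cdot> k"] pairing_cmp[OF R a b c] tp[OF d]
        pr1_pairing[OF R cmp_hom[OF c a] cmp_hom[OF c b]] pr1_pairing[OF R cmp_hom[OF d tr]
          cmp_hom[OF d tr]] by simp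
    then obtain h where "h \<in> hom C w s" "m \<cdot> h = c" "bang C s one \<cdot> h = d"
      using pullback_lift[OF pb, of c w d] c d a tr m by (metis homD(2))
    then show "\<exists>h\<in>hom C w s. m \<cdot> h = c \<and> bang C s one \<cdot> h = d" by blast
  next
    fix w h k assume "h \<in> hom C w s" "k \<in> hom C w s" "m \<cdot> h = m \<cdot> k" "bang C s one \<cdot> h =
      bang C s one \<cdot> k"
    then show "h = k" using pullback_joint_mono[OF pb] homD(2)[OF m] by metis
  qed
  from pullback_paste[OF this meet_pullback[OF R]]
  have "is_pullback C m (bang C one one \<cdot> bang C s one) (meet C one Om tr R \<cdot> pairing C R a b) tr"
    using homD(2)[OF meet_hom[OF R]] homD(3)[OF pairing_hom[OF R a b]] by simp
  moreover have "bang C one one \<cdot> bang C s one = bang C s one"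
    using bang_eq[OF one] cmp_hom[OF bs bang_hom[OF one]] hom_ob bs by metis
  ultimately have "char_map C one Om tr m = meet C one Om tr R \<cdot> pairing C R a b"
    using char_map_eq[OF m cmp_hom[OF pairing_hom[OF R a b] meet_hom[OF R]]] by simp
  then show ?thesis using char_map_eq[OF m a pb] by simp
qed

text \<open>A pair whose meet is true factors through \<open>(true, true)\<close>, since that map is
  the pullback of truth along the meet; comparing second components gives the claim.\<close>

lemma meet_true_left:
  assumes R: "is_product C Om Om R" and b: "b \<in> hom C x Om"
    and eq: "meet C one Om tr R \<cdot> pairing C R (true_at x) b = true_at x"
  shows "b = true_at x"
proof -
  have x: "x \<in> ob C" using hom_ob b by blast
  note tx = true_at_hom[OF x]
  note p = pairing_hom[OF R tx b] and bx = bang_hom[OF one x]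
  obtain h where h: "h \<in> hom C x one" "pairing C R tr tr \<cdot> h = pairing C R (true_at x) b"
    using pullback_lift[OF meet_pullback[OF R], of "pairing C R (true_at x) b" x "bang C x one"]
      p bx eq homD(2)[OF tr] homD(2)[OF tr_pair_hom[OF R]] homD(2)[OF meet_hom[OF R]] by metis
  have "pairing C R (tr \<cdot> h) (tr \<cdot> h) = pairing C R (true_at x) b"
    using pairing_cmp[OF R tr tr h(1)] h by simp
  then show ?thesis
    using pr2_pairing[OF R tx b] pr2_pairing[OF R cmp_hom[OF h(1) tr] cmp_hom[OF h(1) tr]]
      true_cmp[OF h(1)] by metis
qed

text \<open>The equaliser is constructed with one product of the classifier with itself, but the
  formula is asserted for every such product. The canonical isomorphism between two products carries
  one meet to the other.\<close>

lemma meet_pairing_indep: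
  assumes R: "is_product C Om Om R" and R': "is_product C Om Om R'"
    and a: "a \<in> hom C x Om" and b: "b \<in> hom C x Om"
  shows "meet C one Om tr R \<cdot> pairing C R a b = meet C one Om tr R' \<cdot> pairing C R' a b"
proof -
  let ?i = "pairing C R' (pr1 R) (pr2 R)" and ?j = "pairing C R (pr1 R') (pr2 R')"
  note p = product_hom(1,2)[OF R] and p' = product_hom(1,2)[OF R']
  note i = pairing[OF R' p] and j = pairing[OF R p']
  have c: "?i \<cdot> pairing C R u v = pairing C R' u v" if "u \<in> hom C z Om" "v \<in> hom C z Om" for u v z
    using pairing_cmp[OF R' p pairing_hom[OF R that]] pairing[OF R that] by simp
  have c': "?j \<cdot> pairing C R' u v = pairing C R u v" if "u \<in> hom C z Om" "v \<in> hom C z Om" for u v z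
    using pairing_cmp[OF R p' pairing_hom[OF R' that]] pairing[OF R' that] by simp
  have ij: "?i \<cdot> ?j = idt C (vertex R')"
    using c[OF p'] pairing_eq[OF R' p', of "idt C (vertex R')"] p' idt_right idt_hom hom_ob by metis
  have ji: "?j \<cdot> ?i = idt C (vertex R)"
    using c'[OF p] pairing_eq[OF R p, of "idt C (vertex R)"] p idt_right idt_hom hom_ob by metis
  note tt = tr_pair_hom[OF R] and tt' = tr_pair_hom[OF R']
  have o: "one \<in> ob C" using hom_ob tr by blast
  have k: "meet C one Om tr R' \<cdot> ?i \<in> hom C (vertex R) Om" by (rule cmp_hom[OF i(1) meet_hom[OF R']])
  \<comment> \<open>The meet on \<open>R\<close> is by definition the characteristic map of
    \<open>(true, true)\<close> into \<open>R\<close>, so it is enough that the meet transported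
    from \<open>R'\<close> classifies this map.\<close>
  have "is_pullback C (pairing C R tr tr) (bang C one one) (meet C one Om tr R' \<cdot> ?i) tr"
    unfolding classified_iff[OF tt k]
  proof (intro conjI allI ballI impI)
    show "(meet C one Om tr R' \<cdot> ?i) \<cdot> pairing C R tr tr = true_at one"
      using assoc[OF tt i(1) meet_hom[OF R']] c[OF tr tr] meet_pullback[OF R']
        by (simp add: is_pullback_def)
    show "is_mono C (pairing C R tr tr)" using mono_from_terminal[OF one tt] .
  next
    fix z d assume d: "d \<in> hom C z (vertex R)" "(meet C one Om tr R' \<cdot> ?i) \<cdot> d = true_at z"
    then have "meet C one Om tr R' \<cdot> (?i \<cdot> d) = true_at z"
      using assoc[OF d(1) i(1) meet_hom[OF R']] by simp
    then obtain h where h: "h \<in> hom C z one" "pairing C R' tr tr \<cdot> h = ?i \<cdot> d"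
      using classified_iff[OF tt' meet_hom[OF R']] meet_pullback[OF R'] cmp_hom[OF d(1) i(1)] by metis
    have "pairing C R tr tr \<cdot> h = ?j \<cdot> (pairing C R' tr tr \<cdot> h)"
      using c'[OF tr tr] assoc[OF h(1) tt' j(1)] by simp
    also have "\<dots> = d" unfolding h using assoc[OF d(1) i(1) j(1)] ji idt_left[OF d(1)] by simp
    finally show "\<exists>h\<in>hom C z one. pairing C R tr tr \<cdot> h = d" using h by blast
  qed
  then have "meet C one Om tr R = meet C one Om tr R' \<cdot> ?i"
    unfolding meet_def[of C one Om tr R] by (rule char_map_eq[OF tt k])
  then show ?thesis using assoc[OF pairing_hom[OF R a b] i(1) meet_hom[OF R']] c[OF a b] by simp
qed

end

section \<open>Functor categories\<close>

lemma functor_ob: "\<lbrakk>is_functor C D F; x \<in> ob C\<rbrakk> \<Longrightarrow> fob F x \<in> ob D"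
  by (auto simp: is_functor_def)

lemma functor_hom: "\<lbrakk>is_functor C D F; f \<in> hom C x y\<rbrakk> \<Longrightarrow> far F f \<in> hom D (fob F x) (fob F y)"
  by (auto simp: is_functor_def hom_def)

lemma functor_idt: "\<lbrakk>is_functor C D F; x \<in> ob C\<rbrakk> \<Longrightarrow> far F (idt C x) = idt D (fob F x)"
  by (auto simp: is_functor_def)

lemma functor_cmp: "\<lbrakk>is_functor C D F; f \<in> hom C x y; g \<in> hom C y z\<rbrakk> \<Longrightarrow>
    far F (g \<cdot>\<^bsub>C\<^esub> f) = far F g \<cdot>\<^bsub>D\<^esub> far F f"
  by (auto simp: is_functor_def hom_def)

lemma functor_eqI:
  assumes F: "is_functor C D F" and G: "is_functor C D G"
    and "\<And>x. x \<in> ob C \<Longrightarrow> fob F x = fob G x" "\<And>f. f \<in> ar C \<Longrightarrow> far F f = far G f"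
  shows "F = G"
proof -
  have "fob F = fob G" by (rule extensionalityI[of _ "ob C"])
    (use assms in \<open>auto simp: is_functor_def PiE_def\<close>)
  moreover have "far F = far G" by (rule extensionalityI[of _ "ar C"])
    (use assms in \<open>auto simp: is_functor_def\<close>)
  ultimately show ?thesis by simp
qed

definition mk_fctr :: "('o, 'a) cat \<Rightarrow> ('o \<Rightarrow> 'p) \<Rightarrow> ('a \<Rightarrow> 'b) \<Rightarrow> ('o, 'a, 'p, 'b) fctr" where
  "mk_fctr C X f = \<lparr>fob = restrict X (ob C), far = restrict f (ar C)\<rparr>"

lemma fob_mk_fctr [simp]: "x \<in> ob C \<Longrightarrow> fob (mk_fctr C X f) x = X x"
  and far_mk_fctr [simp]: "a \<in> ar C \<Longrightarrow> far (mk_fctr C X f) a = f a"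
  by (simp_all add: mk_fctr_def)

lemma is_functor_mk_fctr:
  assumes C: "category C"
    and "\<And>x. x \<in> ob C \<Longrightarrow> X x \<in> ob D"
    and "\<And>x y a. a \<in> hom C x y \<Longrightarrow> f a \<in> hom D (X x) (X y)"
    and "\<And>x. x \<in> ob C \<Longrightarrow> f (idt C x) = idt D (X x)"
    and cmp: "\<And>x y z a b. \<lbrakk>a \<in> hom C x y; b \<in> hom C y z\<rbrakk> \<Longrightarrow> f (b \<cdot>\<^bsub>C\<^esub> a) = f b \<cdot>\<^bsub>D\<^esub> f a"
  shows "is_functor C D (mk_fctr C X f)"
  unfolding is_functor_def
proof (intro conjI ballI impI)
  interpret C: category C by fact
  show "fob (mk_fctr C X f) \<in> ob C \<rightarrow>\<^sub>E ob D" using assms by (auto simp: mk_fctr_def)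
  show "far (mk_fctr C X f) \<in> extensional (ar C)" by (simp add: mk_fctr_def)
  show "far (mk_fctr C X f) a \<in> hom D (fob (mk_fctr C X f) (src C a)) (fob (mk_fctr C X f) (tgt C a))"
    if "a \<in> ar C" for a
    using assms(3)[OF C.homI[OF that]] C.src_ob C.tgt_ob that by simp
  show "far (mk_fctr C X f) (idt C x) = idt D (fob (mk_fctr C X f) x)" if "x \<in> ob C" for x
    using C.idt_hom[OF that] assms(4)[OF that] that by (simp add: C.homD)
  show "far (mk_fctr C X f) (b \<cdot>\<^bsub>C\<^esub> a) = far (mk_fctr C X f) b \<cdot>\<^bsub>D\<^esub> far (mk_fctr C X f) a"
    if "a \<in> ar C" "b \<in> ar C" "src C b = tgt C a" for a b
  proof -
    have b: "b \<in> hom C (tgt C a) (tgt C b)" using that by (simp add: hom_def)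
    show ?thesis using C.cmp_hom[OF C.homI[OF that(1)] b] cmp[OF C.homI[OF that(1)] b] that
      by (simp add: hom_def)
  qed
qed

lemma fob_comp_fctr [simp]: "x \<in> ob C \<Longrightarrow> fob (comp_fctr C G F) x = fob G (fob F x)"
  and far_comp_fctr [simp]: "f \<in> ar C \<Longrightarrow> far (comp_fctr C G F) f = far G (far F f)"
  by (simp_all add: comp_fctr_def compose_def)

lemma is_functor_comp_fctr:
  assumes C: "category C" and F: "is_functor C D F" and G: "is_functor D K G"
  shows "is_functor C K (comp_fctr C G F)"
proof -
  interpret C: category C by fact
  have "comp_fctr C G F = mk_fctr C (\<lambda>x. fob G (fob F x)) (\<lambda>f. far G (far F f))"
    by (simp add: comp_fctr_def mk_fctr_def compose_def restrict_def)
  moreover have "is_functor C K \<dots>"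
  proof (rule is_functor_mk_fctr[OF C])
    show "fob G (fob F x) \<in> ob K" if "x \<in> ob C" for x by (rule functor_ob[OF G functor_ob[OF F that]])
    show "far G (far F a) \<in> hom K (fob G (fob F x)) (fob G (fob F y))" if "a \<in> hom C x y" for a x y
      by (rule functor_hom[OF G functor_hom[OF F that]])
    show "far G (far F (idt C x)) = idt K (fob G (fob F x))" if "x \<in> ob C" for x
      by (simp add: functor_idt[OF F that] functor_idt[OF G functor_ob[OF F that]])
    show "far G (far F (b \<cdot>\<^bsub>C\<^esub> a)) = far G (far F b) \<cdot>\<^bsub>K\<^esub> far G (far F a)"
      if "a \<in> hom C x y" "b \<in> hom C y z" for a b x y z
      by (simp add: functor_cmp[OF F that] functor_cmp[OF G functor_hom[OF F that(1)]
        functor_hom[OF F that(2)]])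
  qed
  ultimately show ?thesis by simp
qed

lemma comp_fctr_assoc:
  assumes C: "category C" and F: "is_functor C D F"
  shows "comp_fctr C (comp_fctr D H G) F = comp_fctr C H (comp_fctr C G F)"
proof -
  have "fob F x \<in> ob D" if "x \<in> ob C" for x by (rule functor_ob[OF F that])
  moreover have "far F f \<in> ar D" if "f \<in> ar C" for f
    using F that by (auto simp: is_functor_def hom_def)
  ultimately show ?thesis by (auto simp: comp_fctr_def compose_def fun_eq_iff restrict_def)
qed

lemma comp_fctr_id_fctr:
  assumes "is_functor C D F"
  shows "comp_fctr C F (id_fctr C) = F"
proof -
  have "compose (ob C) (fob F) (restrict (\<lambda>x. x) (ob C)) = fob F"
    "compose (ar C) (far F) (restrict (\<lambda>x. x) (ar C)) = far F"
    using assms by (auto simp: is_functor_def compose_def fun_eq_iff restrict_def PiE_def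
      extensional_def)
  then show ?thesis by (simp add: comp_fctr_def id_fctr_def)
qed

section \<open>Natural transformations, constant functors and whiskering\<close>

definition mk_nt :: "('o, 'a) cat \<Rightarrow> ('o, 'a, 'p, 'b) fctr \<Rightarrow> ('o, 'a, 'p, 'b) fctr \<Rightarrow> ('o \<Rightarrow> 'b)
    \<Rightarrow> ('o, 'a, 'p, 'b) ntrans" where
  "mk_nt C X Y c = \<lparr>nsrc = X, ntgt = Y, cpt = restrict c (ob C)\<rparr>"

lemma cpt_mk_nt [simp]: "x \<in> ob C \<Longrightarrow> cpt (mk_nt C X Y c) x = c x"
  by (simp add: mk_nt_def)

lemma hom_fun_cat: "t \<in> hom (fun_cat C E) X Y \<longleftrightarrow> is_ntrans C E t \<and> nsrc t = X \<and> ntgt t = Y"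
  by (simp add: hom_def fun_cat_def)

lemma ob_fun_cat: "X \<in> ob (fun_cat C E) \<longleftrightarrow> is_functor C E X"
  by (simp add: fun_cat_def)

lemma nt_functor: "t \<in> hom (fun_cat C E) X Y \<Longrightarrow> is_functor C E X" "t \<in> hom (fun_cat C E) X Y \<Longrightarrow>
  is_functor C E Y"
  by (auto simp: hom_fun_cat is_ntrans_def)

lemma nt_cpt: "\<lbrakk>t \<in> hom (fun_cat C E) X Y; x \<in> ob C\<rbrakk> \<Longrightarrow> cpt t x \<in> hom E (fob X x) (fob Y x)"
  by (auto simp: hom_fun_cat is_ntrans_def)

lemma nt_nat: "\<lbrakk>t \<in> hom (fun_cat C E) X Y; f \<in> hom C x y\<rbrakk> \<Longrightarrow> far Y f \<cdot>\<^bsub>E\<^esub> cpt t x = cpt t y \<cdot>\<^bsub>E\<^esub> far X f"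
  unfolding hom_fun_cat is_ntrans_def by (auto simp: hom_def)

lemma nt_eqI:
  assumes "t \<in> hom (fun_cat C E) X Y" "s \<in> hom (fun_cat C E) X Y" "\<And>x. x \<in> ob C \<Longrightarrow> cpt t x = cpt s x"
  shows "t = s"
proof -
  have "cpt t = cpt s"
    by (rule extensionalityI[of _ "ob C"]) (use assms in \<open>auto simp: hom_fun_cat is_ntrans_def\<close>)
  then show ?thesis using assms by (auto simp: hom_fun_cat)
qed

lemma mk_nt_hom:
  assumes C: "category C" and X: "is_functor C E X" and Y: "is_functor C E Y"
    and c: "\<And>x. x \<in> ob C \<Longrightarrow> c x \<in> hom E (fob X x) (fob Y x)"
    and nat: "\<And>f x y. f \<in> hom C x y \<Longrightarrow> far Y f \<cdot>\<^bsub>E\<^esub> c x = c y \<cdot>\<^bsub>E\<^esub> far X f"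
  shows "mk_nt C X Y c \<in> hom (fun_cat C E) X Y"
proof -
  interpret C: category C by fact
  show ?thesis
    unfolding hom_fun_cat is_ntrans_def
    using X Y c nat[OF C.homI] C.src_ob C.tgt_ob by (simp add: mk_nt_def)
qed

lemma cpt_cmp [simp]: "x \<in> ob C \<Longrightarrow> cpt (t \<cdot>\<^bsub>fun_cat C E\<^esub> s) x = cpt t x \<cdot>\<^bsub>E\<^esub> cpt s x"
  by (simp add: fun_cat_def)

lemma cpt_idt [simp]: "x \<in> ob C \<Longrightarrow> cpt (idt (fun_cat C E) X) x = idt E (fob X x)"
  by (simp add: fun_cat_def)

lemma category_fun_cat:
  assumes C: "category C" and E: "category E"
  shows "category (fun_cat C E)"
proof -
  interpret C: category C by fact
  interpret E: category E by fact
  have i: "idt (fun_cat C E) X \<in> hom (fun_cat C E) X X" if X: "is_functor C E X" for X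
  proof -
    have "idt (fun_cat C E) X = mk_nt C X X (\<lambda>x. idt E (fob X x))" by (simp add: fun_cat_def mk_nt_def)
    moreover have "\<dots> \<in> hom (fun_cat C E) X X"
    proof (rule mk_nt_hom[OF C X X])
      show "idt E (fob X x) \<in> hom E (fob X x) (fob X x)" if "x \<in> ob C" for x
        using E.idt_hom functor_ob[OF X that] by blast
      show "far X f \<cdot>\<^bsub>E\<^esub> idt E (fob X x) = idt E (fob X y) \<cdot>\<^bsub>E\<^esub> far X f" if "f \<in> hom C x y" for f x y
        using E.idt_left E.idt_right functor_hom[OF X that] by metis
    qed
    ultimately show ?thesis by simp
  qed
  have c: "s \<cdot>\<^bsub>fun_cat C E\<^esub> t \<in> hom (fun_cat C E) X Z"
    if t: "t \<in> hom (fun_cat C E) X Y" and s: "s \<in> hom (fun_cat C E) Y Z" for s t X Y Z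
  proof -
    have "s \<cdot>\<^bsub>fun_cat C E\<^esub> t = mk_nt C X Z (\<lambda>x. cpt s x \<cdot>\<^bsub>E\<^esub> cpt t x)"
      using t[unfolded hom_fun_cat] s[unfolded hom_fun_cat] by (simp add: fun_cat_def mk_nt_def)
    moreover have "\<dots> \<in> hom (fun_cat C E) X Z"
    proof (rule mk_nt_hom[OF C nt_functor(1)[OF t] nt_functor(2)[OF s]])
      show "cpt s x \<cdot>\<^bsub>E\<^esub> cpt t x \<in> hom E (fob X x) (fob Z x)" if "x \<in> ob C" for x
        using E.cmp_hom[OF nt_cpt[OF t that] nt_cpt[OF s that]] .
      fix f x y assume f: "f \<in> hom C x y"
      note x = C.hom_ob[OF f]
      note X = functor_hom[OF nt_functor(1)[OF t] f] and Y = functor_hom[OF nt_functor(2)[OF t] f]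
        and Z = functor_hom[OF nt_functor(2)[OF s] f]
      note tx = nt_cpt[OF t x(1)] nt_cpt[OF t x(2)] and sx = nt_cpt[OF s x(1)] nt_cpt[OF s x(2)]
      show "far Z f \<cdot>\<^bsub>E\<^esub> cpt s x \<cdot>\<^bsub>E\<^esub> cpt t x = (cpt s y \<cdot>\<^bsub>E\<^esub> cpt t y) \<cdot>\<^bsub>E\<^esub> far X f"
        using E.assoc[OF tx(1) sx(1) Z] E.assoc[OF tx(1) Y sx(2)] E.assoc[OF X tx(2) sx(2)]
          nt_nat[OF t f] nt_nat[OF s f] by simp
    qed
    ultimately show ?thesis by simp
  qed
  show ?thesis
  proof
    show "src (fun_cat C E) f \<in> ob (fun_cat C E)" "tgt (fun_cat C E) f \<in> ob (fun_cat C E)"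
      if "f \<in> ar (fun_cat C E)" for f
      using that by (auto simp: fun_cat_def is_ntrans_def)
    show "idt (fun_cat C E) X \<in> hom (fun_cat C E) X X" if "X \<in> ob (fun_cat C E)" for X
      using i that by (simp add: ob_fun_cat)
    show "idt (fun_cat C E) Y \<cdot>\<^bsub>fun_cat C E\<^esub> f = f" if f: "f \<in> hom (fun_cat C E) X Y" for f X Y
      by (rule nt_eqI[OF c[OF f i[OF nt_functor(2)[OF f]]] f]) (simp add: E.idt_left[OF nt_cpt[OF f]])
    show "f \<cdot>\<^bsub>fun_cat C E\<^esub> idt (fun_cat C E) X = f" if f: "f \<in> hom (fun_cat C E) X Y" for f X Y
      by (rule nt_eqI[OF c[OF i[OF nt_functor(1)[OF f]] f] f]) (simp add: E.idt_right[OF nt_cpt[OF f]])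
    show "(h \<cdot>\<^bsub>fun_cat C E\<^esub> g) \<cdot>\<^bsub>fun_cat C E\<^esub> f = h \<cdot>\<^bsub>fun_cat C E\<^esub> g \<cdot>\<^bsub>fun_cat C E\<^esub> f"
      if f: "f \<in> hom (fun_cat C E) W X" and g: "g \<in> hom (fun_cat C E) X Y"
        and h: "h \<in> hom (fun_cat C E) Y Z"
      for f g h W X Y Z
      by (rule nt_eqI[OF c[OF f c[OF g h]] c[OF c[OF f g] h]])
        (simp add: E.assoc[OF nt_cpt[OF f] nt_cpt[OF g] nt_cpt[OF h]])
  qed (rule c)
qed

definition const_fctr :: "('o, 'a) cat \<Rightarrow> ('p, 'b) cat \<Rightarrow> 'p \<Rightarrow> ('o, 'a, 'p, 'b) fctr" where
  "const_fctr C E x = mk_fctr C (\<lambda>_. x) (\<lambda>_. idt E x)"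

lemma fob_const_fctr [simp]: "x \<in> ob C \<Longrightarrow> fob (const_fctr C E p) x = p"
  and far_const_fctr [simp]: "f \<in> ar C \<Longrightarrow> far (const_fctr C E p) f = idt E p"
  by (simp_all add: const_fctr_def)

text \<open>An equality, not an isomorphism. This is why truth maps are taken to start at constant
  functors: restricting one along a functor leaves its domain of the same form.\<close>

lemma comp_const_fctr:
  assumes "is_functor C D F"
  shows "comp_fctr C (const_fctr D E p) F = const_fctr C E p"
  using assms by (auto simp: comp_fctr_def const_fctr_def mk_fctr_def compose_def restrict_def
    fun_eq_iff is_functor_def hom_def)

lemma cpt_whisker [simp]: "x \<in> ob C \<Longrightarrow> cpt (whisker C t F) x = cpt t (fob F x)"
  by (simp add: whisker_def compose_def)

lemma whisker_hom:
  assumes C: "category C" and F: "is_functor C D F" and t: "t \<in> hom (fun_cat D E) X Y"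
  shows "whisker C t F \<in> hom (fun_cat C E) (comp_fctr C X F) (comp_fctr C Y F)"
proof -
  interpret C: category C by fact
  have "whisker C t F = mk_nt C (comp_fctr C X F) (comp_fctr C Y F) (\<lambda>x. cpt t (fob F x))"
    using t by (simp add: whisker_def mk_nt_def hom_fun_cat compose_def restrict_def)
  moreover have "\<dots> \<in> hom (fun_cat C E) (comp_fctr C X F) (comp_fctr C Y F)"
  proof (rule mk_nt_hom[OF C])
    show "is_functor C E (comp_fctr C X F)" "is_functor C E (comp_fctr C Y F)"
      using is_functor_comp_fctr[OF C F] nt_functor[OF t] by blast+
    show "cpt t (fob F x) \<in> hom E (fob (comp_fctr C X F) x) (fob (comp_fctr C Y F) x)" if "x \<in> ob C"
      for x
      using nt_cpt[OF t functor_ob[OF F that]] that by simp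
    show "far (comp_fctr C Y F) f \<cdot>\<^bsub>E\<^esub> cpt t (fob F x) = cpt t (fob F y) \<cdot>\<^bsub>E\<^esub> far (comp_fctr C X F) f"
      if "f \<in> hom C x y" for f x y
      using nt_nat[OF t functor_hom[OF F that]] C.homD(1)[OF that] by simp
  qed
  ultimately show ?thesis by simp
qed

lemma whisker_comp:
  assumes "category C" "is_functor C D F"
  shows "whisker C (whisker D t G) F = whisker C t (comp_fctr C G F)"
proof -
  have "compose (ob C) (compose (ob D) (cpt t) (fob G)) (fob F) =
    compose (ob C) (cpt t) (compose (ob C) (fob G) (fob F))"
    using functor_ob[OF assms(2)] by (auto simp: compose_def)
  then show ?thesis by (simp add: whisker_def comp_fctr_assoc[OF assms]) (simp add: comp_fctr_def)
qed

text \<open>Pullbacks and a terminal object generate the products and equalisers used below. Fixing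
  \<open>pt\<close> gives all functor categories into \<open>E\<close> terminal objects that match
  under restriction.\<close>

locale finitely_complete = category E for E :: "('p, 'b) cat" (structure) +
  fixes pt :: 'p
  assumes pullbacks: "has_pullbacks E" and pt: "is_terminal E pt"

section \<open>Pullbacks, terminal objects, products and equalisers computed pointwise\<close>

locale complete_functor_category = C: category C + E: finitely_complete E pt
  for C :: "('o, 'a) cat" and E :: "('p, 'b) cat" (structure) and pt
begin

sublocale FC: category "fun_cat C E"
  by (rule category_fun_cat) unfold_locales

lemma pullback_pointwiseI:
  assumes p: "p \<in> hom (fun_cat C E) V X" and q: "q \<in> hom (fun_cat C E) V Y"
    and f: "f \<in> hom (fun_cat C E) X Z" and g: "g \<in> hom (fun_cat C E) Y Z"
    and pw: "\<And>x. x \<in> ob C \<Longrightarrow> is_pullback E (cpt p x) (cpt q x) (cpt f x) (cpt g x)"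
  shows "is_pullback (fun_cat C E) p q f g"
proof (rule FC.pullbackI[OF p q f g])
  show "f \<cdot>\<^bsub>fun_cat C E\<^esub> p = g \<cdot>\<^bsub>fun_cat C E\<^esub> q"
    by (rule nt_eqI[OF FC.cmp_hom[OF p f] FC.cmp_hom[OF q g]]) (use pw in \<open>simp add: is_pullback_def\<close>)
next
  fix W a b assume a: "a \<in> hom (fun_cat C E) W X" and b: "b \<in> hom (fun_cat C E) W Y"
    and ab: "f \<cdot>\<^bsub>fun_cat C E\<^esub> a = g \<cdot>\<^bsub>fun_cat C E\<^esub> b"
  have "\<exists>h. h \<in> hom E (fob W x) (fob V x) \<and> cpt p x \<cdot> h = cpt a x \<and> cpt q x \<cdot> h = cpt b x"
    if x: "x \<in> ob C" for x
  proof -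
    have "cpt f x \<cdot> cpt a x = cpt g x \<cdot> cpt b x" using arg_cong[OF ab, of "\<lambda>t. cpt t x"] x by simp
    then show ?thesis
      using E.pullback_lift[OF pw[OF x], of "cpt a x" "fob W x" "cpt b x"] nt_cpt[OF a x] nt_cpt[OF b x]
        E.homD(2)[OF nt_cpt[OF p x]] E.homD(2)[OF nt_cpt[OF f x]] E.homD(2)[OF nt_cpt[OF g x]] by metis
  qed
  then obtain h where h: "\<And>x. x \<in> ob C \<Longrightarrow> h x \<in> hom E (fob W x) (fob V x)"
    "\<And>x. x \<in> ob C \<Longrightarrow> cpt p x \<cdot> h x = cpt a x" "\<And>x. x \<in> ob C \<Longrightarrow> cpt q x \<cdot> h x = cpt b x" by metis
  have W: "is_functor C E W" and V: "is_functor C E V" using nt_functor a p by blast+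
  have H: "mk_nt C W V h \<in> hom (fun_cat C E) W V"
  proof (rule mk_nt_hom[OF C.category_axioms W V h(1)])
    fix k x y assume k: "k \<in> hom C x y"
    note x = C.hom_ob[OF k]
    note Vk = functor_hom[OF V k] and Wk = functor_hom[OF W k]
    \<comment> \<open>Naturality of the pointwise lift is tested after both projections;
      \<open>r\<close> stands for \<open>p\<close> as well as for \<open>q\<close>.\<close>
    have e: "cpt r y \<cdot> (far V k \<cdot> h x) = cpt r y \<cdot> (h y \<cdot> far W k)"
      if r: "r \<in> hom (fun_cat C E) V U" and s: "s \<in> hom (fun_cat C E) W U"
        and rs: "\<And>x. x \<in> ob C \<Longrightarrow> cpt r x \<cdot> h x = cpt s x" for r s U
      using E.assoc[OF h(1)[OF x(1)] Vk nt_cpt[OF r x(2)]] E.assoc[OF Wk h(1)[OF x(2)]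
        nt_cpt[OF r x(2)]]
        E.assoc[OF h(1)[OF x(1)] nt_cpt[OF r x(1)] functor_hom[OF nt_functor(2)[OF r] k]]
        nt_nat[OF r k] nt_nat[OF s k] rs[OF x(1)] rs[OF x(2)] by simp
    show "far V k \<cdot> h x = h y \<cdot> far W k"
    proof (rule E.pullback_joint_mono[OF pw[OF x(2)]])
      show "far V k \<cdot> h x \<in> hom E (fob W x) (src E (cpt p y))"
        "h y \<cdot> far W k \<in> hom E (fob W x) (src E (cpt p y))"
        using E.cmp_hom[OF h(1)[OF x(1)] Vk] E.cmp_hom[OF Wk h(1)[OF x(2)]]
          E.homD(2)[OF nt_cpt[OF p x(2)]] by simp_all
    qed (use e[OF p a h(2)] e[OF q b h(3)] in simp_all)
  qed
  show "\<exists>h\<in>hom (fun_cat C E) W V. p \<cdot>\<^bsub>fun_cat C E\<^esub> h = a \<and> q \<cdot>\<^bsub>fun_cat C E\<^esub> h = b"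
  proof (intro bexI[OF _ H] conjI)
    show "p \<cdot>\<^bsub>fun_cat C E\<^esub> mk_nt C W V h = a" by (rule nt_eqI[OF FC.cmp_hom[OF H p] a]) (simp add: h)
    show "q \<cdot>\<^bsub>fun_cat C E\<^esub> mk_nt C W V h = b" by (rule nt_eqI[OF FC.cmp_hom[OF H q] b]) (simp add: h)
  qed
next
  fix W h k assume h: "h \<in> hom (fun_cat C E) W V" and k: "k \<in> hom (fun_cat C E) W V"
    and e: "p \<cdot>\<^bsub>fun_cat C E\<^esub> h = p \<cdot>\<^bsub>fun_cat C E\<^esub> k" "q \<cdot>\<^bsub>fun_cat C E\<^esub> h = q \<cdot>\<^bsub>fun_cat C E\<^esub> k"
  show "h = k"
  proof (rule nt_eqI[OF h k])
    fix x assume x: "x \<in> ob C"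
    show "cpt h x = cpt k x"
      using E.pullback_joint_mono[OF pw[OF x], of "cpt h x" "fob W x" "cpt k x"] nt_cpt[OF h x]
        nt_cpt[OF k x]
        E.homD(2)[OF nt_cpt[OF p x]] arg_cong[OF e(1), of "\<lambda>t. cpt t x"]
          arg_cong[OF e(2), of "\<lambda>t. cpt t x"] x by simp
  qed
qed

text \<open>A pullback is chosen at each object. Its universal property supplies the action on
  arrows, and joint monicity of the projections makes this action functorial and the projections
  natural by construction.\<close>

lemma pointwise_pullback_exists:
  assumes f: "f \<in> hom (fun_cat C E) X Z" and g: "g \<in> hom (fun_cat C E) Y Z"
  obtains V p q where "p \<in> hom (fun_cat C E) V X" "q \<in> hom (fun_cat C E) V Y"
    "\<And>x. x \<in> ob C \<Longrightarrow> is_pullback E (cpt p x) (cpt q x) (cpt f x) (cpt g x)"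
proof -
  have X: "is_functor C E X" and Y: "is_functor C E Y" and Z: "is_functor C E Z" using nt_functor f g
    by blast+
  have "\<exists>p q. is_pullback E p q (cpt f x) (cpt g x)" if "x \<in> ob C" for x
    using E.pullbacks nt_cpt[OF f that] nt_cpt[OF g that] unfolding has_pullbacks_def by blast
  then obtain p q where pb: "\<And>x. x \<in> ob C \<Longrightarrow> is_pullback E (p x) (q x) (cpt f x) (cpt g x)" by metis
  define v where "v x = src E (p x)" for x
  have p: "p x \<in> hom E (v x) (fob X x)" and q: "q x \<in> hom E (v x) (fob Y x)"
    and fg: "cpt f x \<cdot> p x = cpt g x \<cdot> q x" if "x \<in> ob C" for x
    using E.pullback_hom[OF pb[OF that]] E.homD(2)[OF nt_cpt[OF f that]] E.homD(2)[OF nt_cpt[OF g that]]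
    by (simp_all add: v_def)
  have lift: "\<exists>h. h \<in> hom E w (v x) \<and> p x \<cdot> h = a \<and> q x \<cdot> h = b"
    if "x \<in> ob C" "a \<in> hom E w (fob X x)" "b \<in> hom E w (fob Y x)" "cpt f x \<cdot> a = cpt g x \<cdot> b"
      for x w a b
    using E.pullback_lift[OF pb[OF that(1)], of a w b] that E.homD(2)[OF nt_cpt[OF f that(1)]]
      E.homD(2)[OF nt_cpt[OF g that(1)]]
    unfolding v_def by metis
  have jm: "h = k" if "x \<in> ob C" "h \<in> hom E w (v x)" "k \<in> hom E w (v x)"
    "p x \<cdot> h = p x \<cdot> k" "q x \<cdot> h = q x \<cdot> k" for x w h k
    using E.pullback_joint_mono[OF pb[OF that(1)]] that unfolding v_def by blast
  have "\<exists>h. h \<in> hom E (v (src C k)) (v (tgt C k)) \<and> p (tgt C k) \<cdot> h = far X k \<cdot> p (src C k) \<and>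
      q (tgt C k) \<cdot> h = far Y k \<cdot> q (src C k)" if "k \<in> ar C" for k
  proof -
    let ?x = "src C k" and ?y = "tgt C k"
    have k: "k \<in> hom C ?x ?y" by (rule C.homI[OF that])
    note x = C.hom_ob[OF k]
    note Xk = functor_hom[OF X k] and Yk = functor_hom[OF Y k] and Zk = functor_hom[OF Z k]
    have "cpt f ?y \<cdot> (far X k \<cdot> p ?x) = far Z k \<cdot> (cpt f ?x \<cdot> p ?x)"
      using E.assoc[OF p[OF x(1)] Xk nt_cpt[OF f x(2)]] E.assoc[OF p[OF x(1)] nt_cpt[OF f x(1)] Zk]
        nt_nat[OF f k] by simp
    also have "\<dots> = cpt g ?y \<cdot> (far Y k \<cdot> q ?x)" unfolding fg[OF x(1)]
      using E.assoc[OF q[OF x(1)] Yk nt_cpt[OF g x(2)]] E.assoc[OF q[OF x(1)] nt_cpt[OF g x(1)] Zk]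
        nt_nat[OF g k] by simp
    finally show ?thesis
      using lift[OF x(2) E.cmp_hom[OF p[OF x(1)] Xk] E.cmp_hom[OF q[OF x(1)] Yk]] by blast
  qed
  then obtain w where w: "\<And>k. k \<in> ar C \<Longrightarrow> w k \<in> hom E (v (src C k)) (v (tgt C k))"
    "\<And>k. k \<in> ar C \<Longrightarrow> p (tgt C k) \<cdot> w k = far X k \<cdot> p (src C k)"
    "\<And>k. k \<in> ar C \<Longrightarrow> q (tgt C k) \<cdot> w k = far Y k \<cdot> q (src C k)" by metis
  have w_hom: "w k \<in> hom E (v x) (v y)" and pw: "p y \<cdot> w k = far X k \<cdot> p x"
    and qw: "q y \<cdot> w k = far Y k \<cdot> q x" if "k \<in> hom C x y" for k x y
    using w[OF C.homD(1)[OF that]] C.homD(2,3)[OF that] by simp_all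
  let ?V = "mk_fctr C v w"
  have V: "is_functor C E ?V"
  proof (rule is_functor_mk_fctr[OF C.category_axioms _ w_hom])
    show "v x \<in> ob E" if "x \<in> ob C" for x using E.hom_ob(1)[OF p[OF that]] .
  next
    fix x assume x: "x \<in> ob C"
    note i = C.idt_hom[OF x]
    have ie: "idt E (v x) \<in> hom E (v x) (v x)" using E.idt_hom E.hom_ob(1)[OF p[OF x]] by blast
    show "w (idt C x) = idt E (v x)"
      by (rule jm[OF x w_hom[OF i] ie])
        (simp_all add: pw[OF i] qw[OF i] functor_idt[OF X x] functor_idt[OF Y x] E.idt_left[OF p[OF x]]
          E.idt_right[OF p[OF x]]
          E.idt_left[OF q[OF x]] E.idt_right[OF q[OF x]])
  next
    fix x y z a b assume a: "a \<in> hom C x y" and b: "b \<in> hom C y z"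
    note ba = C.cmp_hom[OF a b]
    have e: "r z \<cdot> w (b \<cdot>\<^bsub>C\<^esub> a) = r z \<cdot> (w b \<cdot> w a)"
      if R: "is_functor C E R" and r: "\<And>x. x \<in> ob C \<Longrightarrow> r x \<in> hom E (v x) (fob R x)"
        and rw: "\<And>k x y. k \<in> hom C x y \<Longrightarrow> r y \<cdot> w k = far R k \<cdot> r x" for R r
    proof -
      note x = C.hom_ob[OF a] C.hom_ob(2)[OF b]
      note Ra = functor_hom[OF R a] and Rb = functor_hom[OF R b]
      have "r z \<cdot> w (b \<cdot>\<^bsub>C\<^esub> a) = (far R b \<cdot> far R a) \<cdot> r x"
        unfolding rw[OF ba] functor_cmp[OF R a b] ..
      also have "\<dots> = r z \<cdot> (w b \<cdot> w a)"
        using E.assoc[OF r[OF x(1)] Ra Rb] E.assoc[OF w_hom[OF a] r[OF x(2)] Rb] E.assoc[OF w_hom[OF a]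
          w_hom[OF b] r[OF x(3)]]
          rw[OF a] rw[OF b] by simp
      finally show ?thesis .
    qed
    show "w (b \<cdot>\<^bsub>C\<^esub> a) = w b \<cdot> w a"
      by (rule jm[OF C.hom_ob(2)[OF b] w_hom[OF ba] E.cmp_hom[OF w_hom[OF a] w_hom[OF b]]])
        (use e[OF X p pw] e[OF Y q qw] in simp_all)
  qed
  have "mk_nt C ?V X p \<in> hom (fun_cat C E) ?V X" "mk_nt C ?V Y q \<in> hom (fun_cat C E) ?V Y"
    using p q pw qw C.hom_ob C.homD(1) by (auto intro!: mk_nt_hom C.category_axioms V X Y)
  then show ?thesis by (rule that) (use pb in simp)
qed

lemma has_pullbacks_fun_cat: "has_pullbacks (fun_cat C E)"
  unfolding has_pullbacks_def
proof (intro allI ballI)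
  fix X Y Z f g assume fg: "f \<in> hom (fun_cat C E) X Z" "g \<in> hom (fun_cat C E) Y Z"
  then show "\<exists>p q. is_pullback (fun_cat C E) p q f g"
    by (rule pointwise_pullback_exists) (use pullback_pointwiseI[OF _ _ fg] in blast)
qed

text \<open>A given pullback of functors is compared with the one built from pullbacks in
  \<open>E\<close>. Universality makes the two comparison maps mutually inverse, and evaluating them
  at \<open>x\<close> transports the pullback property.\<close>

lemma pullback_pointwise:
  assumes pb: "is_pullback (fun_cat C E) p q f g" and x: "x \<in> ob C"
  shows "is_pullback E (cpt p x) (cpt q x) (cpt f x) (cpt g x)"
proof -
  let ?F = "fun_cat C E"
  note h = FC.pullback_hom[OF pb]
  obtain V p' q' where p': "p' \<in> hom ?F V (src ?F f)" and q': "q' \<in> hom ?F V (src ?F g)"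
    and pw: "\<And>x. x \<in> ob C \<Longrightarrow> is_pullback E (cpt p' x) (cpt q' x) (cpt f x) (cpt g x)"
    by (rule pointwise_pullback_exists[OF h(3,4)]) (rule that)
  have pb': "is_pullback ?F p' q' f g" by (rule pullback_pointwiseI[OF p' q' h(3,4) pw])
  have s': "src ?F p' = V" by (rule FC.homD[OF p'])
  obtain k where k: "k \<in> hom ?F V (src ?F p)" "p \<cdot>\<^bsub>?F\<^esub> k = p'" "q \<cdot>\<^bsub>?F\<^esub> k = q'"
    using FC.pullback_lift[OF pb p' q'] pb' by (auto simp: is_pullback_def)
  obtain m where m: "m \<in> hom ?F (src ?F p) V" "p' \<cdot>\<^bsub>?F\<^esub> m = p" "q' \<cdot>\<^bsub>?F\<^esub> m = q"
    using FC.pullback_lift[OF pb' h(1,2)] h(5) s' by metis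
  have "m \<cdot>\<^bsub>?F\<^esub> k = idt ?F V"
    by (rule FC.pullback_joint_mono[OF pb', unfolded s', OF FC.cmp_hom[OF k(1) m(1)]
      FC.idt_hom[OF FC.hom_ob(1)[OF p']]])
      (use FC.assoc[OF k(1) m(1) p'] FC.assoc[OF k(1) m(1) q'] m k FC.idt_right[OF p']
        FC.idt_right[OF q'] in simp_all)
  moreover have "k \<cdot>\<^bsub>?F\<^esub> m = idt ?F (src ?F p)"
    by (rule FC.pullback_joint_mono[OF pb, OF FC.cmp_hom[OF m(1) k(1)]
      FC.idt_hom[OF FC.hom_ob(1)[OF h(1)]]])
      (use FC.assoc[OF m(1) k(1) h(1)] FC.assoc[OF m(1) k(1) h(2)] m k FC.idt_right[OF h(1)]
        FC.idt_right[OF h(2)] in simp_all)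
  ultimately have i: "cpt m x \<cdot> cpt k x = idt E (fob V x)" "cpt k x \<cdot> cpt m x =
    idt E (fob (src ?F p) x)"
    using cpt_cmp[OF x] cpt_idt[OF x] by metis+
  have s: "src E (cpt p' x) = fob V x" by (rule E.homD(2)[OF nt_cpt[OF p' x]])
  have "is_pullback E (cpt p' x \<cdot> cpt m x) (cpt q' x \<cdot> cpt m x) (cpt f x) (cpt g x)"
    by (rule E.pullback_iso[OF pw[OF x]]) (use i nt_cpt[OF m(1) x] nt_cpt[OF k(1) x] s in auto)
  then show ?thesis using m(2,3) cpt_cmp[OF x] by metis
qed

lemma mono_pointwise_iff:
  assumes m: "m \<in> hom (fun_cat C E) X Y"
  shows "is_mono (fun_cat C E) m \<longleftrightarrow> (\<forall>x \<in> ob C. is_mono E (cpt m x))"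
proof -
  let ?i = "idt (fun_cat C E) X"
  have i: "?i \<in> hom (fun_cat C E) X X" using FC.idt_hom FC.hom_ob m by blast
  have "is_mono (fun_cat C E) m \<longleftrightarrow> is_pullback (fun_cat C E) ?i ?i m m"
    using FC.mono_iff_pullback[OF FC.homD(1)[OF m]] FC.homD(2)[OF m] by simp
  also have "\<dots> \<longleftrightarrow> (\<forall>x \<in> ob C. is_pullback E (cpt ?i x) (cpt ?i x) (cpt m x) (cpt m x))"
    using pullback_pointwiseI[OF i i m m] pullback_pointwise by blast
  also have "\<dots> \<longleftrightarrow> (\<forall>x \<in> ob C. is_mono E (cpt m x))"
    using E.mono_iff_pullback E.homD[OF nt_cpt[OF m]] by simp
  finally show ?thesis .
qed

lemma is_functor_const_fctr: "p \<in> ob E \<Longrightarrow> is_functor C E (const_fctr C E p)"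
  unfolding const_fctr_def
  using E.idt_hom E.idt_left[OF E.idt_hom] by (intro is_functor_mk_fctr C.category_axioms) auto

abbreviation unit :: "('o, 'a, 'p, 'b) fctr" where
  "unit \<equiv> const_fctr C E pt"

lemma terminal_fun_cat: "is_terminal (fun_cat C E) unit"
  unfolding is_terminal_def
proof (intro conjI ballI)
  have pt: "pt \<in> ob E" using E.pt by (auto simp: is_terminal_def)
  show u: "unit \<in> ob (fun_cat C E)"
    using is_functor_const_fctr[OF pt] by (simp add: ob_fun_cat)
  fix X assume "X \<in> ob (fun_cat C E)"
  then have X: "is_functor C E X" by (simp add: ob_fun_cat)
  note b = E.bang_hom[OF E.pt functor_ob[OF X]]
  have "mk_nt C X unit (\<lambda>x. bang E (fob X x) pt) \<in> hom (fun_cat C E) X unit"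
  proof (rule mk_nt_hom[OF C.category_axioms X is_functor_const_fctr[OF pt]])
    show "bang E (fob X x) pt \<in> hom E (fob X x) (fob unit x)" if "x \<in> ob C" for x
      using b[OF that] that by simp
    show "far unit f \<cdot> bang E (fob X x) pt = bang E (fob X y) pt \<cdot> far X f" if f: "f \<in> hom C x y"
      for f x y
      using E.idt_left[OF b[OF C.hom_ob(1)[OF f]]] E.bang_eq[OF E.pt E.cmp_hom[OF functor_hom[OF X f]
        b[OF C.hom_ob(2)[OF f]]]]
        C.homD(1)[OF f] by simp
  qed
  moreover have "s = s'" if s: "s \<in> hom (fun_cat C E) X unit" and s': "s' \<in> hom (fun_cat C E) X unit"
    for s s'
    by (rule nt_eqI[OF s s'], rule E.terminal_eq[OF E.pt]) (use nt_cpt[OF s] nt_cpt[OF s'] in auto)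
  ultimately show "\<exists>!s. s \<in> hom (fun_cat C E) X unit" by blast
qed

sublocale FC: finitely_complete "fun_cat C E" unit
  using has_pullbacks_fun_cat terminal_fun_cat by unfold_locales

text \<open>Meant for the terminal objects that come with the boundary classifiers and for the
  matching object of the terminal functor, neither of which has to be constant.\<close>

lemma terminal_pointwise:
  assumes T: "is_terminal (fun_cat C E) T" and x: "x \<in> ob C"
  shows "is_terminal E (fob T x)"
proof -
  have o: "T \<in> ob (fun_cat C E)" "unit \<in> ob (fun_cat C E)"
    using T terminal_fun_cat by (auto simp: is_terminal_def)
  note u = FC.bang_hom[OF T o(2)] and v = FC.bang_hom[OF terminal_fun_cat o(1)]
  have "bang (fun_cat C E) unit T \<cdot>\<^bsub>fun_cat C E\<^esub> bang (fun_cat C E) T unit = idt (fun_cat C E) T"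
    by (rule FC.terminal_eq[OF T FC.cmp_hom[OF v u] FC.idt_hom[OF o(1)]])
  then have i: "cpt (bang (fun_cat C E) unit T) x \<cdot> cpt (bang (fun_cat C E) T unit) x = idt E (fob T x)"
    using cpt_cmp[OF x] cpt_idt[OF x] by metis
  have ux: "cpt (bang (fun_cat C E) unit T) x \<in> hom E pt (fob T x)" using nt_cpt[OF u x] x by simp
  have vx: "cpt (bang (fun_cat C E) T unit) x \<in> hom E (fob T x) pt" using nt_cpt[OF v x] x by simp
  show ?thesis
    unfolding is_terminal_def
  proof (intro conjI ballI)
    show "fob T x \<in> ob E" using E.hom_ob ux by blast
    fix w assume w: "w \<in> ob E"
    have "f = f'" if f: "f \<in> hom E w (fob T x)" and f': "f' \<in> hom E w (fob T x)" for f f'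
    proof -
      have "cpt (bang (fun_cat C E) T unit) x \<cdot> f = cpt (bang (fun_cat C E) T unit) x \<cdot> f'"
        by (rule E.terminal_eq[OF E.pt E.cmp_hom[OF f vx] E.cmp_hom[OF f' vx]])
      then show ?thesis using E.assoc[OF f vx ux] E.assoc[OF f' vx ux] i E.idt_left[OF f]
        E.idt_left[OF f'] by simp
    qed
    then show "\<exists>!f. f \<in> hom E w (fob T x)" using E.cmp_hom[OF E.bang_hom[OF E.pt w] ux] by blast
  qed
qed

lemma product_pointwise:
  assumes R: "is_product (fun_cat C E) X Y R" and x: "x \<in> ob C"
  shows "is_product E (fob X x) (fob Y x) (span_at R x)"
proof -
  note r = FC.product_hom[OF R]
  note b = FC.bang_hom[OF terminal_fun_cat r(3)] FC.bang_hom[OF terminal_fun_cat r(4)]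
  have "is_pullback E (cpt (pr1 R) x) (cpt (pr2 R) x) (cpt (bang (fun_cat C E) X unit) x) (cpt (bang
    (fun_cat C E) Y unit) x)"
    using FC.product_iff_pullback[OF terminal_fun_cat r(1,2)] R pullback_pointwise x by blast
  moreover have "cpt (bang (fun_cat C E) X unit) x =
    bang E (fob X x) pt" "cpt (bang (fun_cat C E) Y unit) x = bang E (fob Y x) pt"
    using E.bang_eq[OF E.pt, of _ "fob X x"] E.bang_eq[OF E.pt, of _ "fob Y x"] nt_cpt[OF b(1) x]
      nt_cpt[OF b(2) x] x by simp_all
  ultimately show ?thesis
    using E.product_iff_pullback[OF E.pt, of "span_at R x" "fob X x" "fob Y x"] nt_cpt[OF r(1) x]
      nt_cpt[OF r(2) x]
    by (simp add: span_at_def)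
qed

lemma pairing_pointwise:
  assumes R: "is_product (fun_cat C E) X Y R" and a: "a \<in> hom (fun_cat C E) Z X"
    and b: "b \<in> hom (fun_cat C E) Z Y"
    and x: "x \<in> ob C"
  shows "cpt (pairing (fun_cat C E) R a b) x = pairing E (span_at R x) (cpt a x) (cpt b x)"
proof (rule E.pairing_eq[OF product_pointwise[OF R x] nt_cpt[OF a x] nt_cpt[OF b x], symmetric])
  note p = FC.pairing[OF R a b]
  show "cpt (pairing (fun_cat C E) R a b) x \<in> hom E (fob Z x) (vertex (span_at R x))"
    using nt_cpt[OF p(1) x] by (simp add: span_at_def)
  show "pr1 (span_at R x) \<cdot> cpt (pairing (fun_cat C E) R a b) x = cpt a x"
    "pr2 (span_at R x) \<cdot> cpt (pairing (fun_cat C E) R a b) x = cpt b x"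
    using arg_cong[OF p(2), of "\<lambda>t. cpt t x"] arg_cong[OF p(3), of "\<lambda>t. cpt t x"] x
      by (simp_all add: span_at_def)
qed

text \<open>The pullback of the two graphs is computed pointwise, and evaluating a graph gives the
  graph of the evaluated map.\<close>

lemma equaliser_pointwise:
  assumes e: "is_equaliser (fun_cat C E) e f g" and x: "x \<in> ob C"
  shows "is_equaliser E (cpt e x) (cpt f x) (cpt g x)"
proof -
  let ?F = "fun_cat C E" and ?X = "tgt (fun_cat C E) e" and ?Y = "tgt (fun_cat C E) f"
  have h: "e \<in> hom ?F (src ?F e) ?X" "f \<in> hom ?F ?X ?Y" "g \<in> hom ?F ?X ?Y"
    using e by (auto simp: is_equaliser_def hom_def)
  obtain R where R: "is_product ?F ?X ?Y R"
    using FC.product_exists[OF has_pullbacks_fun_cat terminal_fun_cat FC.hom_ob[OF h(2)]] .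
  have i: "idt ?F ?X \<in> hom ?F ?X ?X" using FC.idt_hom FC.hom_ob h by blast
  have "is_pullback ?F e e (pairing ?F R (idt ?F ?X) f) (pairing ?F R (idt ?F ?X) g)"
    using FC.equaliser_iff_pullback[OF R h(2,3,1)] e by blast
  from pullback_pointwise[OF this x] show ?thesis
    using E.equaliser_iff_pullback[OF product_pointwise[OF R x] nt_cpt[OF h(2) x] nt_cpt[OF h(3) x]
      nt_cpt[OF h(1) x]] x
    by (simp add: pairing_pointwise[OF R i h(2) x] pairing_pointwise[OF R i h(3) x])
qed

end

locale functor_between_complete = C: complete_functor_category C E pt + D: complete_functor_category D E
  pt
  for C :: "('o, 'a) cat" and D :: "('q, 'c) cat" and E :: "('p, 'b) cat" (structure) and pt +
  fixes F :: "('o, 'a, 'q, 'c) fctr"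
  assumes F: "is_functor C D F"
begin

lemma whisker_pullback:
  assumes pb: "is_pullback (fun_cat D E) p q f g"
  shows "is_pullback (fun_cat C E) (whisker C p F) (whisker C q F) (whisker C f F) (whisker C g F)"
proof -
  note h = D.FC.pullback_hom[OF pb]
  show ?thesis
    by (rule C.pullback_pointwiseI[OF h(1-4)[THEN whisker_hom[OF C.C.category_axioms F]]])
      (use D.pullback_pointwise[OF pb functor_ob[OF F]] in simp)
qed

lemma whisker_mono:
  assumes m: "m \<in> hom (fun_cat D E) X Y" and mm: "is_mono (fun_cat D E) m"
  shows "is_mono (fun_cat C E) (whisker C m F)"
  using C.mono_pointwise_iff[OF whisker_hom[OF C.C.category_axioms F m]] D.mono_pointwise_iff[OF m]
    mm functor_ob[OF F]
  by simp

end

section \<open>Pullbacks and terminal objects from finite limits\<close>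

text \<open>The objects are the numbers below \<open>n\<close>, which also serve as identities; the arrows from
  \<open>n\<close> to \<open>m - 1\<close> are the other ones, and no two of these are composable.\<close>

definition bipartite_cat :: "nat \<Rightarrow> nat \<Rightarrow> (nat \<Rightarrow> nat) \<Rightarrow> (nat \<Rightarrow> nat) \<Rightarrow> (nat, nat) cat" where
  "bipartite_cat n m s t = \<lparr>ob = {..<n}, ar = {..<m},
     src = (\<lambda>a. if a < n then a else s a), tgt = (\<lambda>a. if a < n then a else t a),
     idt = (\<lambda>x. x), cmp = (\<lambda>g f. if f < n then g else f)\<rparr>"

text \<open>Repackages \<open>has_finite_limits\<close> for diagrams without composable proper
  arrows, so that an application only lists the objects and the proper arrows. Such shapes suffice
  for terminal objects and pullbacks.\<close>

lemma bipartite_limit: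
  fixes n m :: nat and s t :: "nat \<Rightarrow> nat"
  assumes E: "category E" and lim: "has_finite_limits E" and nm: "n \<le> m"
    and s: "\<And>a. \<lbrakk>n \<le> a; a < m\<rbrakk> \<Longrightarrow> s a < n" and t: "\<And>a. \<lbrakk>n \<le> a; a < m\<rbrakk> \<Longrightarrow> t a < n"
    and st: "\<And>a b. \<lbrakk>n \<le> a; a < m; n \<le> b; b < m\<rbrakk> \<Longrightarrow> t a \<noteq> s b"
    and X: "\<And>j. j < n \<Longrightarrow> X j \<in> ob E"
    and f: "\<And>a. \<lbrakk>n \<le> a; a < m\<rbrakk> \<Longrightarrow> f a \<in> hom E (X (s a)) (X (t a))"
  obtains v p where "v \<in> ob E" "\<And>j. j < n \<Longrightarrow> p j \<in> hom E v (X j)"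
    "\<And>a. \<lbrakk>n \<le> a; a < m\<rbrakk> \<Longrightarrow> f a \<cdot>\<^bsub>E\<^esub> p (s a) = p (t a)"
    "\<And>w q. \<lbrakk>w \<in> ob E; \<And>j. j < n \<Longrightarrow> q j \<in> hom E w (X j);
        \<And>a. \<lbrakk>n \<le> a; a < m\<rbrakk> \<Longrightarrow> f a \<cdot>\<^bsub>E\<^esub> q (s a) = q (t a)\<rbrakk>
      \<Longrightarrow> \<exists>!h. h \<in> hom E w v \<and> (\<forall>j < n. p j \<cdot>\<^bsub>E\<^esub> h = q j)"
proof -
  interpret E: category E by fact
  let ?J = "bipartite_cat n m s t"
  have hom_J: "a \<in> hom ?J x y \<longleftrightarrow>
      a < m \<and> (if a < n then x = a \<and> y = a else x = s a \<and> y = t a)" for a x y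
    by (auto simp: hom_def bipartite_cat_def)
  have sel: "ob ?J = {..<n}" "ar ?J = {..<m}" "idt ?J x = x" "b \<cdot>\<^bsub>?J\<^esub> a = (if a < n then b else a)"
    for a b x
    by (simp_all add: bipartite_cat_def)
  have J: "category ?J"
  proof
    show "src ?J a \<in> ob ?J" "tgt ?J a \<in> ob ?J" if "a \<in> ar ?J" for a
      using that s t by (auto simp: bipartite_cat_def)
    show "idt ?J x \<in> hom ?J x x" if "x \<in> ob ?J" for x
      using that nm by (simp add: hom_J sel)
    show "b \<cdot>\<^bsub>?J\<^esub> a \<in> hom ?J x z" if "a \<in> hom ?J x y" "b \<in> hom ?J y z" for a b x y z
      using that st[of a b] by (auto simp: hom_J sel split: if_splits)
    show "idt ?J y \<cdot>\<^bsub>?J\<^esub> a = a" "a \<cdot>\<^bsub>?J\<^esub> idt ?J x = a" if "a \<in> hom ?J x y" for a x y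
      using that s[of a] t[of a] by (auto simp: hom_J sel split: if_splits)
    show "(c \<cdot>\<^bsub>?J\<^esub> b) \<cdot>\<^bsub>?J\<^esub> a = c \<cdot>\<^bsub>?J\<^esub> b \<cdot>\<^bsub>?J\<^esub> a"
      if "a \<in> hom ?J w x" "b \<in> hom ?J x y" "c \<in> hom ?J y z" for a b c w x y z
      using that by (auto simp: sel)
  qed
  \<comment> \<open>The family \<open>f\<close> is given on the proper arrows \<open>n\<close>, ...,
    \<open>m - 1\<close> only; the numbers below \<open>n\<close> are the identities.\<close>
  let ?f = "\<lambda>a. if a < n then idt E (X a) else f a"
  let ?X = "mk_fctr ?J X ?f"
  have fX: "is_functor ?J E ?X"
  proof (rule is_functor_mk_fctr[OF J])
    show "X x \<in> ob E" if "x \<in> ob ?J" for x using X that by (simp add: sel)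
    show fa: "?f a \<in> hom E (X x) (X y)" if "a \<in> hom ?J x y" for a x y
      using that f E.idt_hom[OF X] by (auto simp: hom_J split: if_splits)
    show "?f (idt ?J x) = idt E (X x)" if "x \<in> ob ?J" for x using that by (simp add: sel)
    show "?f (b \<cdot>\<^bsub>?J\<^esub> a) = ?f b \<cdot>\<^bsub>E\<^esub> ?f a" if a: "a \<in> hom ?J x y" and b: "b \<in> hom ?J y z" for a b x y z
      using fa[OF a] fa[OF b] a b st[of a b] E.idt_left E.idt_right
      by (auto simp: hom_J sel split: if_splits)
  qed
  \<comment> \<open>At an identity the cone condition follows from the identity law of
    \<open>E\<close>, so the proper arrows alone remain.\<close>
  have cone: "is_cone ?J E ?X c \<longleftrightarrow> apex c \<in> ob E \<and> (\<forall>j < n. leg c j \<in> hom E (apex c) (X j)) \<and>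
      (\<forall>a. n \<le> a \<longrightarrow> a < m \<longrightarrow> f a \<cdot>\<^bsub>E\<^esub> leg c (s a) = leg c (t a))" (is "_ \<longleftrightarrow> ?R") for c
  proof
    assume c: "is_cone ?J E ?X c"
    then have *: "\<forall>a < m. far ?X a \<cdot>\<^bsub>E\<^esub> leg c (src ?J a) = leg c (tgt ?J a)"
      by (auto simp: is_cone_def sel)
    have "f a \<cdot>\<^bsub>E\<^esub> leg c (s a) = leg c (t a)" if "n \<le> a" "a < m" for a
      using *[rule_format, OF that(2)] that by (simp add: sel) (simp add: bipartite_cat_def)
    then show ?R using c by (auto simp: is_cone_def sel)
  next
    assume R: ?R
    have "far ?X a \<cdot>\<^bsub>E\<^esub> leg c (src ?J a) = leg c (tgt ?J a)" if "a < m" for a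
    proof (cases "a < n")
      case True
      then have "idt E (X a) \<cdot>\<^bsub>E\<^esub> leg c a = leg c a" using R E.idt_left by blast
      then show ?thesis using True that by (simp add: sel) (simp add: bipartite_cat_def)
    next
      case False
      then show ?thesis using R that by (simp add: sel) (simp add: bipartite_cat_def)
    qed
    then show "is_cone ?J E ?X c" using R by (auto simp: is_cone_def sel)
  qed
  have "finite (ob ?J)" "finite (ar ?J)" by (simp_all add: sel)
  then obtain c where c: "is_limit ?J E ?X c"
    using lim J fX unfolding has_finite_limits_def by blast
  then have cc: "is_cone ?J E ?X c" by (simp add: is_limit_def)
  show ?thesis
  proof (rule that[of "apex c" "leg c"])
    fix w q assume "w \<in> ob E" "\<And>j. j < n \<Longrightarrow> q j \<in> hom E w (X j)"
      "\<And>a. \<lbrakk>n \<le> a; a < m\<rbrakk> \<Longrightarrow> f a \<cdot>\<^bsub>E\<^esub> q (s a) = q (t a)"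
    then have "is_cone ?J E ?X \<lparr>apex = w, leg = q\<rparr>" by (simp add: cone)
    from conjunct2[OF c[unfolded is_limit_def], rule_format, OF this]
    show "\<exists>!h. h \<in> hom E w (apex c) \<and> (\<forall>j < n. leg c j \<cdot>\<^bsub>E\<^esub> h = q j)"
      by (simp add: sel Ball_def lessThan_def)
  qed (use cc cone in auto)
qed

lemma finitely_complete_if_finite_limits:
  assumes E: "category E" and lim: "has_finite_limits E"
  obtains pt where "finitely_complete E pt"
proof -
  interpret E: category E by fact
  \<comment> \<open>For the empty shape every object carries exactly one relevant cone, so the apex
    of the limit is terminal.\<close>
  obtain v where v: "v \<in> ob E" "\<And>w. w \<in> ob E \<Longrightarrow> \<exists>!h. h \<in> hom E w v"
    by (rule bipartite_limit[OF E lim, of 0 0 id id "\<lambda>_. undefined" "\<lambda>_. undefined"]) auto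
  have "is_terminal E v" using v by (simp add: is_terminal_def)
  moreover have "has_pullbacks E"
    unfolding has_pullbacks_def
  proof (intro allI ballI)
    fix x y z f g assume f: "f \<in> hom E x z" and g: "g \<in> hom E y z"
    \<comment> \<open>The cospan is encoded with objects 0, 1, 2 for \<open>x\<close>,
      \<open>y\<close>, \<open>z\<close>. Since 0, 1, 2 are also the identities, \<open>f\<close>
      and \<open>g\<close> become the arrows 3 and 4, with source \<open>a - 3\<close> and target
      2.\<close>
    let ?X = "\<lambda>j::nat. if j = 0 then x else if j = 1 then y else z"
    let ?f = "\<lambda>a::nat. if a = 3 then f else g"
    obtain v p where v: "v \<in> ob E" and p: "\<And>j. j < 3 \<Longrightarrow> p j \<in> hom E v (?X j)"
      and fp: "\<And>a. \<lbrakk>3 \<le> a; a < 5\<rbrakk> \<Longrightarrow> ?f a \<cdot>\<^bsub>E\<^esub> p (a - 3) = p 2"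
      and un: "\<And>w q. \<lbrakk>w \<in> ob E; \<And>j. j < 3 \<Longrightarrow> q j \<in> hom E w (?X j);
        \<And>a. \<lbrakk>3 \<le> a; a < 5\<rbrakk> \<Longrightarrow> ?f a \<cdot>\<^bsub>E\<^esub> q (a - 3) = q 2\<rbrakk>
        \<Longrightarrow> \<exists>!h. h \<in> hom E w v \<and> (\<forall>j < 3. p j \<cdot>\<^bsub>E\<^esub> h = q j)"
    proof (rule bipartite_limit[OF E lim, of 3 5 "\<lambda>a. a - 3" "\<lambda>_. 2" ?X ?f])
      show "?X j \<in> ob E" if "j < 3" for j using E.hom_ob[OF f] E.hom_ob[OF g] by simp
      show "?f a \<in> hom E (?X (a - 3)) (?X 2)" if "3 \<le> a" "a < 5" for a
      proof -
        have "a = 3 \<or> a = 4" using that by linarith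
        then show ?thesis using f g by auto
      qed
    qed auto
    have p': "p 0 \<in> hom E v x" "p 1 \<in> hom E v y" using p[of 0] p[of 1] by simp_all
    have fg: "f \<cdot>\<^bsub>E\<^esub> p 0 = p 2" "g \<cdot>\<^bsub>E\<^esub> p 1 = p 2" using fp[of 3] fp[of 4] by simp_all
    have u: "\<exists>!h. h \<in> hom E w v \<and> p 0 \<cdot>\<^bsub>E\<^esub> h = a \<and> p 1 \<cdot>\<^bsub>E\<^esub> h = b"
      if a: "a \<in> hom E w x" and b: "b \<in> hom E w y" and ab: "f \<cdot>\<^bsub>E\<^esub> a = g \<cdot>\<^bsub>E\<^esub> b" for w a b
    proof -
      \<comment> \<open>The leg at \<open>z\<close> is determined by the leg at \<open>x\<close>,
        which is why it disappears from the description as a pullback.\<close>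
      let ?q = "\<lambda>j::nat. if j = 0 then a else if j = 1 then b else f \<cdot>\<^bsub>E\<^esub> a"
      have "\<exists>!h. h \<in> hom E w v \<and> (\<forall>j < 3. p j \<cdot>\<^bsub>E\<^esub> h = ?q j)"
      proof (rule un)
        show "w \<in> ob E" using E.hom_ob a by blast
        show "?q j \<in> hom E w (?X j)" if "j < 3" for j using a b E.cmp_hom[OF a f] by simp
        show "?f c \<cdot>\<^bsub>E\<^esub> ?q (c - 3) = ?q 2" if "3 \<le> c" "c < 5" for c
        proof -
          have "c = 3 \<or> c = 4" using that by linarith
          then show ?thesis using ab by auto
        qed
      qed
      moreover have "(\<forall>j < 3. p j \<cdot>\<^bsub>E\<^esub> h = ?q j) \<longleftrightarrow> p 0 \<cdot>\<^bsub>E\<^esub> h = a \<and> p 1 \<cdot>\<^bsub>E\<^esub> h = b"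
        if h: "h \<in> hom E w v" for h
      proof -
        have "p 2 \<cdot>\<^bsub>E\<^esub> h = f \<cdot>\<^bsub>E\<^esub> (p 0 \<cdot>\<^bsub>E\<^esub> h)" using fg E.assoc[OF h p'(1) f] by simp
        moreover have "(\<forall>j < (3::nat). P j) \<longleftrightarrow> P 0 \<and> P 1 \<and> P 2" for P
          by (simp add: numeral_eq_Suc less_Suc_eq all_conj_distrib)
        ultimately show ?thesis by auto
      qed
      ultimately show ?thesis by (metis (no_types, lifting))
    qed
    have "is_pullback E (p 0) (p 1) f g"
      unfolding is_pullback_def
      using u fg p' f g E.homD(1)[OF p'(1)] E.homD(1)[OF p'(2)] E.homD(1)[OF f] E.homD(1)[OF g]
        E.homD(2)[OF p'(1)] E.homD(2)[OF p'(2)] E.homD(2)[OF f] E.homD(2)[OF g]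
        E.homD(3)[OF p'(1)] E.homD(3)[OF p'(2)] E.homD(3)[OF f] E.homD(3)[OF g] by simp
    then show "\<exists>p q. is_pullback E p q f g" by blast
  qed
  ultimately have "finitely_complete E v" by unfold_locales
  then show ?thesis by (rule that)
qed

section \<open>Subobject classifiers on colimits of categories\<close>

text \<open>Restriction preserves the pullback, and it sends the map to the terminal functor to the
  map of the same kind because constant functors restrict to constant functors.\<close>

lemma (in functor_between_complete) whisker_classified:
  assumes m: "m \<in> hom (fun_cat D E) S X" and k: "k \<in> hom (fun_cat D E) X Om"
    and tr: "tr \<in> hom (fun_cat D E) D.unit Om"
    and pb: "is_pullback (fun_cat D E) m (bang (fun_cat D E) S D.unit) k tr"
  shows "is_pullback (fun_cat C E) (whisker C m F) (bang (fun_cat C E) (comp_fctr C S F) C.unit)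
    (whisker C k F) (whisker C tr F)"
proof -
  have S: "S \<in> ob (fun_cat D E)" using D.FC.hom_ob m by blast
  have "whisker C (bang (fun_cat D E) S D.unit) F \<in> hom (fun_cat C E) (comp_fctr C S F) C.unit"
    using whisker_hom[OF C.C.category_axioms F D.FC.bang_hom[OF D.terminal_fun_cat S]]
      unfolding comp_const_fctr[OF F] .
  then have "bang (fun_cat C E) (comp_fctr C S F) C.unit = whisker C (bang (fun_cat D E) S D.unit) F"
    by (rule C.FC.bang_eq[OF C.terminal_fun_cat])
  then show ?thesis using whisker_pullback[OF pb] by simp
qed

section \<open>Functors and transformations on a colimit of categories\<close>

locale cat_diagram = J: category J for J :: "('j, 'k) cat" +
  fixes D :: "'j \<Rightarrow> ('o, 'a) cat" and T :: "'k \<Rightarrow> ('o, 'a, 'o, 'a) fctr"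
  assumes diag: "is_cat_diagram J D T"
begin

abbreviation "L \<equiv> colim_cat J D T"
abbreviation "inc \<equiv> colim_in J D T"

sublocale L: category L
  by (rule colim_category[OF J.category_axioms diag])

lemma D: "j \<in> ob J \<Longrightarrow> category (D j)"
  using diag by (auto simp: is_cat_diagram_def)

lemma T: "a \<in> ar J \<Longrightarrow> is_functor (D (src J a)) (D (tgt J a)) (T a)"
  using diag by (auto simp: is_cat_diagram_def)

lemma inc: "j \<in> ob J \<Longrightarrow> is_functor (D j) L (inc j)"
  by (rule colim_in_functor[OF J.category_axioms diag])

lemma inc_T: "a \<in> ar J \<Longrightarrow> comp_fctr (D (src J a)) (inc (tgt J a)) (T a) = inc (src J a)"
  by (rule colim_in_cocone[OF J.category_axioms diag])

lemma colim_ob_cases: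
  assumes "A \<in> ob L"
  obtains j x where "j \<in> ob J" "x \<in> ob (D j)" "A = fob (inc j) x"
  using assms by (auto simp: colim_cat_def colim_in_def)

text \<open>Hides the presentation of arrows by paths. Paths are listed in diagrammatic order, so
  the head of the list is the arrow composed on the right.\<close>

lemma colim_ar_induct:
  assumes w: "w \<in> hom L A B"
    and idt: "\<And>A. A \<in> ob L \<Longrightarrow> P A A (idt L A)"
    and cmp: "\<And>B j f w. \<lbrakk>j \<in> ob J; f \<in> ar (D j); w \<in> hom L (fob (inc j) (tgt (D j) f)) B;
      P (fob (inc j) (tgt (D j) f)) B w\<rbrakk> \<Longrightarrow> P (fob (inc j) (src (D j) f)) B (w \<cdot>\<^bsub>L\<^esub> far (inc j) f)"
  shows "P A B w"
proof -
  note jd = J.category_axioms diag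
  have "P A B (colim_mk J D T A B ws)" if "colim_path J D T A ws B" for ws A
    using that
  proof (induction ws arbitrary: A)
    case Nil
    then have "A = B" "A \<in> ob L" using colim_path_ob(1)[OF jd Nil] by auto
    then show ?case using idt[of A] colim_idt[OF jd] by simp
  next
    case (Cons w ws)
    obtain j f where w: "w = (j, f)" by (cases w)
    let ?M = "colim_cls J D T (j, tgt (D j) f)"
    have j: "j \<in> ob J" and f: "f \<in> ar (D j)" and A: "A = colim_cls J D T (j, src (D j) f)"
      and p: "colim_path J D T ?M ws B"
      using Cons(2) w by auto
    have M: "fob (inc j) (tgt (D j) f) = ?M" "fob (inc j) (src (D j) f) = A"
      "far (inc j) f = colim_mk J D T A ?M [(j, f)]"
      using category.src_ob[OF D[OF j] f] category.tgt_ob[OF D[OF j] f] f A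
        by (simp_all add: colim_in_def)
    have s: "colim_path J D T A [(j, f)] ?M" using colim_path_single[OF jd j f] A by simp
    show ?case
      using cmp[OF j f, of "colim_mk J D T ?M B ws" B] colim_mk_hom[OF jd p] Cons(1)[OF p]
        colim_mk_cmp[OF jd s p]
      unfolding M w by simp
  qed
  then show ?thesis using colim_ar_cases[OF jd w] by metis
qed

lemma colim_nt_eqI:
  assumes t: "t \<in> hom (fun_cat L E) X Y" and s: "s \<in> hom (fun_cat L E) X Y"
    and eq: "\<And>j. j \<in> ob J \<Longrightarrow> whisker (D j) t (inc j) = whisker (D j) s (inc j)"
  shows "t = s"
proof (rule nt_eqI[OF t s])
  fix A assume "A \<in> ob L"
  then obtain j x where j: "j \<in> ob J" "x \<in> ob (D j)" "A = fob (inc j) x" by (rule colim_ob_cases)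
  then show "cpt t A = cpt s A" using arg_cong[OF eq[OF j(1)], of "\<lambda>t. cpt t x"] by simp
qed

text \<open>The universal property of the colimit concerns functors, so transformations are glued by
  hand. Compatibility along the generating steps makes the components well defined on classes of
  objects, and naturality passes from the arrows of the \<open>D j\<close> to their composites by
  pasting squares.\<close>

lemma colim_nt_exists:
  assumes E: "category E" and X: "is_functor L E X" and Y: "is_functor L E Y"
    and t: "\<And>j. j \<in> ob J \<Longrightarrow> t j \<in> hom (fun_cat (D j) E) (comp_fctr (D j) X (inc j)) (comp_fctr (D j) Y
      (inc j))"
    and compat: "\<And>a. a \<in> ar J \<Longrightarrow> whisker (D (src J a)) (t (tgt J a)) (T a) = t (src J a)"
  obtains s where "s \<in> hom (fun_cat L E) X Y" "\<And>j. j \<in> ob J \<Longrightarrow> whisker (D j) s (inc j) = t j"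
proof -
  interpret E: category E by fact
  \<comment> \<open>The component at a class is read off at an arbitrary representative.\<close>
  define c where "c A = (let p = SOME p. p \<in> A in cpt (t (fst p)) (snd p))" for A
  have eq: "cpt (t (fst p)) (snd p) = cpt (t (fst q)) (snd q)" if "colim_eq J D T p q" for p q
    using that
  proof (induction rule: colim_eq.induct)
    case (colim_eq_step a x)
    then show ?case using arg_cong[OF compat, of a "\<lambda>t. cpt t x"] by simp
  qed auto
  have c: "c (fob (inc j) x) = cpt (t j) x" if j: "j \<in> ob J" and x: "x \<in> ob (D j)" for j x
  proof -
    have A: "fob (inc j) x = {q. colim_eq J D T (j, x) q}" using x
      by (simp add: colim_in_def colim_cls_def)
    have "colim_eq J D T (j, x) (SOME q. colim_eq J D T (j, x) q)"
      by (rule someI[of _ "(j, x)"]) (use j x in \<open>rule colim_eq_refl\<close>)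
    from eq[OF this] show ?thesis by (simp add: c_def A Let_def)
  qed
  have ch: "c (fob (inc j) x) \<in> hom E (fob X (fob (inc j) x)) (fob Y (fob (inc j) x))"
    if "j \<in> ob J" "x \<in> ob (D j)" for j x
    using nt_cpt[OF t[OF that(1)] that(2)] that by (simp add: c)
  have cA: "c A \<in> hom E (fob X A) (fob Y A)" if A: "A \<in> ob L" for A
    by (rule colim_ob_cases[OF A]) (simp add: ch)
  have s: "mk_nt L X Y c \<in> hom (fun_cat L E) X Y"
  proof (rule mk_nt_hom[OF L.category_axioms X Y cA])
    fix w A B assume "w \<in> hom L A B"
    then show "far Y w \<cdot>\<^bsub>E\<^esub> c A = c B \<cdot>\<^bsub>E\<^esub> far X w"
    proof (rule colim_ar_induct)
      fix A assume A: "A \<in> ob L"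
      show "far Y (idt L A) \<cdot>\<^bsub>E\<^esub> c A = c A \<cdot>\<^bsub>E\<^esub> far X (idt L A)"
        using functor_idt[OF X A] functor_idt[OF Y A] E.idt_left[OF cA[OF A]] E.idt_right[OF cA[OF A]]
          by simp
    next
      fix B j f w
      let ?x = "fob (inc j) (src (D j) f)" and ?y = "fob (inc j) (tgt (D j) f)" and ?f = "far (inc j) f"
      assume j: "j \<in> ob J" and f: "f \<in> ar (D j)" and w: "w \<in> hom L ?y B"
        and IH: "far Y w \<cdot>\<^bsub>E\<^esub> c ?y = c B \<cdot>\<^bsub>E\<^esub> far X w"
      interpret Dj: category "D j" by (rule D[OF j])
      note fh = Dj.homI[OF f]
      note x = Dj.hom_ob[OF fh]
      have F: "?f \<in> hom L ?x ?y" by (rule functor_hom[OF inc[OF j] fh])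
      note XF = functor_hom[OF X F] and YF = functor_hom[OF Y F] and Xw = functor_hom[OF X w]
        and Yw = functor_hom[OF Y w]
      have n: "far Y ?f \<cdot>\<^bsub>E\<^esub> c ?x = c ?y \<cdot>\<^bsub>E\<^esub> far X ?f"
        using nt_nat[OF t[OF j] fh] f x by (simp add: c[OF j])
      have B: "B \<in> ob L" using L.hom_ob w by blast
      have "far Y (w \<cdot>\<^bsub>L\<^esub> ?f) \<cdot>\<^bsub>E\<^esub> c ?x = (far Y w \<cdot>\<^bsub>E\<^esub> far Y ?f) \<cdot>\<^bsub>E\<^esub> c ?x"
        by (simp add: functor_cmp[OF Y F w])
      also have "\<dots> = (far Y w \<cdot>\<^bsub>E\<^esub> c ?y) \<cdot>\<^bsub>E\<^esub> far X ?f"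
        using E.assoc[OF ch[OF j x(1)] YF Yw] E.assoc[OF XF ch[OF j x(2)] Yw] n by simp
      also have "\<dots> = c B \<cdot>\<^bsub>E\<^esub> far X (w \<cdot>\<^bsub>L\<^esub> ?f)"
        using E.assoc[OF XF Xw cA[OF B]] IH functor_cmp[OF X F w] by simp
      finally show "far Y (w \<cdot>\<^bsub>L\<^esub> ?f) \<cdot>\<^bsub>E\<^esub> c ?x = c B \<cdot>\<^bsub>E\<^esub> far X (w \<cdot>\<^bsub>L\<^esub> ?f)" .
    qed
  qed
  show ?thesis
  proof (rule that[OF s])
    fix j assume j: "j \<in> ob J"
    show "whisker (D j) (mk_nt L X Y c) (inc j) = t j"
      by (rule nt_eqI[OF whisker_hom[OF D[OF j] inc[OF j] s] t[OF j]])
        (simp add: c[OF j] functor_ob[OF inc[OF j]])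
  qed
qed

text \<open>Hypotheses and conclusions are equalities of functors and transformations. The
  conclusions about \<open>inc j\<close> let the construction at the next stage restrict exactly to
  all earlier ones.\<close>

theorem colim_classifier:
  assumes "finitely_complete E pt"
    and cl: "\<And>j. j \<in> ob J \<Longrightarrow> subobject_classifier (fun_cat (D j) E) (const_fctr (D j) E pt) (Om j)
      (tr j)"
    and Om_T: "\<And>a. a \<in> ar J \<Longrightarrow> comp_fctr (D (src J a)) (Om (tgt J a)) (T a) = Om (src J a)"
    and tr_T: "\<And>a. a \<in> ar J \<Longrightarrow> whisker (D (src J a)) (tr (tgt J a)) (T a) = tr (src J a)"
  obtains Om' tr' where "subobject_classifier (fun_cat L E) (const_fctr L E pt) Om' tr'"
    "\<And>j. j \<in> ob J \<Longrightarrow> comp_fctr (D j) Om' (inc j) = Om j"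
    "\<And>j. j \<in> ob J \<Longrightarrow> whisker (D j) tr' (inc j) = tr j"
proof -
  interpret E: finitely_complete E pt by fact
  interpret LE: complete_functor_category L E pt by unfold_locales
  let ?U = "LE.unit"
  have cfc: "complete_functor_category (D j) E pt" if "j \<in> ob J" for j
    using D[OF that] by (simp add: complete_functor_category_def E.finitely_complete_axioms)
  have cw: "category_with_classifier (fun_cat (D j) E) (const_fctr (D j) E pt) (Om j) (tr j)"
    if "j \<in> ob J" for j
    using category_fun_cat[OF D[OF that] E.category_axioms] cl[OF that]
    by (simp add: category_with_classifier_def category_with_classifier_axioms_def)
  have inc_between: "functor_between_complete (D j) L E pt (inc j)" if "j \<in> ob J" for j
    using cfc[OF that] LE.complete_functor_category_axioms inc[OF that]
    by (simp add: functor_between_complete_def functor_between_complete_axioms_def)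
  have T_between: "functor_between_complete (D (src J a)) (D (tgt J a)) E pt (T a)" if "a \<in> ar J" for a
    using cfc[OF J.src_ob[OF that]] cfc[OF J.tgt_ob[OF that]] T[OF that]
    by (simp add: functor_between_complete_def functor_between_complete_axioms_def)
  have Om: "is_functor (D j) E (Om j)" if "j \<in> ob J" for j
    using cl[OF that] by (simp add: subobject_classifier_def ob_fun_cat)
  have tr: "tr j \<in> hom (fun_cat (D j) E) (const_fctr (D j) E pt) (Om j)" if "j \<in> ob J" for j
    using cl[OF that] by (simp add: subobject_classifier_def)
  obtain Om' where Om': "is_functor L E Om'" and Om'_inc: "\<And>j. j \<in> ob J \<Longrightarrow>
    comp_fctr (D j) Om' (inc j) = Om j"
    using colim_universal[OF J.category_axioms diag E.category_axioms, of Om] Om Om_T by blast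
  have U: "is_functor L E ?U" using LE.terminal_fun_cat by (auto simp: is_terminal_def ob_fun_cat)
  have U_inc: "comp_fctr (D j) ?U (inc j) = const_fctr (D j) E pt" if "j \<in> ob J" for j
    by (rule comp_const_fctr[OF inc[OF that]])
  obtain tr' where tr': "tr' \<in> hom (fun_cat L E) ?U Om'"
    and tr'_inc: "\<And>j. j \<in> ob J \<Longrightarrow> whisker (D j) tr' (inc j) = tr j"
    using colim_nt_exists[OF E.category_axioms U Om', of tr] tr tr_T U_inc Om'_inc by auto
  have "\<exists>!k. classifies (fun_cat L E) ?U Om' tr' m k" if m: "is_mono (fun_cat L E) m" for m
  proof -
    let ?S = "src (fun_cat L E) m" and ?X = "tgt (fun_cat L E) m"
    have mh: "m \<in> hom (fun_cat L E) ?S ?X" using m by (auto simp: is_mono_def hom_def)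
    \<comment> \<open>The characteristic map of \<open>m\<close> will be glued from the
      characteristic maps of its restrictions.\<close>
    define k where "k j = char_map (fun_cat (D j) E) (const_fctr (D j) E pt) (Om j) (tr j) (whisker
      (D j) m (inc j))" for j
    have X: "is_functor L E ?X" using nt_functor(2)[OF mh] .
    have mj: "whisker (D j) m (inc j) \<in> hom (fun_cat (D j) E) (comp_fctr (D j) ?S (inc j)) (comp_fctr
      (D j) ?X (inc j))"
      if j: "j \<in> ob J" for j
      by (rule whisker_hom[OF D[OF j] inc[OF j] mh])
    have mono_j: "is_mono (fun_cat (D j) E) (whisker (D j) m (inc j))" if j: "j \<in> ob J" for j
      by (rule functor_between_complete.whisker_mono[OF inc_between[OF j] mh m])
    have k_hom: "k j \<in> hom (fun_cat (D j) E) (comp_fctr (D j) ?X (inc j)) (Om j)"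
      and k_pb: "is_pullback (fun_cat (D j) E) (whisker (D j) m (inc j))
        (bang (fun_cat (D j) E) (comp_fctr (D j) ?S (inc j)) (const_fctr (D j) E pt)) (k j) (tr j)"
          if j: "j \<in> ob J" for j
      unfolding k_def
      using category_with_classifier.char_map_hom[OF cw[OF j] mono_j[OF j] mj[OF j]]
        category_with_classifier.char_map_pullback[OF cw[OF j] mono_j[OF j] mj[OF j]] by blast+
    \<comment> \<open>Restricting the square at the target of \<open>a\<close> along
      \<open>T a\<close> yields a square that classifies the restriction of \<open>m\<close> at the
      source, so uniqueness there gives the compatibility.\<close>
    have k_T: "whisker (D (src J a)) (k (tgt J a)) (T a) = k (src J a)" if a: "a \<in> ar J" for a
    proof -
      let ?i = "src J a" and ?j = "tgt J a"
      have i: "?i \<in> ob J" and j: "?j \<in> ob J" using J.src_ob J.tgt_ob a by blast+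
      have c: "comp_fctr (D ?i) (comp_fctr (D ?j) Z (inc ?j)) (T a) = comp_fctr (D ?i) Z (inc ?i)" for Z
        by (simp add: comp_fctr_assoc[OF D[OF i] T[OF a]] inc_T[OF a])
      have w: "whisker (D ?i) (whisker (D ?j) m (inc ?j)) (T a) = whisker (D ?i) m (inc ?i)"
        by (simp add: whisker_comp[OF D[OF i] T[OF a]] inc_T[OF a])
      have "is_pullback (fun_cat (D ?i) E) (whisker (D ?i) m (inc ?i))
        (bang (fun_cat (D ?i) E) (comp_fctr (D ?i) ?S (inc ?i)) (const_fctr (D ?i) E pt))
        (whisker (D ?i) (k ?j) (T a)) (tr ?i)"
        using functor_between_complete.whisker_classified[OF T_between[OF a] mj[OF j] k_hom[OF j]
          tr[OF j] k_pb[OF j]]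
        by (simp add: c w tr_T[OF a])
      moreover have "whisker (D ?i) (k ?j) (T a) \<in> hom (fun_cat (D ?i) E) (comp_fctr (D ?i) ?X (inc ?i))
        (Om ?i)"
        using whisker_hom[OF D[OF i] T[OF a] k_hom[OF j]] by (simp add: c Om_T[OF a])
      ultimately show ?thesis
        using category_with_classifier.char_map_eq[OF cw[OF i] mj[OF i]] unfolding k_def[of ?i] by simp
    qed
    obtain K where K: "K \<in> hom (fun_cat L E) ?X Om'"
      and K_inc: "\<And>j. j \<in> ob J \<Longrightarrow> whisker (D j) K (inc j) = k j"
      using colim_nt_exists[OF E.category_axioms X Om', of k] k_hom k_T Om'_inc by auto
    have b: "bang (fun_cat L E) ?S ?U \<in> hom (fun_cat L E) ?S ?U"
      using LE.FC.bang_hom[OF LE.terminal_fun_cat] LE.FC.hom_ob mh by blast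
    have bj: "bang (fun_cat (D j) E) (comp_fctr (D j) ?S (inc j)) (const_fctr (D j) E pt) =
        whisker (D j) (bang (fun_cat L E) ?S ?U) (inc j)" if j: "j \<in> ob J" for j
    proof -
      interpret Dj: complete_functor_category "D j" E pt by (rule cfc[OF j])
      show ?thesis
        by (rule Dj.FC.bang_eq[OF Dj.terminal_fun_cat])
          (use whisker_hom[OF D[OF j] inc[OF j] b] U_inc[OF j] in simp)
    qed
    show ?thesis
    proof (rule ex1I[of _ K])
      show "classifies (fun_cat L E) ?U Om' tr' m K"
        unfolding classifies_def
      proof (intro conjI K LE.pullback_pointwiseI[OF mh b K tr'])
        fix A assume "A \<in> ob L"
        then obtain j x where j: "j \<in> ob J" and x: "x \<in> ob (D j)" and A: "A = fob (inc j) x"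
          by (rule colim_ob_cases)
        interpret Dj: complete_functor_category "D j" E pt by (rule cfc[OF j])
        from Dj.pullback_pointwise[OF k_pb[OF j] x]
          show "is_pullback E (cpt m A) (cpt (bang (fun_cat L E) ?S ?U) A) (cpt K A) (cpt tr' A)"
          unfolding bj[OF j] K_inc[OF j, symmetric] tr'_inc[OF j, symmetric] A using x by simp
      qed
    next
      fix K' assume K': "classifies (fun_cat L E) ?U Om' tr' m K'"
      then have K'h: "K' \<in> hom (fun_cat L E) ?X Om'"
        and pb: "is_pullback (fun_cat L E) m (bang (fun_cat L E) ?S ?U) K' tr'"
        by (auto simp: classifies_def)
      show "K' = K"
      proof (rule colim_nt_eqI[OF K'h K])
        fix j assume j: "j \<in> ob J"
        have "whisker (D j) K' (inc j) \<in> hom (fun_cat (D j) E) (comp_fctr (D j) ?X (inc j)) (Om j)"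
          using whisker_hom[OF D[OF j] inc[OF j] K'h] Om'_inc[OF j] by simp
        then have "k j = whisker (D j) K' (inc j)"
          unfolding k_def
          using category_with_classifier.char_map_eq[OF cw[OF j] mj[OF j]]
            functor_between_complete.whisker_classified[OF inc_between[OF j] mh K'h tr' pb]
              tr'_inc[OF j] by simp
        then show "whisker (D j) K' (inc j) = whisker (D j) K (inc j)" using K_inc[OF j] by simp
      qed
    qed
  qed
  then have "subobject_classifier (fun_cat L E) ?U Om' tr'"
    using LE.terminal_fun_cat Om' tr' by (simp add: subobject_classifier_def ob_fun_cat)
  then show ?thesis using that Om'_inc tr'_inc by blast
qed

end

section \<open>Matching functors\<close>

lemma set_functor_mem:
  assumes W: "is_functor C set_cat W" and f: "f \<in> hom C x y" and u: "u \<in> fob W x"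
  shows "sfun (far W f) u \<in> fob W y"
  using functor_hom[OF W f] u by (auto simp: hom_def set_cat_def)

lemma set_functor_idt: "\<lbrakk>is_functor C set_cat W; x \<in> ob C; u \<in> fob W x\<rbrakk> \<Longrightarrow> sfun (far W (idt C x)) u = u"
  by (simp add: functor_idt set_cat_def)

lemma set_functor_cmp:
  assumes W: "is_functor C set_cat W" and f: "f \<in> hom C x y" and g: "g \<in> hom C y z" and u: "u \<in> fob W x"
  shows "sfun (far W (g \<cdot>\<^bsub>C\<^esub> f)) u = sfun (far W g) (sfun (far W f) u)"
  using functor_hom[OF W f] u by (simp add: functor_cmp[OF W f g])
    (auto simp: hom_def set_cat_def compose_def)

lemma hom_elements: "a \<in> hom (elements C W) p q \<longleftrightarrow>
    (\<exists>f. a = (p, f, q) \<and> f \<in> hom C (fst p) (fst q) \<and> snd p \<in> fob W (fst p) \<and>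
      snd q = sfun (far W f) (snd p))"
  by (cases p; cases q) (auto simp: hom_def elements_def)

lemma category_elements:
  assumes C: "category C" and W: "is_functor C set_cat W"
  shows "category (elements C W)"
proof -
  interpret C: category C by fact
  have cmp: "(q, g, r) \<cdot>\<^bsub>elements C W\<^esub> (p, f, q) = (p, g \<cdot>\<^bsub>C\<^esub> f, r)" for p q r f g
    by (simp add: elements_def)
  have idt: "idt (elements C W) p = (p, idt C (fst p), p)" for p
    by (cases p) (simp add: elements_def)
  show ?thesis
  proof
    show "src (elements C W) a \<in> ob (elements C W)" if "a \<in> ar (elements C W)" for a
      using that C.hom_ob by (auto simp: elements_def)
    show "tgt (elements C W) a \<in> ob (elements C W)" if "a \<in> ar (elements C W)" for a
      using that C.hom_ob set_functor_mem[OF W] by (fastforce simp: elements_def)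
    show "idt (elements C W) p \<in> hom (elements C W) p p" if "p \<in> ob (elements C W)" for p
      using that C.idt_hom set_functor_idt[OF W] by (auto simp: hom_elements) (auto simp: elements_def)
    show "b \<cdot>\<^bsub>elements C W\<^esub> a \<in> hom (elements C W) p r"
      if ab: "a \<in> hom (elements C W) p q" "b \<in> hom (elements C W) q r" for a b p q r
    proof -
      obtain f g where eq: "a = (p, f, q)" "b = (q, g, r)"
        and f: "f \<in> hom C (fst p) (fst q)" "g \<in> hom C (fst q) (fst r)"
        and u: "snd p \<in> fob W (fst p)" "snd q = sfun (far W f) (snd p)" "snd r = sfun (far W g) (snd q)"
        using ab unfolding hom_elements by blast
      show ?thesis
        using C.cmp_hom[OF f] set_functor_cmp[OF W f u(1)] u by (simp add: eq cmp hom_elements)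
    qed
    show "idt (elements C W) q \<cdot>\<^bsub>elements C W\<^esub> a = a" if "a \<in> hom (elements C W) p q" for a p q
      using that C.idt_left by (auto simp: hom_elements idt cmp)
    show "a \<cdot>\<^bsub>elements C W\<^esub> idt (elements C W) p = a" if "a \<in> hom (elements C W) p q" for a p q
      using that C.idt_right by (auto simp: hom_elements idt cmp)
    show "(c \<cdot>\<^bsub>elements C W\<^esub> b) \<cdot>\<^bsub>elements C W\<^esub> a = c \<cdot>\<^bsub>elements C W\<^esub> b \<cdot>\<^bsub>elements C W\<^esub> a"
      if "a \<in> hom (elements C W) o' p" "b \<in> hom (elements C W) p q" "c \<in> hom (elements C W) q r"
        for a b c o' p q r
      using that C.assoc by (auto simp: hom_elements cmp)
  qed
qed

lemma is_functor_elements_proj: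
  assumes C: "category C" and W: "is_functor C set_cat W"
  shows "is_functor (elements C W) C (elements_proj C W)"
proof -
  have "elements_proj C W = mk_fctr (elements C W) fst (\<lambda>(p, f, q). f)"
    by (simp add: elements_proj_def mk_fctr_def)
  moreover have "is_functor (elements C W) C \<dots>"
    by (rule is_functor_mk_fctr[OF category_elements[OF C W]])
      (auto simp: hom_elements, auto simp: elements_def)
  ultimately show ?thesis by simp
qed

lemma hom_op_prod: "(f, g) \<in> hom (prod_cat (op_cat A) B) (i, j) (i', j') \<longleftrightarrow>
  f \<in> hom A i' i \<and> g \<in> hom B j j'"
  by (auto simp: hom_def prod_cat_def op_cat_def)

lemma is_functor_profctr_at:
  assumes A: "category A" and B: "category B" and W: "is_functor (prod_cat (op_cat A) B) set_cat W"
    and i: "i \<in> ob A"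
  shows "is_functor B set_cat (profctr_at A B W i)"
proof -
  interpret A: category A by fact
  interpret B: category B by fact
  have "profctr_at A B W i = mk_fctr B (\<lambda>j. fob W (i, j)) (\<lambda>g. far W (idt A i, g))"
    by (simp add: profctr_at_def mk_fctr_def)
  moreover have "is_functor B set_cat \<dots>"
  proof (rule is_functor_mk_fctr[OF B])
    note ii = A.idt_hom[OF i]
    show "far W (idt A i, a) \<in> hom set_cat (fob W (i, x)) (fob W (i, y))" if "a \<in> hom B x y" for a x y
      using functor_hom[OF W] ii that by (simp add: hom_op_prod)
    show "far W (idt A i, idt B x) = idt set_cat (fob W (i, x))" if "x \<in> ob B" for x
      using functor_idt[OF W, of "(i, x)"] that i by (simp add: prod_cat_def op_cat_def)
    show "far W (idt A i, b \<cdot>\<^bsub>B\<^esub> a) = far W (idt A i, b) \<cdot>\<^bsub>set_cat\<^esub> far W (idt A i, a)"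
      if "a \<in> hom B x y" "b \<in> hom B y z" for a b x y z
      using functor_cmp[OF W, of "(idt A i, a)" "(i, x)" "(i, y)" "(idt A i, b)" "(i, z)"]
        ii that A.idt_left[OF ii]
      by (simp add: hom_op_prod) (simp add: prod_cat_def op_cat_def)
  qed (simp add: set_cat_def)
  ultimately show ?thesis by simp
qed

section \<open>The matching functor of a profunctor\<close>

locale matching = A: complete_functor_category A E pt + B: complete_functor_category B E pt
  for A :: "('d, 'e) cat" and B :: "('j, 'k) cat" and E :: "('p, 'b) cat" (structure) and pt +
  fixes W :: "('d, 'e, 'j, 'k, 'u) profctr" and l :: "('d, 'j, 'k, 'u, 'p, 'b) elements_lims"
  assumes W: "is_functor (prod_cat (op_cat A) B) set_cat W"
    and l: "\<And>i. i \<in> ob A \<Longrightarrow> limit_choice (elements_at A B W i) E (l i)"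
begin

text \<open>The two-sided action of the profunctor. With \<open>u\<close> regarded as an arrow from
  the boundary to the lower part, \<open>f\<close> is composed before it and \<open>g\<close> after
  it.\<close>

abbreviation act :: "'e \<Rightarrow> 'k \<Rightarrow> 'u \<Rightarrow> 'u" where
  "act f g \<equiv> sfun (far W (f, g))"

abbreviation M :: "('j, 'k, 'p, 'b) fctr \<Rightarrow> ('d, 'e, 'p, 'b) fctr" where
  "M \<equiv> matching_ob A B W E l"

abbreviation Mt :: "('j, 'k, 'p, 'b) ntrans \<Rightarrow> ('d, 'e, 'p, 'b) ntrans" where
  "Mt \<equiv> matching_ar A B W E l"

definition prj :: "('j, 'k, 'p, 'b) fctr \<Rightarrow> 'd \<Rightarrow> 'j \<Rightarrow> 'u \<Rightarrow> 'b" where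
  "prj X i j u = leg (matching_cone A B W l X i) (j, u)"

lemma act_mem: "\<lbrakk>f \<in> hom A i i'; g \<in> hom B j j'; u \<in> fob W (i', j)\<rbrakk> \<Longrightarrow> act f g u \<in> fob W (i, j')"
  using set_functor_mem[OF W, of "(f, g)" "(i', j)" "(i, j')"] by (simp add: hom_op_prod)

lemma act_idt: "\<lbrakk>i \<in> ob A; j \<in> ob B; u \<in> fob W (i, j)\<rbrakk> \<Longrightarrow> act (idt A i) (idt B j) u = u"
  using set_functor_idt[OF W, of "(i, j)"] by (simp add: prod_cat_def op_cat_def)

lemma act_cmp:
  assumes "f \<in> hom A i i'" "f' \<in> hom A i' i''" "g \<in> hom B j j'" "g' \<in> hom B j' j''" "u \<in> fob W (i'', j)"
  shows "act f g' (act f' g u) = act (f' \<cdot>\<^bsub>A\<^esub> f) (g' \<cdot>\<^bsub>B\<^esub> g) u"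
  using set_functor_cmp[OF W, of "(f', g)" "(i'', j)" "(i', j')" "(f, g')" "(i, j'')" u] assms
  by (simp add: hom_op_prod) (simp add: prod_cat_def op_cat_def)

text \<open>Both sides are the simultaneous action of \<open>f\<close> and \<open>g\<close>. This
  interchange makes matching objects functorial in \<open>i\<close>, and it is the mixed case of
  associativity in the collage.\<close>

lemma act_commute:
  assumes f: "f \<in> hom A i i'" and g: "g \<in> hom B j j'" and u: "u \<in> fob W (i', j)"
  shows "act (idt A i) g (act f (idt B j) u) = act f (idt B j') (act (idt A i') g u)"
  using act_cmp[OF A.C.idt_hom f B.C.idt_hom g u] act_cmp[OF f A.C.idt_hom g B.C.idt_hom u]
    A.C.hom_ob[OF f] B.C.hom_ob[OF g] A.C.idt_left[OF f] A.C.idt_right[OF f] B.C.idt_left[OF g]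
      B.C.idt_right[OF g] by simp

lemma ob_elements_at: "i \<in> ob A \<Longrightarrow> (j, u) \<in> ob (elements_at A B W i) \<longleftrightarrow> j \<in> ob B \<and> u \<in> fob W (i, j)"
  by (auto simp: elements_def profctr_at_def)

text \<open>Unpacks the chosen limit into statements about the elements \<open>u\<close> of
  \<open>W (i, j)\<close>. Every arrow of the category of elements is some \<open>g\<close> from
  \<open>(j, u)\<close> to \<open>(j', act (idt A i) g u)\<close>, so the cone condition becomes
  compatibility with this action.\<close>

lemma
  assumes X: "is_functor B E X" and i: "i \<in> ob A"
  shows fob_M: "fob (M X) i \<in> ob E"
    and prj_hom: "\<And>j u. \<lbrakk>j \<in> ob B; u \<in> fob W (i, j)\<rbrakk> \<Longrightarrow> prj X i j u \<in> hom E (fob (M X) i) (fob X j)"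
    and prj_nat: "\<And>g j j' u. \<lbrakk>g \<in> hom B j j'; u \<in> fob W (i, j)\<rbrakk> \<Longrightarrow>
      far X g \<cdot> prj X i j u = prj X i j' (act (idt A i) g u)"
    and M_lift: "\<And>v q. \<lbrakk>v \<in> ob E; \<And>j u. \<lbrakk>j \<in> ob B; u \<in> fob W (i, j)\<rbrakk> \<Longrightarrow> q j u \<in> hom E v (fob X j);
        \<And>g j j' u. \<lbrakk>g \<in> hom B j j'; u \<in> fob W (i, j)\<rbrakk> \<Longrightarrow> far X g \<cdot> q j u = q j' (act (idt A i) g u)\<rbrakk>
      \<Longrightarrow> \<exists>!h. h \<in> hom E v (fob (M X) i) \<and> (\<forall>(j, u) \<in> ob (elements_at A B W i). prj X i j u \<cdot> h = q j u)"
proof -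
  let ?J = "elements_at A B W i" and ?c = "matching_cone A B W l X i"
  let ?X = "comp_fctr ?J X (elements_proj B (profctr_at A B W i))"
  have P: "is_functor B set_cat (profctr_at A B W i)"
    by (rule is_functor_profctr_at[OF A.C.category_axioms B.C.category_axioms W i])
  have J: "category ?J" by (rule category_elements[OF B.C.category_axioms P])
  have proj: "is_functor ?J B (elements_proj B (profctr_at A B W i))"
    by (rule is_functor_elements_proj[OF B.C.category_axioms P])
  have lim: "is_limit ?J E ?X ?c"
    using l[OF i, unfolded limit_choice_def, rule_format, OF is_functor_comp_fctr[OF J proj X]]
    unfolding matching_cone_def .
  then have cone: "is_cone ?J E ?X ?c" by (simp add: is_limit_def)
  have M: "fob (M X) i = apex ?c" using i by (simp add: matching_ob_def)
  have obX: "fob ?X p = fob X (fst p)" if "p \<in> ob ?J" for p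
    using that by (simp add: elements_proj_def)
  have arJ: "((j, u), g, (j', act (idt A i) g u)) \<in> ar ?J" if "g \<in> hom B j j'" "u \<in> fob W (i, j)"
    for g j j' u
    using that B.C.hom_ob[OF that(1)] B.C.homD[OF that(1)] by (auto simp: elements_def profctr_at_def)
  have arX: "far ?X ((j, u), g, (j', act (idt A i) g u)) = far X g"
    if "g \<in> hom B j j'" "u \<in> fob W (i, j)" for g j j' u
    using arJ[OF that] by (simp add: elements_proj_def)
  have stJ: "src ?J (p, g, q) = p" "tgt ?J (p, g, q) = q" for p q g by (simp_all add: elements_def)
  have arJE: "\<exists>j u j' g. a = ((j, u), g, (j', act (idt A i) g u)) \<and> g \<in> hom B j j' \<and> u \<in> fob W (i, j)"
    if "a \<in> ar ?J" for a
  proof -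
    from that obtain j u g j' where a: "a = ((j, u), g, (j', sfun (far (profctr_at A B W i) g) u))"
      "g \<in> hom B j j'" "u \<in> fob (profctr_at A B W i) j"
      by (auto simp: elements_def)
    then show ?thesis using B.C.hom_ob[OF a(2)] B.C.homD(1)[OF a(2)] by (auto simp: profctr_at_def)
  qed
  show "fob (M X) i \<in> ob E" using cone by (simp add: M is_cone_def)
  show "prj X i j u \<in> hom E (fob (M X) i) (fob X j)" if "j \<in> ob B" "u \<in> fob W (i, j)" for j u
  proof -
    have "(j, u) \<in> ob ?J" using ob_elements_at[OF i] that by blast
    then show ?thesis using cone obX[of "(j, u)"] unfolding is_cone_def M prj_def by auto
  qed
  show "far X g \<cdot> prj X i j u = prj X i j' (act (idt A i) g u)"
    if "g \<in> hom B j j'" "u \<in> fob W (i, j)" for g j j' u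
  proof -
    have "far ?X a \<cdot> leg ?c (src ?J a) = leg ?c (tgt ?J a)" if "a \<in> ar ?J" for a
      using cone that unfolding is_cone_def by blast
    from this[OF arJ[OF that]] show ?thesis unfolding arX[OF that] stJ prj_def .
  qed
  fix v q assume v: "v \<in> ob E" and q: "\<And>j u. \<lbrakk>j \<in> ob B; u \<in> fob W (i, j)\<rbrakk> \<Longrightarrow> q j u \<in> hom E v (fob X j)"
    and nat: "\<And>g j j' u. \<lbrakk>g \<in> hom B j j'; u \<in> fob W (i, j)\<rbrakk> \<Longrightarrow>
      far X g \<cdot> q j u = q j' (act (idt A i) g u)"
  have "is_cone ?J E ?X \<lparr>apex = v, leg = \<lambda>(j, u). q j u\<rparr>"
    unfolding is_cone_def
  proof (intro conjI ballI)
    fix p assume p: "p \<in> ob ?J"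
    then show "leg \<lparr>apex = v, leg = \<lambda>(j, u). q j u\<rparr> p \<in> hom E (apex \<lparr>apex = v, leg =
      \<lambda>(j, u). q j u\<rparr>) (fob ?X p)"
      using q ob_elements_at[OF i] unfolding obX[OF p] by (cases p) auto
  next
    fix a assume "a \<in> ar ?J"
    then obtain j u j' g where a: "a = ((j, u), g, (j', act (idt A i) g u))" "g \<in> hom B j j'"
      "u \<in> fob W (i, j)"
      using arJE by blast
    show "far ?X a \<cdot> leg \<lparr>apex = v, leg = \<lambda>(j, u). q j u\<rparr> (src ?J a) = leg \<lparr>apex = v, leg =
      \<lambda>(j, u). q j u\<rparr> (tgt ?J a)"
      unfolding a(1) arX[OF a(2,3)] stJ using nat[OF a(2,3)] by simp
  qed (simp add: v)
  from conjunct2[OF lim[unfolded is_limit_def], rule_format, OF this]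
  show "\<exists>!h. h \<in> hom E v (fob (M X) i) \<and> (\<forall>(j, u) \<in> ob ?J. prj X i j u \<cdot> h = q j u)"
    unfolding M prj_def by (simp add: case_prod_unfold)
qed

text \<open>Both maps lift the cone obtained by composing the projections with
  \<open>k\<close>.\<close>

lemma M_joint_mono:
  assumes X: "is_functor B E X" and i: "i \<in> ob A" and h: "h \<in> hom E v (fob (M X) i)"
    and k: "k \<in> hom E v (fob (M X) i)"
    and eq: "\<And>j u. \<lbrakk>j \<in> ob B; u \<in> fob W (i, j)\<rbrakk> \<Longrightarrow> prj X i j u \<cdot> h = prj X i j u \<cdot> k"
  shows "h = k"
proof -
  note p = prj_hom[OF X i]
  let ?P = "\<lambda>h. h \<in> hom E v (fob (M X) i) \<and>
    (\<forall>(j, u) \<in> ob (elements_at A B W i). prj X i j u \<cdot> h = prj X i j u \<cdot> k)"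
  have "\<exists>!h. ?P h"
  proof (rule M_lift[OF X i])
    show "v \<in> ob E" using A.E.hom_ob h by blast
    show "prj X i j u \<cdot> k \<in> hom E v (fob X j)" if "j \<in> ob B" "u \<in> fob W (i, j)" for j u
      using A.E.cmp_hom[OF k p[OF that]] .
    show "far X g \<cdot> (prj X i j u \<cdot> k) = prj X i j' (act (idt A i) g u) \<cdot> k"
      if "g \<in> hom B j j'" "u \<in> fob W (i, j)" for g j j' u
      using A.E.assoc[OF k p[OF B.C.hom_ob(1)[OF that(1)] that(2)] functor_hom[OF X that(1)]]
        prj_nat[OF X i that] by simp
  qed
  moreover have "?P h" "?P k" using h k eq ob_elements_at[OF i] by auto
  ultimately show ?thesis by blast
qed

text \<open>Resolves the definite description in \<open>matching_ob\<close>: the legs reindexed by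
  \<open>f\<close> form a cone thanks to \<open>act_commute\<close>. Afterwards the action on arrows
  is handled through its projections alone.\<close>

lemma
  assumes X: "is_functor B E X" and f: "f \<in> hom A i i'"
  shows far_M_hom: "far (M X) f \<in> hom E (fob (M X) i) (fob (M X) i')"
    and prj_far_M: "\<And>j u. \<lbrakk>j \<in> ob B; u \<in> fob W (i', j)\<rbrakk> \<Longrightarrow>
      prj X i' j u \<cdot> far (M X) f = prj X i j (act f (idt B j) u)"
proof -
  note i = A.C.hom_ob[OF f]
  let ?P = "\<lambda>h. h \<in> hom E (fob (M X) i) (fob (M X) i') \<and>
    (\<forall>(j, u) \<in> ob (elements_at A B W i'). prj X i' j u \<cdot> h = prj X i j (act f (idt B j) u))"
  have "\<exists>!h. ?P h"
  proof (rule M_lift[OF X i(2) fob_M[OF X i(1)]])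
    show "prj X i j (act f (idt B j) u) \<in> hom E (fob (M X) i) (fob X j)"
      if "j \<in> ob B" "u \<in> fob W (i', j)" for j u
      using prj_hom[OF X i(1) that(1) act_mem[OF f B.C.idt_hom[OF that(1)] that(2)]] .
    show "far X g \<cdot> prj X i j (act f (idt B j) u) = prj X i j' (act f (idt B j') (act (idt A i') g u))"
      if g: "g \<in> hom B j j'" and u: "u \<in> fob W (i', j)" for g j j' u
      using prj_nat[OF X i(1) g act_mem[OF f B.C.idt_hom[OF B.C.hom_ob(1)[OF g]] u]]
        act_commute[OF f g u] by simp
  qed
  moreover have "far (M X) f = (THE h. ?P h)"
    using A.C.homD[OF f] i by (simp add: matching_ob_def prj_def Let_def)
  ultimately have "?P (far (M X) f)" using theI'[of ?P] by simp
  then show "far (M X) f \<in> hom E (fob (M X) i) (fob (M X) i')"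
    "\<And>j u. \<lbrakk>j \<in> ob B; u \<in> fob W (i', j)\<rbrakk> \<Longrightarrow> prj X i' j u \<cdot> far (M X) f = prj X i j (act f (idt B j) u)"
    using ob_elements_at[OF i(2)] by blast+
qed

lemma M_functor:
  assumes X: "is_functor B E X"
  shows "is_functor A E (M X)"
proof -
  have "M X = mk_fctr A (fob (M X)) (far (M X))"
    by (simp add: matching_ob_def mk_fctr_def restrict_def cong: if_cong)
  moreover have "is_functor A E \<dots>"
  proof (rule is_functor_mk_fctr[OF A.C.category_axioms fob_M[OF X] far_M_hom[OF X]])
    fix i assume i: "i \<in> ob A"
    note ii = A.C.idt_hom[OF i]
    show "far (M X) (idt A i) = idt E (fob (M X) i)"
      by (rule M_joint_mono[OF X i far_M_hom[OF X ii] A.E.idt_hom[OF fob_M[OF X i]]])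
        (simp add: prj_far_M[OF X ii] act_idt[OF i] A.E.idt_right[OF prj_hom[OF X i]])
  next
    fix i i' i'' f g assume f: "f \<in> hom A i i'" and g: "g \<in> hom A i' i''"
    note i = A.C.hom_ob[OF f] A.C.hom_ob(2)[OF g] and gf = A.C.cmp_hom[OF f g]
    note Mf = far_M_hom[OF X f] and Mg = far_M_hom[OF X g]
    show "far (M X) (g \<cdot>\<^bsub>A\<^esub> f) = far (M X) g \<cdot> far (M X) f"
    proof (rule M_joint_mono[OF X i(3) far_M_hom[OF X gf] A.E.cmp_hom[OF Mf Mg]])
      fix j u assume j: "j \<in> ob B" and u: "u \<in> fob W (i'', j)"
      note jj = B.C.idt_hom[OF j]
      have "prj X i'' j u \<cdot> (far (M X) g \<cdot> far (M X) f) =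
        prj X i j (act f (idt B j) (act g (idt B j) u))"
        using A.E.assoc[OF Mf Mg prj_hom[OF X i(3) j u]] prj_far_M[OF X g j u]
          prj_far_M[OF X f j act_mem[OF g jj u]] by simp
      then show "prj X i'' j u \<cdot> far (M X) (g \<cdot>\<^bsub>A\<^esub> f) = prj X i'' j u \<cdot> (far (M X) g \<cdot> far (M X) f)"
        using prj_far_M[OF X gf j u] act_cmp[OF f g jj jj u] B.C.idt_left[OF jj] by simp
    qed
  qed
  ultimately show ?thesis by simp
qed

lemma
  assumes t: "t \<in> hom (fun_cat B E) X Y"
  shows Mt_hom: "Mt t \<in> hom (fun_cat A E) (M X) (M Y)"
    and prj_Mt: "\<And>i j u. \<lbrakk>i \<in> ob A; j \<in> ob B; u \<in> fob W (i, j)\<rbrakk> \<Longrightarrow>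
      prj Y i j u \<cdot> cpt (Mt t) i = cpt t j \<cdot> prj X i j u"
proof -
  note X = nt_functor(1)[OF t] and Y = nt_functor(2)[OF t]
  have st: "nsrc t = X" "ntgt t = Y" using t by (auto simp: hom_fun_cat)
  let ?P = "\<lambda>i h. h \<in> hom E (fob (M X) i) (fob (M Y) i) \<and>
    (\<forall>(j, u) \<in> ob (elements_at A B W i). prj Y i j u \<cdot> h = cpt t j \<cdot> prj X i j u)"
  have P: "?P i (cpt (Mt t) i)" if i: "i \<in> ob A" for i
  proof -
    have "\<exists>!h. ?P i h"
    proof (rule M_lift[OF Y i fob_M[OF X i]])
      show "cpt t j \<cdot> prj X i j u \<in> hom E (fob (M X) i) (fob Y j)" if "j \<in> ob B" "u \<in> fob W (i, j)"
        for j u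
        using A.E.cmp_hom[OF prj_hom[OF X i that] nt_cpt[OF t that(1)]] .
      show "far Y g \<cdot> (cpt t j \<cdot> prj X i j u) = cpt t j' \<cdot> prj X i j' (act (idt A i) g u)"
        if g: "g \<in> hom B j j'" and u: "u \<in> fob W (i, j)" for g j j' u
      proof -
        note j = B.C.hom_ob[OF g]
        note p = prj_hom[OF X i j(1) u] and tj = nt_cpt[OF t j(1)] nt_cpt[OF t j(2)]
        show ?thesis
          using A.E.assoc[OF p tj(1) functor_hom[OF Y g]] A.E.assoc[OF p functor_hom[OF X g] tj(2)]
            nt_nat[OF t g] prj_nat[OF X i g u] by simp
      qed
    qed
    moreover have "cpt (Mt t) i = (THE h. ?P i h)"
      using i by (simp add: matching_ar_def matching_ob_def prj_def st Let_def)
    ultimately show ?thesis using theI'[of "?P i"] by simp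
  qed
  then show prj: "prj Y i j u \<cdot> cpt (Mt t) i = cpt t j \<cdot> prj X i j u"
    if "i \<in> ob A" "j \<in> ob B" "u \<in> fob W (i, j)" for i j u
    using ob_elements_at[OF that(1)] that by blast
  have c: "cpt (Mt t) i \<in> hom E (fob (M X) i) (fob (M Y) i)" if "i \<in> ob A" for i
    using P[OF that] by blast
  have "Mt t = mk_nt A (M X) (M Y) (cpt (Mt t))"
    by (simp add: matching_ar_def mk_nt_def st restrict_def cong: if_cong)
  moreover have "\<dots> \<in> hom (fun_cat A E) (M X) (M Y)"
  proof (rule mk_nt_hom[OF A.C.category_axioms M_functor[OF X] M_functor[OF Y] c])
    fix f i i' assume f: "f \<in> hom A i i'"
    note i = A.C.hom_ob[OF f]
    note Xf = far_M_hom[OF X f] and Yf = far_M_hom[OF Y f]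
    show "far (M Y) f \<cdot> cpt (Mt t) i = cpt (Mt t) i' \<cdot> far (M X) f"
    proof (rule M_joint_mono[OF Y i(2) A.E.cmp_hom[OF c[OF i(1)] Yf] A.E.cmp_hom[OF Xf c[OF i(2)]]])
      fix j u assume j: "j \<in> ob B" and u: "u \<in> fob W (i', j)"
      note fu = act_mem[OF f B.C.idt_hom[OF j] u]
      have "prj Y i' j u \<cdot> (far (M Y) f \<cdot> cpt (Mt t) i) = cpt t j \<cdot> prj X i j (act f (idt B j) u)"
        using A.E.assoc[OF c[OF i(1)] Yf prj_hom[OF Y i(2) j u]] prj_far_M[OF Y f j u] prj[OF i(1) j fu]
          by simp
      also have "\<dots> = prj Y i' j u \<cdot> (cpt (Mt t) i' \<cdot> far (M X) f)"
        using A.E.assoc[OF Xf c[OF i(2)] prj_hom[OF Y i(2) j u]] prj_far_M[OF X f j u] prj[OF i(2) j u]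
          A.E.assoc[OF Xf prj_hom[OF X i(2) j u] nt_cpt[OF t j]] by simp
      finally show "prj Y i' j u \<cdot> (far (M Y) f \<cdot> cpt (Mt t) i) =
        prj Y i' j u \<cdot> (cpt (Mt t) i' \<cdot> far (M X) f)" .
    qed
  qed
  ultimately show "Mt t \<in> hom (fun_cat A E) (M X) (M Y)" by simp
qed

lemma Mt_cmp:
  assumes t: "t \<in> hom (fun_cat B E) X Y" and s: "s \<in> hom (fun_cat B E) Y Z"
  shows "Mt (s \<cdot>\<^bsub>fun_cat B E\<^esub> t) = Mt s \<cdot>\<^bsub>fun_cat A E\<^esub> Mt t"
proof (rule nt_eqI)
  note st = B.FC.cmp_hom[OF t s]
  note X = nt_functor(1)[OF t] and Z = nt_functor(2)[OF s] and Y = nt_functor(2)[OF t]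
  show "Mt (s \<cdot>\<^bsub>fun_cat B E\<^esub> t) \<in> hom (fun_cat A E) (M X) (M Z)" by (rule Mt_hom[OF st])
  show "Mt s \<cdot>\<^bsub>fun_cat A E\<^esub> Mt t \<in> hom (fun_cat A E) (M X) (M Z)"
    by (rule A.FC.cmp_hom[OF Mt_hom[OF t] Mt_hom[OF s]])
  fix i assume i: "i \<in> ob A"
  note ti = nt_cpt[OF Mt_hom[OF t] i] and si = nt_cpt[OF Mt_hom[OF s] i]
  have "cpt (Mt (s \<cdot>\<^bsub>fun_cat B E\<^esub> t)) i = cpt (Mt s) i \<cdot> cpt (Mt t) i"
  proof (rule M_joint_mono[OF Z i nt_cpt[OF Mt_hom[OF st] i] A.E.cmp_hom[OF ti si]])
    fix j u assume j: "j \<in> ob B" and u: "u \<in> fob W (i, j)"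
    note p = prj_hom[OF X i j u] prj_hom[OF Y i j u] prj_hom[OF Z i j u]
    show "prj Z i j u \<cdot> cpt (Mt (s \<cdot>\<^bsub>fun_cat B E\<^esub> t)) i = prj Z i j u \<cdot> (cpt (Mt s) i \<cdot> cpt (Mt t) i)"
      using prj_Mt[OF st i j u] prj_Mt[OF t i j u] prj_Mt[OF s i j u] A.E.assoc[OF ti si p(3)]
        A.E.assoc[OF ti p(2) nt_cpt[OF s j]] A.E.assoc[OF p(1) nt_cpt[OF t j] nt_cpt[OF s j]] j by simp
  qed
  then show "cpt (Mt (s \<cdot>\<^bsub>fun_cat B E\<^esub> t)) i = cpt (Mt s \<cdot>\<^bsub>fun_cat A E\<^esub> Mt t) i" using i by simp
qed

text \<open>A limit of terminal objects is terminal. The functor \<open>M B.unit\<close> may differ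
  from the constant functor \<open>A.unit\<close>, so the unique maps between such objects, which
  express the isomorphism of 1 with M 1, have to be carried along in the formulas.\<close>

lemma terminal_M: "is_terminal (fun_cat A E) (M B.unit)"
proof -
  have U: "is_functor B E B.unit" using B.terminal_fun_cat by (simp add: is_terminal_def ob_fun_cat)
  have o: "M B.unit \<in> ob (fun_cat A E)" using M_functor[OF U] by (simp add: ob_fun_cat)
  note b = A.FC.bang_hom[OF A.terminal_fun_cat o]
  have uniq: "h = k" if i: "i \<in> ob A" and "h \<in> hom E v (fob (M B.unit) i)"
    "k \<in> hom E v (fob (M B.unit) i)" for h k v i
  proof (rule M_joint_mono[OF U that])
    fix j u assume j: "j \<in> ob B" "u \<in> fob W (i, j)"
    show "prj B.unit i j u \<cdot> h = prj B.unit i j u \<cdot> k"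
      using A.E.terminal_eq[OF A.E.pt] A.E.cmp_hom[OF that(2) prj_hom[OF U i j]]
        A.E.cmp_hom[OF that(3) prj_hom[OF U i j]] j
      by simp
  qed
  show ?thesis
    unfolding is_terminal_def
  proof (intro conjI ballI o)
    fix X assume "X \<in> ob (fun_cat A E)"
    then have X: "is_functor A E X" by (simp add: ob_fun_cat)
    have "\<exists>h. h \<in> hom E (fob X i) (fob (M B.unit) i)" if i: "i \<in> ob A" for i
    proof -
      have v: "fob X i \<in> ob E" by (rule functor_ob[OF X i])
      note bv = A.E.bang_hom[OF A.E.pt v]
      have "\<exists>!h. h \<in> hom E (fob X i) (fob (M B.unit) i) \<and>
        (\<forall>(j, u) \<in> ob (elements_at A B W i). prj B.unit i j u \<cdot> h = bang E (fob X i) pt)"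
        by (rule M_lift[OF U i v]) (use bv A.E.idt_left[OF bv] B.C.homD(1) in auto)
      then show ?thesis by blast
    qed
    then obtain h where h: "\<And>i. i \<in> ob A \<Longrightarrow> h i \<in> hom E (fob X i) (fob (M B.unit) i)" by metis
    have "mk_nt A X (M B.unit) h \<in> hom (fun_cat A E) X (M B.unit)"
    proof (rule mk_nt_hom[OF A.C.category_axioms X M_functor[OF U] h])
      fix f i i' assume f: "f \<in> hom A i i'"
      note i = A.C.hom_ob[OF f]
      show "far (M B.unit) f \<cdot> h i = h i' \<cdot> far X f"
        by (rule uniq[OF i(2) A.E.cmp_hom[OF h[OF i(1)] far_M_hom[OF U f]]
          A.E.cmp_hom[OF functor_hom[OF X f] h[OF i(2)]]])
    qed
    moreover have "s = s'" if s: "s \<in> hom (fun_cat A E) X (M B.unit)"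
      and s': "s' \<in> hom (fun_cat A E) X (M B.unit)" for s s'
      by (rule nt_eqI[OF s s']) (rule uniq[OF _ nt_cpt[OF s] nt_cpt[OF s']])
    ultimately show "\<exists>!s. s \<in> hom (fun_cat A E) X (M B.unit)" by blast
  qed
qed

end

section \<open>Functors on a collage\<close>

context matching begin

abbreviation "K \<equiv> collage A B W"

lemma ob_collage: "p \<in> ob K \<longleftrightarrow> (\<exists>j \<in> ob B. p = Inl j) \<or> (\<exists>i \<in> ob A. p = Inr i)"
  by (auto simp: collage_def)

lemma hom_collage: "a \<in> hom K p q \<longleftrightarrow>
    (\<exists>g j j'. a = Base g \<and> p = Inl j \<and> q = Inl j' \<and> g \<in> hom B j j') \<or>
    (\<exists>f i i'. a = Bdry f \<and> p = Inr i \<and> q = Inr i' \<and> f \<in> hom A i i') \<or>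
    (\<exists>i j u. a = Het i j u \<and> p = Inr i \<and> q = Inl j \<and> i \<in> ob A \<and> j \<in> ob B \<and> u \<in> fob W (i, j))"
  by (auto simp: hom_def collage_def)

lemma collage_hom_cases:
  assumes "a \<in> hom K p q"
  obtains (Base) g j j' where "a = Base g" "p = Inl j" "q = Inl j'" "g \<in> hom B j j'"
    | (Bdry) f i i' where "a = Bdry f" "p = Inr i" "q = Inr i'" "f \<in> hom A i i'"
    | (Het) i j u where "a = Het i j u" "p = Inr i" "q = Inl j" "i \<in> ob A" "j \<in> ob B" "u \<in> fob W (i, j)"
  using assms unfolding hom_collage by blast

lemma cmp_collage:
  "Base g' \<cdot>\<^bsub>K\<^esub> Base g = Base (g' \<cdot>\<^bsub>B\<^esub> g)"
  "Bdry f' \<cdot>\<^bsub>K\<^esub> Bdry f = Bdry (f' \<cdot>\<^bsub>A\<^esub> f)"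
  "g' \<in> hom B j j' \<Longrightarrow> Base g' \<cdot>\<^bsub>K\<^esub> Het i j u = Het i j' (act (idt A i) g' u)"
  "f \<in> hom A i' i \<Longrightarrow> Het i j u \<cdot>\<^bsub>K\<^esub> Bdry f = Het i' j (act f (idt B j) u)"
  by (auto simp: collage_def hom_def)

lemma idt_collage: "idt K (Inl j) = Base (idt B j)" "idt K (Inr i) = Bdry (idt A i)"
  by (simp_all add: collage_def)

text \<open>No arrow leads from the lower part to the boundary, so after \<open>Base\<close> or
  \<open>Het\<close> only \<open>Base\<close> can follow. Apart from the laws of \<open>A\<close>
  and \<open>B\<close>, associativity then needs \<open>act_cmp\<close> when two arrows act on the
  same side of a \<open>Het\<close>, and \<open>act_commute\<close> when \<open>Het\<close> stands
  between \<open>Bdry\<close> and \<open>Base\<close>.\<close>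

lemma category_collage: "category K"
proof
  fix a assume a: "a \<in> ar K"
  then have "a \<in> hom K (src K a) (tgt K a)" by (simp add: hom_def)
  then show "src K a \<in> ob K" "tgt K a \<in> ob K"
    by (cases rule: collage_hom_cases; use A.C.hom_ob B.C.hom_ob in \<open>auto simp: ob_collage\<close>)+
next
  fix p assume "p \<in> ob K"
  then show "idt K p \<in> hom K p p"
    using A.C.idt_hom B.C.idt_hom by (auto simp: ob_collage idt_collage hom_collage)
next
  fix a b p q r assume a: "a \<in> hom K p q" and b: "b \<in> hom K q r"
  from a show "b \<cdot>\<^bsub>K\<^esub> a \<in> hom K p r"
  proof (cases rule: collage_hom_cases)
    case (Base g j j')
    from b obtain g' j'' where "b = Base g'" "r = Inl j''" "g' \<in> hom B j' j''"
      by (cases rule: collage_hom_cases) (use Base in auto)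
    then show ?thesis using Base B.C.cmp_hom by (auto simp: cmp_collage hom_collage)
  next
    case f: (Bdry f i i')
    from b show ?thesis
    proof (cases rule: collage_hom_cases)
      case (Het i1 j u)
      then show ?thesis
        using f A.C.hom_ob act_mem[OF f(4) B.C.idt_hom] by (simp add: cmp_collage hom_collage)
    qed (use f A.C.cmp_hom in \<open>auto simp: cmp_collage hom_collage\<close>)
  next
    case (Het i j u)
    from b obtain g' j'' where "b = Base g'" "r = Inl j''" "g' \<in> hom B j j''"
      by (cases rule: collage_hom_cases) (use Het in auto)
    then show ?thesis
      using Het B.C.hom_ob act_mem[OF A.C.idt_hom] by (simp add: cmp_collage hom_collage)
  qed
next
  fix a p q assume a: "a \<in> hom K p q"
  then show "idt K q \<cdot>\<^bsub>K\<^esub> a = a"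
    by (cases rule: collage_hom_cases)
      (simp_all add: idt_collage cmp_collage A.C.idt_left B.C.idt_left cmp_collage(3)[OF B.C.idt_hom]
        act_idt)
  from a show "a \<cdot>\<^bsub>K\<^esub> idt K p = a"
    by (cases rule: collage_hom_cases)
      (simp_all add: idt_collage cmp_collage A.C.idt_right B.C.idt_right cmp_collage(4)[OF A.C.idt_hom]
        act_idt)
next
  fix a b c p q r s assume a: "a \<in> hom K p q" and b: "b \<in> hom K q r" and c: "c \<in> hom K r s"
  from a show "(c \<cdot>\<^bsub>K\<^esub> b) \<cdot>\<^bsub>K\<^esub> a = c \<cdot>\<^bsub>K\<^esub> b \<cdot>\<^bsub>K\<^esub> a"
  proof (cases rule: collage_hom_cases)
    case (Base g j j')
    from b obtain g' j'' where b': "b = Base g'" "r = Inl j''" "g' \<in> hom B j' j''"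
      by (cases rule: collage_hom_cases) (use Base in auto)
    from c obtain g'' j3 where "c = Base g''" "s = Inl j3" "g'' \<in> hom B j'' j3"
      by (cases rule: collage_hom_cases) (use b' in auto)
    then show ?thesis using Base b' B.C.assoc by (simp add: cmp_collage)
  next
    case (Het i j u)
    from b obtain g' j'' where b': "b = Base g'" "r = Inl j''" "g' \<in> hom B j j''"
      by (cases rule: collage_hom_cases) (use Het in auto)
    from c obtain g'' j3 where c': "c = Base g''" "s = Inl j3" "g'' \<in> hom B j'' j3"
      by (cases rule: collage_hom_cases) (use b' in auto)
    note ii = A.C.idt_hom[OF Het(4)]
    show ?thesis
      using Het b' c' act_cmp[OF ii ii b'(3) c'(3) Het(6)] A.C.idt_left[OF ii]
      by (simp add: cmp_collage(1) cmp_collage(3)[OF b'(3)] cmp_collage(3)[OF c'(3)]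
        cmp_collage(3)[OF B.C.cmp_hom[OF b'(3) c'(3)]])
  next
    case f: (Bdry f i i')
    from b show ?thesis
    proof (cases rule: collage_hom_cases)
      case (Base g j j')
      then show ?thesis using f by simp
    next
      case g: (Bdry f' i1 i'')
      then have f': "f' \<in> hom A i' i''" using f by simp
      from c show ?thesis
      proof (cases rule: collage_hom_cases)
        case (Base g j j')
        then show ?thesis using g by simp
      next
        case h: (Bdry f'' i2 i3)
        then show ?thesis using f g A.C.assoc by (simp add: cmp_collage)
      next
        case h: (Het i2 j u)
        then have u: "u \<in> fob W (i'', j)" using g by simp
        note jj = B.C.idt_hom[OF h(5)]
        show ?thesis
          using f g h act_cmp[OF f(4) f' jj jj u] B.C.idt_left[OF jj]
          by (simp add: cmp_collage(2) cmp_collage(4)[OF f(4)] cmp_collage(4)[OF f']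
            cmp_collage(4)[OF A.C.cmp_hom[OF f(4) f']])
      qed
    next
      case h: (Het i1 j u)
      then have u: "u \<in> fob W (i', j)" using f by simp
      from c obtain g' j' where c': "c = Base g'" "s = Inl j'" "g' \<in> hom B j j'"
        by (cases rule: collage_hom_cases) (use h in auto)
      show ?thesis
        using f h c' act_commute[OF f(4) c'(3) u]
        by (simp add: cmp_collage(3)[OF c'(3)] cmp_collage(4)[OF f(4)])
    qed
  qed
qed

end

section \<open>Functors and transformations on a category isomorphic to a collage\<close>

locale glued_collage = matching A B E pt W l + I: complete_functor_category I E pt
  for A :: "('d, 'e) cat" and B :: "('j, 'k) cat" and E :: "('p, 'b) cat" (structure) and pt
    and W :: "('d, 'e, 'j, 'k, 'u) profctr" and l :: "('d, 'j, 'k, 'u, 'p, 'b) elements_lims"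
    and I :: "('o, 'a) cat" +
  fixes glu :: "('j + 'd, ('d, 'e, 'j, 'k, 'u) collage_ar, 'o, 'a) fctr"
  assumes glu: "is_iso_fctr (collage A B W) I glu"
begin

abbreviation base :: "('j, 'k, 'o, 'a) fctr" where
  "base \<equiv> comp_fctr B glu (collage_base B)"

abbreviation bd :: "('d, 'e, 'o, 'a) fctr" where
  "bd \<equiv> comp_fctr A glu (collage_bdry A)"

definition het :: "'d \<Rightarrow> 'j \<Rightarrow> 'u \<Rightarrow> 'a" where
  "het i j u = far glu (Het i j u)"

lemma functor_glu: "is_functor K I glu"
  using glu by (simp add: is_iso_fctr_def)

lemma fob_base: "j \<in> ob B \<Longrightarrow> fob base j = fob glu (Inl j)"
  and far_base: "g \<in> hom B j j' \<Longrightarrow> far base g = far glu (Base g)"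
  and fob_bd: "i \<in> ob A \<Longrightarrow> fob bd i = fob glu (Inr i)"
  and far_bd: "f \<in> hom A i i' \<Longrightarrow> far bd f = far glu (Bdry f)"
  by (auto simp: collage_base_def collage_bdry_def hom_def)

lemma functor_base: "is_functor B I base"
proof (rule is_functor_comp_fctr[OF B.C.category_axioms _ functor_glu])
  have "(collage_base B :: ('j, 'k, 'j + 'd, ('d, 'e, 'j, 'k, 'u) collage_ar) fctr) =
    mk_fctr B Inl Base" by (simp add: collage_base_def mk_fctr_def)
  moreover have "is_functor B K \<dots>"
    by (rule is_functor_mk_fctr[OF B.C.category_axioms])
      (auto simp: ob_collage hom_collage idt_collage cmp_collage)
  ultimately show "is_functor B K (collage_base B)" by simp
qed

lemma functor_bd: "is_functor A I bd"
proof (rule is_functor_comp_fctr[OF A.C.category_axioms _ functor_glu])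
  have "(collage_bdry A :: ('d, 'e, 'j + 'd, ('d, 'e, 'j, 'k, 'u) collage_ar) fctr) =
    mk_fctr A Inr Bdry" by (simp add: collage_bdry_def mk_fctr_def)
  moreover have "is_functor A K \<dots>"
    by (rule is_functor_mk_fctr[OF A.C.category_axioms])
      (auto simp: ob_collage hom_collage idt_collage cmp_collage)
  ultimately show "is_functor A K (collage_bdry A)" by simp
qed

sublocale base: functor_between_complete B I E pt base
  by unfold_locales (rule functor_base)

sublocale bd: functor_between_complete A I E pt bd
  by unfold_locales (rule functor_bd)

lemma het_hom: "\<lbrakk>i \<in> ob A; j \<in> ob B; u \<in> fob W (i, j)\<rbrakk> \<Longrightarrow> het i j u \<in> hom I (fob bd i) (fob base j)"
  unfolding het_def using functor_hom[OF functor_glu, of "Het i j u" "Inr i" "Inl j"]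
  by (simp add: fob_bd fob_base hom_collage del: fob_comp_fctr)

lemma base_het:
  assumes i: "i \<in> ob A" and g: "g \<in> hom B j j'" and u: "u \<in> fob W (i, j)"
  shows "far base g \<cdot>\<^bsub>I\<^esub> het i j u = het i j' (act (idt A i) g u)"
proof -
  have "Het i j u \<in> hom K (Inr i) (Inl j)" "Base g \<in> hom K (Inl j) (Inl j')"
    using i g u B.C.hom_ob by (auto simp: hom_collage)
  from functor_cmp[OF functor_glu this] show ?thesis
    by (simp add: het_def far_base[OF g] cmp_collage(3)[OF g])
qed

lemma het_bd:
  assumes f: "f \<in> hom A i i'" and j: "j \<in> ob B" and u: "u \<in> fob W (i', j)"
  shows "het i' j u \<cdot>\<^bsub>I\<^esub> far bd f = het i j (act f (idt B j) u)"
proof -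
  have "Bdry f \<in> hom K (Inr i) (Inr i')" "Het i' j u \<in> hom K (Inr i') (Inl j)"
    using f j u A.C.hom_ob by (auto simp: hom_collage)
  from functor_cmp[OF functor_glu this] show ?thesis
    by (simp add: het_def far_bd[OF f] cmp_collage(4)[OF f])
qed

definition unglue :: "('o, 'a, 'j + 'd, ('d, 'e, 'j, 'k, 'u) collage_ar) fctr" where
  "unglue = (SOME G. is_functor I K G \<and> comp_fctr K G glu = id_fctr K \<and> comp_fctr I glu G = id_fctr I)"

lemma unglue: "is_functor I K unglue" "comp_fctr K unglue glu = id_fctr K" "comp_fctr I glu unglue =
  id_fctr I"
proof -
  have "\<exists>G. is_functor I K G \<and> comp_fctr K G glu = id_fctr K \<and> comp_fctr I glu G = id_fctr I"
    using glu by (simp add: is_iso_fctr_def)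
  from someI_ex[OF this] show "is_functor I K unglue" "comp_fctr K unglue glu =
    id_fctr K" "comp_fctr I glu unglue = id_fctr I"
    unfolding unglue_def by blast+
qed

lemma fob_unglue: "p \<in> ob K \<Longrightarrow> fob unglue (fob glu p) = p"
  using arg_cong[OF unglue(2), of "\<lambda>F. fob F p"] by (simp add: id_fctr_def)

lemma far_unglue: "a \<in> ar K \<Longrightarrow> far unglue (far glu a) = a"
  using arg_cong[OF unglue(2), of "\<lambda>F. far F a"] by (simp add: id_fctr_def)

lemma glu_fob_unglue: "x \<in> ob I \<Longrightarrow> fob glu (fob unglue x) = x"
  using arg_cong[OF unglue(3), of "\<lambda>F. fob F x"] by (simp add: id_fctr_def)

lemma glu_far_unglue: "a \<in> ar I \<Longrightarrow> far glu (far unglue a) = a"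
  using arg_cong[OF unglue(3), of "\<lambda>F. far F a"] by (simp add: id_fctr_def)

lemma ob_cases:
  assumes "x \<in> ob I"
  obtains (base) j where "j \<in> ob B" "x = fob base j" | (bd) i where "i \<in> ob A" "x = fob bd i"
proof -
  have "fob unglue x \<in> ob K" using functor_ob[OF unglue(1) assms] .
  then show ?thesis using glu_fob_unglue[OF assms] fob_base fob_bd base bd by (auto simp: ob_collage)
qed

text \<open>The inverse isomorphism carries the three kinds of collage arrow over to
  \<open>I\<close>, which gives the case distinction for naturality on \<open>I\<close>.\<close>

lemma hom_cases:
  assumes a: "a \<in> hom I x y"
  obtains (base) g j j' where "g \<in> hom B j j'" "a = far base g" "x = fob base j" "y = fob base j'"
    | (bd) f i i' where "f \<in> hom A i i'" "a = far bd f" "x = fob bd i" "y = fob bd i'"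
    | (het) i j u where "i \<in> ob A" "j \<in> ob B" "u \<in> fob W (i, j)" "a = het i j u" "x = fob bd i" "y =
      fob base j"
proof -
  have a': "far glu (far unglue a) = a" using glu_far_unglue I.C.homD(1)[OF a] .
  have xy: "fob glu (fob unglue x) = x" "fob glu (fob unglue y) = y"
    using glu_fob_unglue I.C.hom_ob[OF a] by blast+
  from functor_hom[OF unglue(1) a] show ?thesis
  proof (cases rule: collage_hom_cases)
    case (Base g j j')
    then show ?thesis using base[of g j j'] a' xy far_base[of g j j'] fob_base B.C.hom_ob[of g j j']
      by simp
  next
    case (Bdry f i i')
    then show ?thesis using bd[of f i i'] a' xy far_bd[of f i i'] fob_bd A.C.hom_ob[of f i i'] by simp
  next
    case (Het i j u)
    then show ?thesis using het[of i j u] a' xy fob_bd fob_base by (simp add: het_def)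
  qed
qed

lemma nt_eqI_glued:
  assumes t: "t \<in> hom (fun_cat I E) X Y" and s: "s \<in> hom (fun_cat I E) X Y"
    and eq: "whisker B t base = whisker B s base" "whisker A t bd = whisker A s bd"
  shows "t = s"
proof (rule nt_eqI[OF t s])
  fix x assume "x \<in> ob I"
  then show "cpt t x = cpt s x"
  proof (cases rule: ob_cases)
    case (base j)
    then show ?thesis using arg_cong[OF eq(1), of "\<lambda>t. cpt t j"] by (simp del: fob_comp_fctr)
  next
    case (bd i)
    then show ?thesis using arg_cong[OF eq(2), of "\<lambda>t. cpt t i"] by (simp del: fob_comp_fctr)
  qed
qed

text \<open>Naturality along arrows inside the lower part and inside the boundary is already
  contained in \<open>tB\<close> and \<open>tA\<close>; only the arrows crossing from the boundary
  to the lower part impose a new condition.\<close>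

lemma nt_extend:
  assumes X: "is_functor I E X" and Y: "is_functor I E Y"
    and tB: "tB \<in> hom (fun_cat B E) (comp_fctr B X base) (comp_fctr B Y base)"
    and tA: "tA \<in> hom (fun_cat A E) (comp_fctr A X bd) (comp_fctr A Y bd)"
    and het: "\<And>i j u. \<lbrakk>i \<in> ob A; j \<in> ob B; u \<in> fob W (i, j)\<rbrakk> \<Longrightarrow>
      far Y (het i j u) \<cdot> cpt tA i = cpt tB j \<cdot> far X (het i j u)"
  obtains t where "t \<in> hom (fun_cat I E) X Y" "whisker B t base = tB" "whisker A t bd = tA"
proof -
  \<comment> \<open>The inverse of the gluing isomorphism decides in which of the two parts an
    object lies.\<close>
  define c where "c x = (case fob unglue x of Inl j \<Rightarrow> cpt tB j | Inr i \<Rightarrow> cpt tA i)" for x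
  have cB: "c (fob base j) = cpt tB j" if "j \<in> ob B" for j
    unfolding c_def fob_base[OF that] using fob_unglue[of "Inl j"] that by (simp add: ob_collage)
  have cA: "c (fob bd i) = cpt tA i" if "i \<in> ob A" for i
    unfolding c_def fob_bd[OF that] using fob_unglue[of "Inr i"] that by (simp add: ob_collage)
  have fB: "fob (comp_fctr B Z base) j = fob Z (fob base j)"
    if "j \<in> ob B" for Z :: "('o, 'a, 'p, 'b) fctr" and j
    using that by simp
  have fA: "fob (comp_fctr A Z bd) i = fob Z (fob bd i)"
    if "i \<in> ob A" for Z :: "('o, 'a, 'p, 'b) fctr" and i
    using that by simp
  have t: "mk_nt I X Y c \<in> hom (fun_cat I E) X Y"
  proof (rule mk_nt_hom[OF I.C.category_axioms X Y])
    show "c x \<in> hom E (fob X x) (fob Y x)" if "x \<in> ob I" for x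
      using that
    proof (cases rule: ob_cases)
      case (base j)
      show ?thesis using nt_cpt[OF tB base(1)] unfolding base(2) cB[OF base(1)] fB[OF base(1)] .
    next
      case (bd i)
      show ?thesis using nt_cpt[OF tA bd(1)] unfolding bd(2) cA[OF bd(1)] fA[OF bd(1)] .
    qed
    show "far Y a \<cdot> c x = c y \<cdot> far X a" if "a \<in> hom I x y" for a x y
      using that
    proof (cases rule: hom_cases)
      case (base g j j')
      then show ?thesis
        using nt_nat[OF tB base(1)] cB B.C.hom_ob[OF base(1)] B.C.homD(1)[OF base(1)] by simp
    next
      case (bd f i i')
      then show ?thesis
        using nt_nat[OF tA bd(1)] cA A.C.hom_ob[OF bd(1)] A.C.homD(1)[OF bd(1)] by simp
    next
      case (het i j u)
      then show ?thesis using assms(5)[OF het(1-3)] cA cB by simp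
    qed
  qed
  show ?thesis
  proof (rule that[OF t])
    show "whisker B (mk_nt I X Y c) base = tB"
      by (rule nt_eqI[OF whisker_hom[OF B.C.category_axioms functor_base t] tB])
        (simp add: cB functor_ob[OF functor_base] del: fob_comp_fctr)
    show "whisker A (mk_nt I X Y c) bd = tA"
      by (rule nt_eqI[OF whisker_hom[OF A.C.category_axioms functor_bd t] tA])
        (simp add: cA functor_ob[OF functor_bd] del: fob_comp_fctr)
  qed
qed

text \<open>The values of \<open>X\<close> on the crossing arrows out of \<open>i\<close> form a
  cone over the category of elements by \<open>base_het\<close>, hence induce a map into the
  matching object; \<open>het_bd\<close> makes these maps natural in \<open>i\<close>.\<close>

lemma attach_exists:
  assumes X: "is_functor I E X"
  shows "\<exists>t \<in> hom (fun_cat A E) (comp_fctr A X bd) (M (comp_fctr B X base)).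
    \<forall>i \<in> ob A. \<forall>j \<in> ob B. \<forall>u \<in> fob W (i, j). prj (comp_fctr B X base) i j u \<cdot> cpt t i =
      far X (het i j u)"
proof -
  let ?XB = "comp_fctr B X base" and ?XA = "comp_fctr A X bd"
  have XB: "is_functor B E ?XB" by (rule is_functor_comp_fctr[OF B.C.category_axioms functor_base X])
  have XA: "is_functor A E ?XA" by (rule is_functor_comp_fctr[OF A.C.category_axioms functor_bd X])
  have fB: "fob ?XB j = fob X (fob base j)" if "j \<in> ob B" for j using that by simp
  have fA: "fob ?XA i = fob X (fob bd i)" if "i \<in> ob A" for i using that by simp
  have h: "far X (het i j u) \<in> hom E (fob ?XA i) (fob ?XB j)"
    if "i \<in> ob A" "j \<in> ob B" "u \<in> fob W (i, j)" for i j u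
    using functor_hom[OF X het_hom[OF that]] fA fB that by simp
  have "\<exists>h. h \<in> hom E (fob ?XA i) (fob (M ?XB) i) \<and>
      (\<forall>j \<in> ob B. \<forall>u \<in> fob W (i, j). prj ?XB i j u \<cdot> h = far X (het i j u))" if i: "i \<in> ob A" for i
  proof -
    have "\<exists>!h. h \<in> hom E (fob ?XA i) (fob (M ?XB) i) \<and>
      (\<forall>(j, u) \<in> ob (elements_at A B W i). prj ?XB i j u \<cdot> h = far X (het i j u))"
    proof (rule M_lift[OF XB i functor_ob[OF XA i] h[OF i]])
      fix g j j' u assume g: "g \<in> hom B j j'" and u: "u \<in> fob W (i, j)"
      note j = B.C.hom_ob[OF g]
      show "far ?XB g \<cdot> far X (het i j u) = far X (het i j' (act (idt A i) g u))"
        using functor_cmp[OF X het_hom[OF i j(1) u] functor_hom[OF functor_base g]] B.C.homD(1)[OF g]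
        unfolding base_het[OF i g u] by simp
    qed
    then show ?thesis using ob_elements_at[OF i] by blast
  qed
  then obtain c where c: "\<And>i. i \<in> ob A \<Longrightarrow> c i \<in> hom E (fob ?XA i) (fob (M ?XB) i)"
    "\<And>i j u. \<lbrakk>i \<in> ob A; j \<in> ob B; u \<in> fob W (i, j)\<rbrakk> \<Longrightarrow> prj ?XB i j u \<cdot> c i = far X (het i j u)"
    by metis
  have "mk_nt A ?XA (M ?XB) c \<in> hom (fun_cat A E) ?XA (M ?XB)"
  proof (rule mk_nt_hom[OF A.C.category_axioms XA M_functor[OF XB] c(1)])
    fix f i i' assume f: "f \<in> hom A i i'"
    note i = A.C.hom_ob[OF f]
    note Mf = far_M_hom[OF XB f] and Xf = functor_hom[OF XA f]
    show "far (M ?XB) f \<cdot> c i = c i' \<cdot> far ?XA f"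
    proof (rule M_joint_mono[OF XB i(2) A.E.cmp_hom[OF c(1)[OF i(1)] Mf]
      A.E.cmp_hom[OF Xf c(1)[OF i(2)]]])
      fix j u assume j: "j \<in> ob B" and u: "u \<in> fob W (i', j)"
      note p = prj_hom[OF XB i(2) j u]
      have "prj ?XB i' j u \<cdot> (far (M ?XB) f \<cdot> c i) = far X (het i j (act f (idt B j) u))"
        using A.E.assoc[OF c(1)[OF i(1)] Mf p] prj_far_M[OF XB f j u]
          c(2)[OF i(1) j act_mem[OF f B.C.idt_hom[OF j] u]] by simp
      also have "\<dots> = prj ?XB i' j u \<cdot> (c i' \<cdot> far ?XA f)"
        using A.E.assoc[OF Xf c(1)[OF i(2)] p] c(2)[OF i(2) j u]
          functor_cmp[OF X functor_hom[OF functor_bd f] het_hom[OF i(2) j u]] A.C.homD(1)[OF f]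
        unfolding het_bd[OF f j u] by simp
      finally show "prj ?XB i' j u \<cdot> (far (M ?XB) f \<cdot> c i) = prj ?XB i' j u \<cdot> (c i' \<cdot> far ?XA f)" .
    qed
  qed
  then show ?thesis by (rule bexI[rotated]) (simp add: c(2))
qed

text \<open>The structure map of the object of the comma category of \<open>M\<close> that
  corresponds to \<open>X\<close>.\<close>

definition attach :: "('o, 'a, 'p, 'b) fctr \<Rightarrow> ('d, 'e, 'p, 'b) ntrans" where
  "attach X = (SOME t. t \<in> hom (fun_cat A E) (comp_fctr A X bd) (M (comp_fctr B X base)) \<and>
    (\<forall>i \<in> ob A. \<forall>j \<in> ob B. \<forall>u \<in> fob W (i, j). prj (comp_fctr B X base) i j u \<cdot> cpt t i =
      far X (het i j u)))"

lemma attach: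
  assumes X: "is_functor I E X"
  shows attach_hom: "attach X \<in> hom (fun_cat A E) (comp_fctr A X bd) (M (comp_fctr B X base))"
    and prj_attach: "\<And>i j u. \<lbrakk>i \<in> ob A; j \<in> ob B; u \<in> fob W (i, j)\<rbrakk> \<Longrightarrow>
      prj (comp_fctr B X base) i j u \<cdot> cpt (attach X) i = far X (het i j u)"
  using someI_ex[OF attach_exists[OF X, unfolded Bex_def]] unfolding attach_def by blast+

lemma attach_eqI:
  assumes X: "is_functor I E X" and t: "t \<in> hom (fun_cat A E) (comp_fctr A X bd) (M
    (comp_fctr B X base))"
    and eq: "\<And>i j u. \<lbrakk>i \<in> ob A; j \<in> ob B; u \<in> fob W (i, j)\<rbrakk> \<Longrightarrow>
      prj (comp_fctr B X base) i j u \<cdot> cpt t i = far X (het i j u)"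
  shows "attach X = t"
proof (rule nt_eqI[OF attach_hom[OF X] t])
  fix i assume i: "i \<in> ob A"
  have XB: "is_functor B E (comp_fctr B X base)"
    by (rule is_functor_comp_fctr[OF B.C.category_axioms functor_base X])
  show "cpt (attach X) i = cpt t i"
    by (rule M_joint_mono[OF XB i nt_cpt[OF attach_hom[OF X] i]
      nt_cpt[OF t i]]) (simp add: eq prj_attach[OF X] i)
qed

text \<open>The left side is the commuting square of a morphism in the comma category. Tested
  against the projections of the matching object, it becomes naturality at the crossing arrows, the
  hypothesis that \<open>nt_extend\<close> requires.\<close>

lemma attach_nat_iff:
  assumes X: "is_functor I E X" and Y: "is_functor I E Y"
    and tB: "tB \<in> hom (fun_cat B E) (comp_fctr B X base) (comp_fctr B Y base)"
    and tA: "tA \<in> hom (fun_cat A E) (comp_fctr A X bd) (comp_fctr A Y bd)"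
  shows "attach Y \<cdot>\<^bsub>fun_cat A E\<^esub> tA = Mt tB \<cdot>\<^bsub>fun_cat A E\<^esub> attach X \<longleftrightarrow>
    (\<forall>i \<in> ob A. \<forall>j \<in> ob B. \<forall>u \<in> fob W (i, j).
      far Y (het i j u) \<cdot> cpt tA i = cpt tB j \<cdot> far X (het i j u))"
proof -
  let ?XB = "comp_fctr B X base" and ?YB = "comp_fctr B Y base"
  note XB = nt_functor(1)[OF tB] and YB = nt_functor(2)[OF tB]
  note l = A.FC.cmp_hom[OF tA attach_hom[OF Y]] and r = A.FC.cmp_hom[OF attach_hom[OF X] Mt_hom[OF tB]]
  have e: "prj ?YB i j u \<cdot> cpt (attach Y \<cdot>\<^bsub>fun_cat A E\<^esub> tA) i = far Y (het i j u) \<cdot> cpt tA i"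
    "prj ?YB i j u \<cdot> cpt (Mt tB \<cdot>\<^bsub>fun_cat A E\<^esub> attach X) i = cpt tB j \<cdot> far X (het i j u)"
    if i: "i \<in> ob A" and j: "j \<in> ob B" and u: "u \<in> fob W (i, j)" for i j u
  proof -
    note p = prj_hom[OF YB i j u] prj_hom[OF XB i j u]
    show "prj ?YB i j u \<cdot> cpt (attach Y \<cdot>\<^bsub>fun_cat A E\<^esub> tA) i = far Y (het i j u) \<cdot> cpt tA i"
      using A.E.assoc[OF nt_cpt[OF tA i] nt_cpt[OF attach_hom[OF Y] i] p(1)] prj_attach[OF Y i j u] i
        by simp
    show "prj ?YB i j u \<cdot> cpt (Mt tB \<cdot>\<^bsub>fun_cat A E\<^esub> attach X) i = cpt tB j \<cdot> far X (het i j u)"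
      using A.E.assoc[OF nt_cpt[OF attach_hom[OF X] i] nt_cpt[OF Mt_hom[OF tB] i] p(1)]
        A.E.assoc[OF nt_cpt[OF attach_hom[OF X] i] p(2) nt_cpt[OF tB j]]
        prj_attach[OF X i j u] prj_Mt[OF tB i j u] i by simp
  qed
  show ?thesis
  proof
    assume "attach Y \<cdot>\<^bsub>fun_cat A E\<^esub> tA = Mt tB \<cdot>\<^bsub>fun_cat A E\<^esub> attach X"
    then show "\<forall>i \<in> ob A. \<forall>j \<in> ob B. \<forall>u \<in> fob W (i, j).
      far Y (het i j u) \<cdot> cpt tA i = cpt tB j \<cdot> far X (het i j u)"
      using e by metis
  next
    assume h: "\<forall>i \<in> ob A. \<forall>j \<in> ob B. \<forall>u \<in> fob W (i, j).
      far Y (het i j u) \<cdot> cpt tA i = cpt tB j \<cdot> far X (het i j u)"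
    show "attach Y \<cdot>\<^bsub>fun_cat A E\<^esub> tA = Mt tB \<cdot>\<^bsub>fun_cat A E\<^esub> attach X"
    proof (rule nt_eqI[OF l r])
      fix i assume i: "i \<in> ob A"
      show "cpt (attach Y \<cdot>\<^bsub>fun_cat A E\<^esub> tA) i = cpt (Mt tB \<cdot>\<^bsub>fun_cat A E\<^esub> attach X) i"
        by (rule M_joint_mono[OF YB i nt_cpt[OF l i] nt_cpt[OF r i]]) (use e h i in metis)
    qed
  qed
qed

lemma attach_nat:
  assumes t: "t \<in> hom (fun_cat I E) X Y"
  shows "attach Y \<cdot>\<^bsub>fun_cat A E\<^esub> whisker A t bd = Mt (whisker B t base) \<cdot>\<^bsub>fun_cat A E\<^esub> attach X"
proof -
  note tB = whisker_hom[OF B.C.category_axioms functor_base t]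
    and tA = whisker_hom[OF A.C.category_axioms functor_bd t]
  show ?thesis
    unfolding attach_nat_iff[OF nt_functor[OF t] tB tA]
    using nt_nat[OF t het_hom] by (simp del: fob_comp_fctr)
qed

text \<open>The passage from an object of the comma category back to a functor on \<open>I\<close>.
  Its restrictions are the given functors themselves, and this exactness is what keeps the stages of
  the recursion strictly compatible.\<close>

lemma functor_extend:
  assumes XB: "is_functor B E XB" and XA: "is_functor A E XA" and t: "t \<in> hom (fun_cat A E) XA (M XB)"
  obtains X where "is_functor I E X" "comp_fctr B X base = XB" "comp_fctr A X bd = XA" "attach X = t"
proof -
  define X0 where "X0 p = (case p of Inl j \<Rightarrow> fob XB j | Inr i \<Rightarrow> fob XA i)" for p
  \<comment> \<open>A crossing arrow is sent to the projection of the structure map at that element,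
    as \<open>prj_attach\<close> dictates.\<close>
  define f0 where "f0 a = (case a of Base g \<Rightarrow> far XB g | Bdry f \<Rightarrow> far XA f
    | Het i j u \<Rightarrow> prj XB i j u \<cdot> cpt t i)" for a
  have het0: "prj XB i j u \<cdot> cpt t i \<in> hom E (fob XA i) (fob XB j)"
    if "i \<in> ob A" "j \<in> ob B" "u \<in> fob W (i, j)" for i j u
    using A.E.cmp_hom[OF nt_cpt[OF t that(1)] prj_hom[OF XB that]] .
  have f0: "is_functor K E (mk_fctr K X0 f0)"
  proof (rule is_functor_mk_fctr[OF category_collage])
    show "X0 p \<in> ob E" if "p \<in> ob K" for p
      using that functor_ob[OF XB] functor_ob[OF XA] by (auto simp: ob_collage X0_def)
    show "f0 a \<in> hom E (X0 p) (X0 q)" if "a \<in> hom K p q" for a p q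
      using that by (cases rule: collage_hom_cases)
        (simp_all add: f0_def X0_def functor_hom[OF XB] functor_hom[OF XA] het0)
    show "f0 (idt K p) = idt E (X0 p)" if "p \<in> ob K" for p
      using that functor_idt[OF XB] functor_idt[OF XA]
        by (auto simp: ob_collage X0_def f0_def idt_collage)
    show "f0 (b \<cdot>\<^bsub>K\<^esub> a) = f0 b \<cdot> f0 a" if a: "a \<in> hom K p q" and b: "b \<in> hom K q r" for a b p q r
      using a
    proof (cases rule: collage_hom_cases)
      case (Base g j j')
      from b obtain g' j'' where b': "b = Base g'" "r = Inl j''" "g' \<in> hom B j' j''"
        by (cases rule: collage_hom_cases) (use Base in auto)
      then show ?thesis using Base functor_cmp[OF XB Base(4) b'(3)] by (simp add: f0_def cmp_collage)
    next
      case (Het i j u)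
      from b obtain g' j'' where b': "b = Base g'" "r = Inl j''" "g' \<in> hom B j j''"
        by (cases rule: collage_hom_cases) (use Het in auto)
      then show ?thesis
        using Het prj_nat[OF XB Het(4) b'(3) Het(6)]
          A.E.assoc[OF nt_cpt[OF t Het(4)] prj_hom[OF XB Het(4-6)] functor_hom[OF XB b'(3)]]
        by (simp add: f0_def cmp_collage(3)[OF b'(3)])
    next
      case f: (Bdry f i i')
      note i = A.C.hom_ob[OF f(4)]
      from b show ?thesis
      proof (cases rule: collage_hom_cases)
        case (Base g j j')
        then show ?thesis using f by simp
      next
        case g: (Bdry f' i1 i'')
        then show ?thesis using f functor_cmp[OF XA f(4), of f' i''] by (simp add: f0_def cmp_collage)
      next
        case h: (Het i1 j u)
        then have u: "u \<in> fob W (i', j)" using f by simp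
        \<comment> \<open>Functoriality on a boundary arrow followed by a crossing one: the action
          on matching objects reindexes the projection, and naturality of \<open>t\<close> moves
          \<open>f\<close> to the other side.\<close>
        have "prj XB i j (act f (idt B j) u) \<cdot> cpt t i = (prj XB i' j u \<cdot> far (M XB) f) \<cdot> cpt t i"
          using prj_far_M[OF XB f(4) h(5) u] by simp
        also have "\<dots> = (prj XB i' j u \<cdot> cpt t i') \<cdot> far XA f"
          using A.E.assoc[OF nt_cpt[OF t i(1)] far_M_hom[OF XB f(4)] prj_hom[OF XB i(2) h(5) u]]
            A.E.assoc[OF functor_hom[OF XA f(4)] nt_cpt[OF t i(2)] prj_hom[OF XB i(2) h(5) u]]
            nt_nat[OF t f(4)] by simp
        finally show ?thesis using f h by (simp add: f0_def cmp_collage(4)[OF f(4)])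
      qed
    qed
  qed
  let ?X = "comp_fctr I (mk_fctr K X0 f0) unglue"
  have X: "is_functor I E ?X" by (rule is_functor_comp_fctr[OF I.C.category_axioms unglue(1) f0])
  have arK: "a \<in> ar K" "far glu a \<in> ar I" if "a \<in> hom K p q" for a p q
    using that functor_hom[OF functor_glu that] by (auto simp: hom_def)
  have farX: "far ?X (far glu a) = f0 a" if "a \<in> hom K p q" for a p q
    using arK[OF that] by (simp add: far_unglue)
  have fobX: "fob ?X (fob glu p) = X0 p" if "p \<in> ob K" for p
    using functor_ob[OF functor_glu that] that by (simp add: fob_unglue)
  have B: "comp_fctr B ?X base = XB"
  proof (rule functor_eqI[OF is_functor_comp_fctr[OF B.C.category_axioms functor_base X] XB])
    fix j assume j: "j \<in> ob B"
    have "fob (comp_fctr B ?X base) j = fob ?X (fob base j)" using j by (rule fob_comp_fctr)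
    then show "fob (comp_fctr B ?X base) j = fob XB j"
      unfolding fob_base[OF j] using fobX[of "Inl j"] j
        by (simp add: ob_collage X0_def del: fob_comp_fctr)
  next
    fix g assume g: "g \<in> ar B"
    note g' = B.C.homI[OF g]
    have "far (comp_fctr B ?X base) g = far ?X (far base g)" using g by (rule far_comp_fctr)
    then show "far (comp_fctr B ?X base) g = far XB g"
      unfolding far_base[OF g'] using farX[of "Base g" "Inl (src B g)" "Inl (tgt B g)"] g'
        by (simp add: hom_collage f0_def del: far_comp_fctr)
  qed
  have A: "comp_fctr A ?X bd = XA"
  proof (rule functor_eqI[OF is_functor_comp_fctr[OF A.C.category_axioms functor_bd X] XA])
    fix i assume i: "i \<in> ob A"
    have "fob (comp_fctr A ?X bd) i = fob ?X (fob bd i)" using i by (rule fob_comp_fctr)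
    then show "fob (comp_fctr A ?X bd) i = fob XA i"
      unfolding fob_bd[OF i] using fobX[of "Inr i"] i
        by (simp add: ob_collage X0_def del: fob_comp_fctr)
  next
    fix g assume g: "g \<in> ar A"
    note g' = A.C.homI[OF g]
    have "far (comp_fctr A ?X bd) g = far ?X (far bd g)" using g by (rule far_comp_fctr)
    then show "far (comp_fctr A ?X bd) g = far XA g"
      unfolding far_bd[OF g'] using farX[of "Bdry g" "Inr (src A g)" "Inr (tgt A g)"] g'
        by (simp add: hom_collage f0_def del: far_comp_fctr)
  qed
  have "attach ?X = t"
  proof (rule attach_eqI[OF X], unfold A B, rule t)
    fix i j u assume i: "i \<in> ob A" "j \<in> ob B" "u \<in> fob W (i, j)"
    then have "Het i j u \<in> hom K (Inr i) (Inl j)" by (simp add: hom_collage)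
    from farX[OF this] show "prj XB i j u \<cdot> cpt t i = far ?X (het i j u)"
      by (simp add: het_def f0_def del: far_comp_fctr)
  qed
  then show ?thesis using that X B A by blast
qed

end

section \<open>The classifier of a glued functor category\<close>

context category_with_classifier begin

lemma meet_true_true:
  assumes R: "is_product C Om Om R" and x: "x \<in> ob C"
  shows "meet C one Om tr R \<cdot> pairing C R (true_at x) (true_at x) = true_at x"
proof -
  note b = bang_hom[OF one x] and tt = tr_pair_hom[OF R]
  have "meet C one Om tr R \<cdot> pairing C R (true_at x) (true_at x) =
      (meet C one Om tr R \<cdot> pairing C R tr tr) \<cdot> bang C x one"
    using pairing_cmp[OF R tr tr b] assoc[OF b tt meet_hom[OF R]] by simp
  also have "meet C one Om tr R \<cdot> pairing C R tr tr = true_at one"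
    using meet_pullback[OF R] by (simp add: is_pullback_def)
  finally show ?thesis using true_at_cmp[OF b] by simp
qed

text \<open>The equaliser below represents the pairs \<open>(a, y)\<close> of a truth value \<open>a\<close> and a
  generalised element \<open>y\<close> of \<open>Y\<close> with \<open>a \<le> c(y)\<close>.\<close>

lemma
  assumes R: "is_product C Om Om R" and P: "is_product C Om Y P" and c: "c \<in> hom C Y Om"
    and e: "is_equaliser C e (pr1 P) (meet C one Om tr R \<cdot> pairing C R (pr1 P) (c \<cdot> pr2 P))"
  shows bounded_pair_hom: "e \<in> hom C (src C e) (vertex P)"
    and bounded_pair_lift: "\<And>x a y. \<lbrakk>a \<in> hom C x Om; y \<in> hom C x Y;
      meet C one Om tr R \<cdot> pairing C R a (c \<cdot> y) = a\<rbrakk> \<Longrightarrow>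
      \<exists>z \<in> hom C x (src C e). (pr1 P \<cdot> e) \<cdot> z = a \<and> (pr2 P \<cdot> e) \<cdot> z = y"
    and bounded_pair_le: "\<And>x z. z \<in> hom C x (src C e) \<Longrightarrow>
      meet C one Om tr R \<cdot> pairing C R ((pr1 P \<cdot> e) \<cdot> z) (c \<cdot> ((pr2 P \<cdot> e) \<cdot> z)) = (pr1 P \<cdot> e) \<cdot> z"
    and bounded_pair_eqI: "\<And>x z z'. \<lbrakk>z \<in> hom C x (src C e); z' \<in> hom C x (src C e);
      (pr1 P \<cdot> e) \<cdot> z = (pr1 P \<cdot> e) \<cdot> z'; (pr2 P \<cdot> e) \<cdot> z = (pr2 P \<cdot> e) \<cdot> z'\<rbrakk> \<Longrightarrow> z = z'"
proof -
  note p = product_hom[OF P]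
  let ?m = "meet C one Om tr R" and ?f = "pairing C R (pr1 P) (c \<cdot> pr2 P)"
  note cp = cmp_hom[OF p(2) c]
  note f = pairing_hom[OF R p(1) cp] and m = meet_hom[OF R]
  have te: "tgt C e = vertex P" using e homD(2)[OF p(1)] by (simp add: is_equaliser_def)
  show eh: "e \<in> hom C (src C e) (vertex P)" using e te by (simp add: is_equaliser_def hom_def)
  have mf: "(?m \<cdot> ?f) \<cdot> w = ?m \<cdot> pairing C R (pr1 P \<cdot> w) (c \<cdot> (pr2 P \<cdot> w))"
    if w: "w \<in> hom C x (vertex P)" for w x
    using assoc[OF w f m] pairing_cmp[OF R p(1) cp w] assoc[OF w p(2) c] by simp
  note e1 = assoc[OF _ eh p(1)] and e2 = assoc[OF _ eh p(2)]
  show "\<exists>z \<in> hom C x (src C e). (pr1 P \<cdot> e) \<cdot> z = a \<and> (pr2 P \<cdot> e) \<cdot> z = y"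
    if a: "a \<in> hom C x Om" and y: "y \<in> hom C x Y" and eq: "?m \<cdot> pairing C R a (c \<cdot> y) = a" for x a y
  proof -
    note ay = pairing[OF P a y]
    have "pr1 P \<cdot> pairing C P a y = (?m \<cdot> ?f) \<cdot> pairing C P a y"
      using mf[OF ay(1)] ay eq by simp
    then obtain z where z: "z \<in> hom C x (src C e)" "e \<cdot> z = pairing C P a y"
      using equaliser_lift[OF e, of "pairing C P a y" x] ay(1) te by auto
    then show ?thesis using e1[OF z(1)] e2[OF z(1)] ay by auto
  qed
  show "?m \<cdot> pairing C R ((pr1 P \<cdot> e) \<cdot> z) (c \<cdot> ((pr2 P \<cdot> e) \<cdot> z)) = (pr1 P \<cdot> e) \<cdot> z"
    if z: "z \<in> hom C x (src C e)" for x z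
  proof -
    have "(?m \<cdot> ?f) \<cdot> (e \<cdot> z) = pr1 P \<cdot> (e \<cdot> z)"
      using assoc[OF z eh cmp_hom[OF f m]] assoc[OF z eh p(1)] e by (simp add: is_equaliser_def)
    then show ?thesis using mf[OF cmp_hom[OF z eh]] e1[OF z] e2[OF z] by simp
  qed
  show "z = z'" if z: "z \<in> hom C x (src C e)" "z' \<in> hom C x (src C e)"
    and eq: "(pr1 P \<cdot> e) \<cdot> z = (pr1 P \<cdot> e) \<cdot> z'" "(pr2 P \<cdot> e) \<cdot> z = (pr2 P \<cdot> e) \<cdot> z'" for x z z'
  proof -
    have "e \<cdot> z = e \<cdot> z'"
      by (rule product_joint_mono[OF P cmp_hom[OF z(1) eh] cmp_hom[OF z(2) eh]])
        (use eq e1[OF z(1)] e1[OF z(2)] e2[OF z(1)] e2[OF z(2)] in simp_all)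
    then show ?thesis by (rule monoD[OF equaliser_mono[OF e] z])
  qed
qed

end

context glued_collage begin

text \<open>Under the equivalence of \<open>E\<^sup>I\<close> with the comma category of \<open>M\<close>, the classifier is the
  projection to \<open>M OmB\<close> of the object of those pairs \<open>(a, y)\<close> in \<open>Om \<times> M OmB\<close> for which
  the subobject classified by \<open>a\<close> lies in the one cut out by \<open>y\<close>.\<close>

theorem glued_classifier:
  assumes clB: "subobject_classifier (fun_cat B E) B.unit OmB trB"
    and clA: "subobject_classifier (fun_cat A E) one Om tr"
  defines "chi \<equiv> char_map (fun_cat A E) one Om tr (Mt trB \<cdot>\<^bsub>fun_cat A E\<^esub> bang (fun_cat A E) one
    (M B.unit))"
  obtains OmI trI e P where "subobject_classifier (fun_cat I E) I.unit OmI trI"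
    "comp_fctr B OmI base = OmB" "whisker B trI base = trB"
    "is_product (fun_cat A E) Om (M OmB) P" "e \<in> hom (fun_cat A E) (comp_fctr A OmI bd) (vertex P)"
    "\<And>R. is_product (fun_cat A E) Om Om R \<Longrightarrow> is_equaliser (fun_cat A E) e (pr1 P)
      (meet (fun_cat A E) one Om tr R \<cdot>\<^bsub>fun_cat A E\<^esub>
       pairing (fun_cat A E) R (pr1 P) (chi \<cdot>\<^bsub>fun_cat A E\<^esub> pr2 P))"
    "(pr1 P \<cdot>\<^bsub>fun_cat A E\<^esub> e) \<cdot>\<^bsub>fun_cat A E\<^esub> whisker A trI bd =
      tr \<cdot>\<^bsub>fun_cat A E\<^esub> bang (fun_cat A E) A.unit one"
    "(pr2 P \<cdot>\<^bsub>fun_cat A E\<^esub> e) \<cdot>\<^bsub>fun_cat A E\<^esub> whisker A trI bd =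
      Mt trB \<cdot>\<^bsub>fun_cat A E\<^esub> bang (fun_cat A E) A.unit (M B.unit)"
    "chi \<in> hom (fun_cat A E) (M OmB) Om"
proof -
  interpret CA: category_with_classifier "fun_cat A E" one Om tr
    by unfold_locales (rule clA)
  interpret CB: category_with_classifier "fun_cat B E" B.unit OmB trB
    by unfold_locales (rule clB)
  let ?FA = "fun_cat A E" and ?FB = "fun_cat B E" and ?FI = "fun_cat I E"
  let ?M1 = "M B.unit" and ?MO = "M OmB"
  note AC = A.C.category_axioms and BC = B.C.category_axioms and IC = I.C.category_axioms
  note M1 = terminal_M
  have OmB: "is_functor B E OmB" using CB.Om by (simp add: ob_fun_cat)
  have MO: "?MO \<in> ob ?FA" using M_functor[OF OmB] by (simp add: ob_fun_cat)
  have oneA: "one \<in> ob ?FA" using CA.one by (simp add: is_terminal_def)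
  have UA: "A.unit \<in> ob ?FA" using A.terminal_fun_cat by (simp add: is_terminal_def)
  have UI: "is_functor I E I.unit" using I.terminal_fun_cat by (simp add: is_terminal_def ob_fun_cat)
  have Mtr: "Mt trB \<in> hom ?FA ?M1 ?MO" by (rule Mt_hom[OF CB.tr])
  \<comment> \<open>The map \<open>Mt trB\<close> starts at \<open>M B.unit\<close>, whereas the
    classifier on \<open>A\<close> has its own terminal object \<open>one\<close>. The unique map
    between them moves the domain, and a map out of a terminal object is mono.\<close>
  define m1 where "m1 = Mt trB \<cdot>\<^bsub>?FA\<^esub> bang ?FA one ?M1"
  note b1 = A.FC.bang_hom[OF M1 oneA]
  have m1: "m1 \<in> hom ?FA one ?MO" unfolding m1_def by (rule A.FC.cmp_hom[OF b1 Mtr])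
  have m1_mono: "is_mono ?FA m1" by (rule A.FC.mono_from_terminal[OF CA.one m1])
  have chi: "chi \<in> hom ?FA ?MO Om" unfolding chi_def m1_def[symmetric]
    by (rule CA.char_map_hom[OF m1_mono m1])
  have chi_pb: "is_pullback ?FA m1 (bang ?FA one one) chi tr"
    unfolding chi_def m1_def[symmetric] by (rule CA.char_map_pullback[OF m1_mono m1])
  note chi_cl = chi_pb[unfolded CA.classified_iff[OF m1 chi]]
  \<comment> \<open>Since \<open>M B.unit\<close> is terminal, every way of reaching
    \<open>Mt trB\<close> from \<open>X\<close> is the same as going through
    \<open>one\<close>.\<close>
  have Mtr_b: "Mt trB \<cdot>\<^bsub>?FA\<^esub> b = m1 \<cdot>\<^bsub>?FA\<^esub> bang ?FA X one" if b: "b \<in> hom ?FA X ?M1" for b X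
  proof -
    note bX = A.FC.bang_hom[OF CA.one A.FC.hom_ob(1)[OF b]]
    have "bang ?FA one ?M1 \<cdot>\<^bsub>?FA\<^esub> bang ?FA X one = b"
      by (rule A.FC.terminal_eq[OF M1 A.FC.cmp_hom[OF bX b1] b])
    then show ?thesis using A.FC.assoc[OF bX b1 Mtr] by (simp add: m1_def)
  qed
  have chi_true: "chi \<cdot>\<^bsub>?FA\<^esub> (Mt trB \<cdot>\<^bsub>?FA\<^esub> b) = CA.true_at X" if b: "b \<in> hom ?FA X ?M1" for b X
  proof -
    note bX = A.FC.bang_hom[OF CA.one A.FC.hom_ob(1)[OF b]]
    show ?thesis
      unfolding Mtr_b[OF b] using A.FC.assoc[OF bX m1 chi] chi_cl CA.true_at_cmp[OF bX] by simp
  qed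
  \<comment> \<open>The converse of \<open>chi_true\<close>: the subobject classified by
    \<open>chi\<close> is the single global element M(true), so an element on which
    \<open>chi\<close> is true must be that element.\<close>
  have chi_trueD: "y = Mt trB \<cdot>\<^bsub>?FA\<^esub> bang ?FA X ?M1"
    if y: "y \<in> hom ?FA X ?MO" and eq: "chi \<cdot>\<^bsub>?FA\<^esub> y = CA.true_at X" for y X
  proof -
    obtain h where h: "h \<in> hom ?FA X one" "m1 \<cdot>\<^bsub>?FA\<^esub> h = y" using chi_cl y eq by blast
    then show ?thesis
      using Mtr_b[OF A.FC.bang_hom[OF M1 A.FC.hom_ob(1)[OF y]]] A.FC.bang_eq[OF CA.one h(1)] by simp
  qed
  obtain P where P: "is_product ?FA Om ?MO P"
    by (rule A.FC.product_exists[OF A.has_pullbacks_fun_cat A.terminal_fun_cat CA.Om MO])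
  obtain R where R: "is_product ?FA Om Om R"
    by (rule A.FC.product_exists[OF A.has_pullbacks_fun_cat A.terminal_fun_cat CA.Om CA.Om])
  note p = A.FC.product_hom[OF P]
  note cp = A.FC.cmp_hom[OF p(2) chi]
  let ?mt = "meet ?FA one Om tr"
  have mh: "?mt R \<cdot>\<^bsub>?FA\<^esub> pairing ?FA R (pr1 P) (chi \<cdot>\<^bsub>?FA\<^esub> pr2 P) \<in> hom ?FA (vertex P) Om"
    by (rule A.FC.cmp_hom[OF A.FC.pairing_hom[OF R p(1) cp] CA.meet_hom[OF R]])
  obtain e where e: "is_equaliser ?FA e (pr1 P) (?mt R \<cdot>\<^bsub>?FA\<^esub> pairing ?FA R (pr1 P) (chi \<cdot>\<^bsub>?FA\<^esub> pr2 P))"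
    by (rule A.FC.equaliser_exists[OF A.has_pullbacks_fun_cat A.terminal_fun_cat p(1) mh])
  \<comment> \<open>The equaliser was formed with one product \<open>R\<close>, and the meet of a
    given pair is the same for every product.\<close>
  have eR: "is_equaliser ?FA e (pr1 P) (?mt R' \<cdot>\<^bsub>?FA\<^esub> pairing ?FA R' (pr1 P) (chi \<cdot>\<^bsub>?FA\<^esub> pr2 P))"
    if "is_product ?FA Om Om R'" for R'
    using e unfolding CA.meet_pairing_indep[OF R that p(1) cp] .
  define OmA where "OmA = src ?FA e"
  define al where "al = pr1 P \<cdot>\<^bsub>?FA\<^esub> e"
  define be where "be = pr2 P \<cdot>\<^bsub>?FA\<^esub> e"
  note pair = CA.bounded_pair_hom[OF R P chi e, folded OmA_def]
    CA.bounded_pair_lift[OF R P chi e, folded OmA_def al_def be_def]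
    CA.bounded_pair_le[OF R P chi e, folded OmA_def al_def be_def]
    CA.bounded_pair_eqI[OF R P chi e, folded OmA_def al_def be_def]
  have al: "al \<in> hom ?FA OmA Om" unfolding al_def by (rule A.FC.cmp_hom[OF pair(1) p(1)])
  have be: "be \<in> hom ?FA OmA ?MO" unfolding be_def by (rule A.FC.cmp_hom[OF pair(1) p(2)])
  obtain OmI where OmI: "is_functor I E OmI" and OmI_B: "comp_fctr B OmI base = OmB"
    and OmI_A: "comp_fctr A OmI bd = OmA" and OmI_attach: "attach OmI = be"
    by (rule functor_extend[OF OmB nt_functor(1)[OF be] be])
  note bU = A.FC.bang_hom[OF M1 UA]
  \<comment> \<open>The pair of truth and M(true) satisfies the bound because \<open>chi\<close> is
    true at M(true); it therefore lifts to the boundary part of the new truth map.\<close>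
  have "?mt R \<cdot>\<^bsub>?FA\<^esub> pairing ?FA R (CA.true_at A.unit) (chi \<cdot>\<^bsub>?FA\<^esub>
    (Mt trB \<cdot>\<^bsub>?FA\<^esub> bang ?FA A.unit ?M1)) = CA.true_at A.unit"
    unfolding chi_true[OF bU] by (rule CA.meet_true_true[OF R UA])
  then obtain trA where trA: "trA \<in> hom ?FA A.unit OmA" "al \<cdot>\<^bsub>?FA\<^esub> trA = CA.true_at A.unit"
    "be \<cdot>\<^bsub>?FA\<^esub> trA = Mt trB \<cdot>\<^bsub>?FA\<^esub> bang ?FA A.unit ?M1"
    using pair(2)[OF CA.true_at_hom[OF UA] A.FC.cmp_hom[OF bU Mtr]] by blast
  have U_B: "comp_fctr B I.unit base = B.unit" by (rule comp_const_fctr[OF functor_base])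
  have U_A: "comp_fctr A I.unit bd = A.unit" by (rule comp_const_fctr[OF functor_bd])
  have "attach I.unit = bang ?FA A.unit ?M1"
    using A.FC.bang_eq[OF M1, of "attach I.unit"] attach_hom[OF UI] unfolding U_A U_B by simp
  then have "attach OmI \<cdot>\<^bsub>?FA\<^esub> trA = Mt trB \<cdot>\<^bsub>?FA\<^esub> attach I.unit"
    using trA(3) OmI_attach by simp
  moreover have tB: "trB \<in> hom ?FB (comp_fctr B I.unit base) (comp_fctr B OmI base)"
    unfolding U_B OmI_B by (rule CB.tr)
  moreover have tA: "trA \<in> hom ?FA (comp_fctr A I.unit bd) (comp_fctr A OmI bd)"
    unfolding U_A OmI_A by (rule trA)
  ultimately obtain trI where trI: "trI \<in> hom ?FI I.unit OmI"
    and trI_B: "whisker B trI base = trB" and trI_A: "whisker A trI bd = trA"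
    using nt_extend[OF UI OmI tB tA] attach_nat_iff[OF UI OmI tB tA] by metis
  have "\<exists>!k. classifies ?FI I.unit OmI trI m k" if m: "is_mono ?FI m" for m
  proof -
    let ?S = "src ?FI m" and ?X = "tgt ?FI m"
    have mh: "m \<in> hom ?FI ?S ?X" using m by (auto simp: is_mono_def hom_def)
    note S = nt_functor(1)[OF mh] and X = nt_functor(2)[OF mh]
    define SA XA SB XB mA mB where d: "SA = comp_fctr A ?S bd" "XA = comp_fctr A ?X bd"
      "SB = comp_fctr B ?S base" "XB = comp_fctr B ?X base" "mA = whisker A m bd" "mB =
        whisker B m base"
    have mA: "mA \<in> hom ?FA SA XA" unfolding d by (rule whisker_hom[OF AC functor_bd mh])
    have mB: "mB \<in> hom ?FB SB XB" unfolding d by (rule whisker_hom[OF BC functor_base mh])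
    have mA_mono: "is_mono ?FA mA" unfolding d by (rule bd.whisker_mono[OF mh m])
    have mB_mono: "is_mono ?FB mB" unfolding d by (rule base.whisker_mono[OF mh m])
    have atS: "attach ?S \<in> hom ?FA SA (M SB)" and atX: "attach ?X \<in> hom ?FA XA (M XB)"
      unfolding d using attach_hom[OF S] attach_hom[OF X] by blast+
    have at_m: "attach ?X \<cdot>\<^bsub>?FA\<^esub> mA = Mt mB \<cdot>\<^bsub>?FA\<^esub> attach ?S"
      unfolding d by (rule attach_nat[OF mh])
    have SAo: "SA \<in> ob ?FA" and SBo: "SB \<in> ob ?FB" using A.FC.hom_ob(1)[OF mA] B.FC.hom_ob(1)[OF mB]
      by blast+
    note bSA = A.FC.bang_hom[OF A.terminal_fun_cat SAo] and bSB = B.FC.bang_hom[OF CB.one SBo]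
    define kB where "kB = char_map ?FB B.unit OmB trB mB"
    have kB: "kB \<in> hom ?FB XB OmB" unfolding kB_def by (rule CB.char_map_hom[OF mB_mono mB])
    have kB_pb: "is_pullback ?FB mB (bang ?FB SB B.unit) kB trB"
      unfolding kB_def by (rule CB.char_map_pullback[OF mB_mono mB])
    have kBm: "kB \<cdot>\<^bsub>?FB\<^esub> mB = trB \<cdot>\<^bsub>?FB\<^esub> bang ?FB SB B.unit" using kB_pb by (simp add: is_pullback_def)
    define a where "a = char_map ?FA one Om tr mA"
    have a: "a \<in> hom ?FA XA Om" unfolding a_def by (rule CA.char_map_hom[OF mA_mono mA])
    have a_pb: "is_pullback ?FA mA (bang ?FA SA one) a tr"
      unfolding a_def by (rule CA.char_map_pullback[OF mA_mono mA])
    note a_cl = a_pb[unfolded CA.classified_iff[OF mA a]]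
    \<comment> \<open>What the boundary sees of the lower subobject: the lower characteristic map,
      transported to matching objects and pulled back along the structure map of
      \<open>?X\<close>.\<close>
    define y where "y = Mt kB \<cdot>\<^bsub>?FA\<^esub> attach ?X"
    have y: "y \<in> hom ?FA XA ?MO" unfolding y_def by (rule A.FC.cmp_hom[OF atX Mt_hom[OF kB]])
    define b where "b = Mt (bang ?FB SB B.unit) \<cdot>\<^bsub>?FA\<^esub> attach ?S"
    have b: "b \<in> hom ?FA SA ?M1" unfolding b_def by (rule A.FC.cmp_hom[OF atS Mt_hom[OF bSB]])
    have ym: "y \<cdot>\<^bsub>?FA\<^esub> mA = Mt trB \<cdot>\<^bsub>?FA\<^esub> b"
    proof -
      have "y \<cdot>\<^bsub>?FA\<^esub> mA = (Mt kB \<cdot>\<^bsub>?FA\<^esub> Mt mB) \<cdot>\<^bsub>?FA\<^esub> attach ?S"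
        unfolding y_def A.FC.assoc[OF mA atX Mt_hom[OF kB]] at_m A.FC.assoc[OF atS Mt_hom[OF mB]
          Mt_hom[OF kB]] ..
      also have "Mt kB \<cdot>\<^bsub>?FA\<^esub> Mt mB = Mt trB \<cdot>\<^bsub>?FA\<^esub> Mt (bang ?FB SB B.unit)"
        unfolding Mt_cmp[OF mB kB, symmetric] kBm by (rule Mt_cmp[OF bSB CB.tr])
      finally show ?thesis unfolding b_def A.FC.assoc[OF atS Mt_hom[OF bSB] Mtr] .
    qed
    \<comment> \<open>On the boundary part of the subobject, \<open>y\<close> is M(true), because
      the structure map of \<open>?S\<close> factors that of \<open>?X\<close> through the matching
      object of the lower subobject. So \<open>a\<close> lies below \<open>chi\<close> of
      \<open>y\<close>, and the pair lifts.\<close>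
    have "(chi \<cdot>\<^bsub>?FA\<^esub> y) \<cdot>\<^bsub>?FA\<^esub> mA = CA.true_at SA"
      unfolding A.FC.assoc[OF mA y chi] ym by (rule chi_true[OF b])
    then have "?mt R \<cdot>\<^bsub>?FA\<^esub> pairing ?FA R a (chi \<cdot>\<^bsub>?FA\<^esub> y) = a"
      by (rule CA.meet_absorb[OF R a A.FC.cmp_hom[OF y chi] mA a_pb])
    then obtain kA where kA: "kA \<in> hom ?FA XA OmA" "al \<cdot>\<^bsub>?FA\<^esub> kA = a" "be \<cdot>\<^bsub>?FA\<^esub> kA = y"
      using pair(2)[OF a y] by blast
    have "attach OmI \<cdot>\<^bsub>?FA\<^esub> kA = Mt kB \<cdot>\<^bsub>?FA\<^esub> attach ?X" using kA(3) OmI_attach y_def by simp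
    moreover have kB': "kB \<in> hom ?FB (comp_fctr B ?X base) (comp_fctr B OmI base)" using kB
      by (simp add: d OmI_B)
    moreover have kA': "kA \<in> hom ?FA (comp_fctr A ?X bd) (comp_fctr A OmI bd)" using kA
      by (simp add: d OmI_A)
    ultimately obtain k where k: "k \<in> hom ?FI ?X OmI" and k_B: "whisker B k base = kB"
      and k_A: "whisker A k bd = kA"
      using nt_extend[OF X OmI kB' kA'] attach_nat_iff[OF X OmI kB' kA'] by metis
    have tr_true: "al \<cdot>\<^bsub>?FA\<^esub> (trA \<cdot>\<^bsub>?FA\<^esub> c) = CA.true_at w" if c: "c \<in> hom ?FA w A.unit" for c w
      using A.FC.assoc[OF c trA(1) al] trA(2) CA.true_at_cmp[OF c] by simp
    have tr_M: "be \<cdot>\<^bsub>?FA\<^esub> (trA \<cdot>\<^bsub>?FA\<^esub> c) = Mt trB \<cdot>\<^bsub>?FA\<^esub> bang ?FA w ?M1" if c: "c \<in> hom ?FA w A.unit"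
      for c w
      using A.FC.assoc[OF c trA(1) be] trA(3) A.FC.assoc[OF c bU Mtr]
        A.FC.bang_eq[OF M1 A.FC.cmp_hom[OF c bU]] by simp
    \<comment> \<open>Factorisations through \<open>mA\<close> come from the first component
      \<open>a\<close>. On \<open>SA\<close> both components of \<open>kA\<close> are those of the
      true pair, the second one by \<open>ym\<close>.\<close>
    have kA_pb: "is_pullback ?FA mA (bang ?FA SA A.unit) kA trA"
    proof (rule A.FC.pullbackI[OF mA bSA kA(1) trA(1)])
      show "kA \<cdot>\<^bsub>?FA\<^esub> mA = trA \<cdot>\<^bsub>?FA\<^esub> bang ?FA SA A.unit"
      proof (rule pair(4)[OF A.FC.cmp_hom[OF mA kA(1)] A.FC.cmp_hom[OF bSA trA(1)]])
        show "al \<cdot>\<^bsub>?FA\<^esub> kA \<cdot>\<^bsub>?FA\<^esub> mA = al \<cdot>\<^bsub>?FA\<^esub> trA \<cdot>\<^bsub>?FA\<^esub> bang ?FA SA A.unit"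
          using A.FC.assoc[OF mA kA(1) al] kA(2) a_cl tr_true[OF bSA] by simp
        show "be \<cdot>\<^bsub>?FA\<^esub> kA \<cdot>\<^bsub>?FA\<^esub> mA = be \<cdot>\<^bsub>?FA\<^esub> trA \<cdot>\<^bsub>?FA\<^esub> bang ?FA SA A.unit"
          using A.FC.assoc[OF mA kA(1) be] kA(3) ym tr_M[OF bSA] A.FC.bang_eq[OF M1 b] by simp
      qed
    next
      fix w c c' assume c: "c \<in> hom ?FA w XA" and c': "c' \<in> hom ?FA w A.unit"
        and eq: "kA \<cdot>\<^bsub>?FA\<^esub> c = trA \<cdot>\<^bsub>?FA\<^esub> c'"
      have "a \<cdot>\<^bsub>?FA\<^esub> c = CA.true_at w"
        using A.FC.assoc[OF c kA(1) al] kA(2) eq tr_true[OF c'] by simp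
      then obtain h where h: "h \<in> hom ?FA w SA" "mA \<cdot>\<^bsub>?FA\<^esub> h = c" using a_cl c by blast
      moreover have "bang ?FA SA A.unit \<cdot>\<^bsub>?FA\<^esub> h = c'"
        by (rule A.FC.terminal_eq[OF A.terminal_fun_cat A.FC.cmp_hom[OF h(1) bSA] c'])
      ultimately show "\<exists>h\<in>hom ?FA w SA. mA \<cdot>\<^bsub>?FA\<^esub> h = c \<and> bang ?FA SA A.unit \<cdot>\<^bsub>?FA\<^esub> h = c'" by blast
    next
      fix w h h' assume "h \<in> hom ?FA w SA" "h' \<in> hom ?FA w SA" "mA \<cdot>\<^bsub>?FA\<^esub> h = mA \<cdot>\<^bsub>?FA\<^esub> h'"
      then show "h = h'" using A.FC.monoD[OF mA_mono] A.FC.homD(2)[OF mA] by metis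
    qed
    have So: "?S \<in> ob ?FI" using S by (simp add: ob_fun_cat)
    note bS = I.FC.bang_hom[OF I.terminal_fun_cat So]
    have bS_A: "whisker A (bang ?FI ?S I.unit) bd = bang ?FA SA A.unit"
      using A.FC.bang_eq[OF A.terminal_fun_cat, of "whisker A (bang ?FI ?S I.unit) bd" SA]
        whisker_hom[OF AC functor_bd bS] unfolding U_A d by simp
    have bS_B: "whisker B (bang ?FI ?S I.unit) base = bang ?FB SB B.unit"
      using B.FC.bang_eq[OF CB.one, of "whisker B (bang ?FI ?S I.unit) base" SB]
        whisker_hom[OF BC functor_base bS] unfolding U_B d by simp
    show ?thesis
    proof (rule ex1I[of _ k])
      show "classifies ?FI I.unit OmI trI m k"
        unfolding classifies_def
      proof (intro conjI k I.pullback_pointwiseI[OF mh bS k trI])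
        fix x assume "x \<in> ob I"
        then show "is_pullback E (cpt m x) (cpt (bang ?FI ?S I.unit) x) (cpt k x) (cpt trI x)"
        proof (cases rule: ob_cases)
          case (base j)
          show ?thesis
            using B.pullback_pointwise[OF kB_pb base(1)] base(1)
            unfolding base(2) d k_B[symmetric] trI_B[symmetric] bS_B[symmetric, unfolded d]
              by (simp del: fob_comp_fctr)
        next
          case (bd i)
          show ?thesis
            using A.pullback_pointwise[OF kA_pb bd(1)] bd(1)
            unfolding bd(2) d k_A[symmetric] trI_A[symmetric] bS_A[symmetric, unfolded d]
              by (simp del: fob_comp_fctr)
        qed
      qed
    next
      fix k' assume k'c: "classifies ?FI I.unit OmI trI m k'"
      then have k': "k' \<in> hom ?FI ?X OmI" and pb: "is_pullback ?FI m (bang ?FI ?S I.unit) k' trI"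
        by (auto simp: classifies_def)
      define kA2 kB2 where d2: "kA2 = whisker A k' bd" "kB2 = whisker B k' base"
      have kA2: "kA2 \<in> hom ?FA XA OmA" unfolding d d2 OmI_A[symmetric]
        by (rule whisker_hom[OF AC functor_bd k'])
      have kB2: "kB2 \<in> hom ?FB XB OmB" unfolding d d2 OmI_B[symmetric]
        by (rule whisker_hom[OF BC functor_base k'])
      have pbB: "is_pullback ?FB mB (bang ?FB SB B.unit) kB2 trB"
        using base.whisker_classified[OF mh k' trI pb] unfolding d d2 trI_B .
      have pbA: "is_pullback ?FA mA (bang ?FA SA A.unit) kA2 trA"
        using bd.whisker_classified[OF mh k' trI pb] unfolding d d2 trI_A .
      have kB_eq: "kB2 = kB" unfolding kB_def by (rule CB.char_map_eq[OF mB kB2 pbB, symmetric])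
      \<comment> \<open>Naturality of \<open>attach\<close> and uniqueness on the lower part force
        the second component of any competitor, which leaves the first.\<close>
      have be2: "be \<cdot>\<^bsub>?FA\<^esub> kA2 = y"
        using attach_nat[OF k'] OmI_attach kB_eq unfolding y_def d2 by simp
      define a2 where "a2 = al \<cdot>\<^bsub>?FA\<^esub> kA2"
      have a2: "a2 \<in> hom ?FA XA Om" unfolding a2_def by (rule A.FC.cmp_hom[OF kA2 al])
      \<comment> \<open>The first component has to classify \<open>mA\<close>. Where it is true, the
        bound makes \<open>chi\<close> true at \<open>y\<close>, so \<open>y\<close> is M(true)
        there and \<open>kA2\<close> is the true pair; the pullback square of \<open>kA2\<close>
        then gives the factorisation through \<open>mA\<close>.\<close>
      have "is_pullback ?FA mA (bang ?FA SA one) a2 tr"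
        unfolding CA.classified_iff[OF mA a2]
      proof (intro conjI allI ballI impI mA_mono)
        have "kA2 \<cdot>\<^bsub>?FA\<^esub> mA = trA \<cdot>\<^bsub>?FA\<^esub> bang ?FA SA A.unit" using pbA by (simp add: is_pullback_def)
        then show "a2 \<cdot>\<^bsub>?FA\<^esub> mA = CA.true_at SA"
          unfolding a2_def A.FC.assoc[OF mA kA2 al] using tr_true[OF bSA] by simp
        fix w z assume z: "z \<in> hom ?FA w XA" and az: "a2 \<cdot>\<^bsub>?FA\<^esub> z = CA.true_at w"
        note kz = A.FC.cmp_hom[OF z kA2] and yz = A.FC.cmp_hom[OF z y]
        have wo: "w \<in> ob ?FA" using A.FC.hom_ob(1)[OF z] .
        note bw = A.FC.bang_hom[OF A.terminal_fun_cat wo]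
        have al_kz: "al \<cdot>\<^bsub>?FA\<^esub> kA2 \<cdot>\<^bsub>?FA\<^esub> z = CA.true_at w"
          using az unfolding a2_def A.FC.assoc[OF z kA2 al] .
        have be_kz: "be \<cdot>\<^bsub>?FA\<^esub> kA2 \<cdot>\<^bsub>?FA\<^esub> z = y \<cdot>\<^bsub>?FA\<^esub> z"
          using A.FC.assoc[OF z kA2 be] be2 by simp
        have "?mt R \<cdot>\<^bsub>?FA\<^esub> pairing ?FA R (CA.true_at w) (chi \<cdot>\<^bsub>?FA\<^esub> y \<cdot>\<^bsub>?FA\<^esub> z) = CA.true_at w"
          using pair(3)[OF kz] unfolding al_kz be_kz .
        from CA.meet_true_left[OF R A.FC.cmp_hom[OF yz chi] this]
        have "y \<cdot>\<^bsub>?FA\<^esub> z = Mt trB \<cdot>\<^bsub>?FA\<^esub> bang ?FA w ?M1" by (rule chi_trueD[OF yz])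
        then have "kA2 \<cdot>\<^bsub>?FA\<^esub> z = trA \<cdot>\<^bsub>?FA\<^esub> bang ?FA w A.unit"
          using pair(4)[OF kz A.FC.cmp_hom[OF bw trA(1)]] al_kz be_kz tr_true[OF bw] tr_M[OF bw] by simp
        then show "\<exists>h\<in>hom ?FA w SA. mA \<cdot>\<^bsub>?FA\<^esub> h = z"
          using A.FC.pullback_lift[OF pbA, of z w "bang ?FA w A.unit"] z bw
            A.FC.homD(2)[OF mA] A.FC.homD(2)[OF kA2] A.FC.homD(2)[OF trA(1)] by metis
      qed
      then have "a = a2" unfolding a_def by (rule CA.char_map_eq[OF mA a2])
      then have "kA2 = kA"
        using pair(4)[OF kA2 kA(1)] kA(2,3) be2 unfolding a2_def by simp
      then show "k' = k"
        using nt_eqI_glued[OF k' k] kB_eq k_A k_B unfolding d2 by simp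
    qed
  qed
  then have "subobject_classifier ?FI I.unit OmI trI"
    using I.terminal_fun_cat OmI trI by (simp add: subobject_classifier_def ob_fun_cat)
  moreover have "e \<in> hom ?FA (comp_fctr A OmI bd) (vertex P)" unfolding OmI_A by (rule pair(1))
  moreover have "(pr1 P \<cdot>\<^bsub>?FA\<^esub> e) \<cdot>\<^bsub>?FA\<^esub> whisker A trI bd = CA.true_at A.unit"
    "(pr2 P \<cdot>\<^bsub>?FA\<^esub> e) \<cdot>\<^bsub>?FA\<^esub> whisker A trI bd = Mt trB \<cdot>\<^bsub>?FA\<^esub> bang ?FA A.unit ?M1"
    using trA(2,3) unfolding trI_A al_def be_def .
  ultimately show ?thesis
    using that[OF _ OmI_B trI_B P _ eR _ _ chi] by blast
qed

end

context glued_collage begin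

text \<open>The products \<open>R\<close> and \<open>Q\<close> are arbitrary, whereas \<open>e\<close> was constructed from a chosen product.\<close>

lemma glued_classifier_pointwise:
  assumes P: "is_product (fun_cat A E) Om Y P" and e: "e \<in> hom (fun_cat A E) Z (vertex P)"
    and R: "is_product (fun_cat A E) Om Om R" and mt: "mt \<in> hom (fun_cat A E) (vertex R) Om"
    and chi: "chi \<in> hom (fun_cat A E) Y Om"
    and eq: "is_equaliser (fun_cat A E) e (pr1 P)
      (mt \<cdot>\<^bsub>fun_cat A E\<^esub> pairing (fun_cat A E) R (pr1 P) (chi \<cdot>\<^bsub>fun_cat A E\<^esub> pr2 P))"
    and t: "t \<in> hom (fun_cat A E) A.unit Z"
    and t1: "(pr1 P \<cdot>\<^bsub>fun_cat A E\<^esub> e) \<cdot>\<^bsub>fun_cat A E\<^esub> t = u1 \<cdot>\<^bsub>fun_cat A E\<^esub> bang (fun_cat A E) A.unit T1"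
    and t2: "(pr2 P \<cdot>\<^bsub>fun_cat A E\<^esub> e) \<cdot>\<^bsub>fun_cat A E\<^esub> t = u2 \<cdot>\<^bsub>fun_cat A E\<^esub> bang (fun_cat A E) A.unit T2"
    and T1: "is_terminal (fun_cat A E) T1" and T2: "is_terminal (fun_cat A E) T2"
    and i: "i \<in> ob A" and Q: "is_product E (fob Om i) (fob Y i) Q"
  shows "\<exists>e' \<in> hom E (fob Z i) (vertex Q).
    is_equaliser E e' (pr1 Q) (cpt mt i \<cdot> prod_map E Q (span_at R i) (idt E (fob Om i)) (cpt chi i)) \<and>
    pr1 Q \<cdot> (e' \<cdot> cpt t i) = cpt u1 i \<cdot> bang E pt (fob T1 i) \<and>
    pr2 Q \<cdot> (e' \<cdot> cpt t i) = cpt u2 i \<cdot> bang E pt (fob T2 i)"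
proof -
  note p = A.FC.product_hom[OF P]
  note cp = A.FC.cmp_hom[OF p(2) chi]
  note Pi = A.product_pointwise[OF P i] and Ri = A.product_pointwise[OF R i]
  have pp: "pr1 (span_at P i) = cpt (pr1 P) i" "pr2 (span_at P i) =
    cpt (pr2 P) i" "vertex (span_at P i) = fob (vertex P) i"
    "vertex (span_at R i) = fob (vertex R) i"
    by (simp_all add: span_at_def)
  note p' = nt_cpt[OF p(1) i] nt_cpt[OF p(2) i]
  note q = A.E.product_hom[OF Q]
  \<comment> \<open>The comparison maps between the given product \<open>Q\<close> and the value at
    \<open>i\<close> of the product \<open>P\<close> of functors; they are mutually inverse.\<close>
  let ?s = "pairing E Q (cpt (pr1 P) i) (cpt (pr2 P) i)" and ?r =
    "pairing E (span_at P i) (pr1 Q) (pr2 Q)"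
  note s = A.E.pairing[OF Q p'] and r = A.E.pairing[OF Pi q(1,2), unfolded pp]
  have sr: "?s \<cdot> ?r = idt E (vertex Q)"
  proof -
    have "?s \<cdot> ?r = pairing E Q (pr1 Q) (pr2 Q)"
      unfolding A.E.pairing_cmp[OF Q p' r(1)] r ..
    also have "\<dots> = idt E (vertex Q)"
      by (rule A.E.pairing_eq[OF Q q(1,2) A.E.idt_hom[OF A.E.hom_ob(1)[OF q(1)]] A.E.idt_right[OF q(1)]
        A.E.idt_right[OF q(2)]])
    finally show ?thesis .
  qed
  have rs: "?r \<cdot> ?s = idt E (fob (vertex P) i)"
  proof -
    have "?r \<cdot> ?s = pairing E (span_at P i) (cpt (pr1 P) i) (cpt (pr2 P) i)"
      unfolding A.E.pairing_cmp[OF Pi q(1,2) s(1)] s ..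
    also have "\<dots> = idt E (fob (vertex P) i)"
      using A.E.idt_hom[OF A.E.hom_ob(1)[OF p'(1)]] A.E.idt_right[OF p'(1)] A.E.idt_right[OF p'(2)]
      by (intro A.E.pairing_eq[OF Pi p']) (simp_all add: pp)
    finally show ?thesis .
  qed
  note ei = nt_cpt[OF e i] and ti = nt_cpt[OF t i] and mi = nt_cpt[OF mt i] and ci = nt_cpt[OF chi i]
  have te: "tgt E (cpt e i) = fob (vertex P) i" by (rule A.E.homD(3)[OF ei])
  have io: "idt E (fob Om i) \<cdot> pr1 Q = pr1 Q" by (rule A.E.idt_left[OF q(1)])
  note cq = A.E.cmp_hom[OF q(2) ci]
  let ?pm = "prod_map E Q (span_at R i) (idt E (fob Om i)) (cpt chi i)"
  have pm: "?pm \<in> hom E (vertex Q) (fob (vertex R) i)"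
    unfolding prod_map_def io using A.E.pairing_hom[OF Ri q(1) cq] unfolding pp .
  \<comment> \<open>Seen through the comparison, \<open>prod_map\<close> becomes the pairing that
    occurs in the equaliser of functors.\<close>
  have "?pm \<cdot> ?s = pairing E (span_at R i) (cpt (pr1 P) i) (cpt chi i \<cdot> cpt (pr2 P) i)"
    unfolding prod_map_def io A.E.pairing_cmp[OF Ri q(1) cq s(1)] using s A.E.assoc[OF s(1) q(2) ci]
      by simp
  also have "\<dots> = cpt (pairing (fun_cat A E) R (pr1 P) (chi \<cdot>\<^bsub>fun_cat A E\<^esub> pr2 P)) i"
    using A.pairing_pointwise[OF R p(1) cp i] i by simp
  finally have pms: "(cpt mt i \<cdot> ?pm) \<cdot> ?s =
      cpt (mt \<cdot>\<^bsub>fun_cat A E\<^esub> pairing (fun_cat A E) R (pr1 P) (chi \<cdot>\<^bsub>fun_cat A E\<^esub> pr2 P)) i"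
    using A.E.assoc[OF s(1) pm mi] i by simp
  have "is_equaliser E (?s \<cdot> cpt e i) (pr1 Q) (cpt mt i \<cdot> ?pm)"
    by (rule A.E.equaliser_iso[OF A.equaliser_pointwise[OF eq i], unfolded te, OF s(1) r(1) sr rs q(1)
      A.E.cmp_hom[OF pm mi] s(2) pms])
  moreover have "pr1 Q \<cdot> ((?s \<cdot> cpt e i) \<cdot> cpt t i) = cpt u1 i \<cdot> bang E pt (fob T1 i)"
    "pr2 Q \<cdot> ((?s \<cdot> cpt e i) \<cdot> cpt t i) = cpt u2 i \<cdot> bang E pt (fob T2 i)"
  proof -
    have U: "A.unit \<in> ob (fun_cat A E)" using A.terminal_fun_cat by (simp add: is_terminal_def)
    \<comment> \<open>Terminal functors are terminal at each object, so evaluating the unique map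
      into one yields the unique map in \<open>E\<close>.\<close>
    have b: "cpt (bang (fun_cat A E) A.unit T) i = bang E pt (fob T i)" if "is_terminal (fun_cat A E) T"
      for T
      using A.E.bang_eq[OF A.terminal_pointwise[OF that i]] nt_cpt[OF A.FC.bang_hom[OF that U] i] i
        by simp
    have x: "pr \<cdot> ((?s \<cdot> cpt e i) \<cdot> cpt t i) = ((pr \<cdot> ?s) \<cdot> cpt e i) \<cdot> cpt t i"
      if pr: "pr \<in> hom E (vertex Q) z" for pr z
      using A.E.assoc[OF ti A.E.cmp_hom[OF ei s(1)] pr] A.E.assoc[OF ei s(1) pr] by simp
    show "pr1 Q \<cdot> ((?s \<cdot> cpt e i) \<cdot> cpt t i) = cpt u1 i \<cdot> bang E pt (fob T1 i)"
      unfolding x[OF q(1)] s using arg_cong[OF t1, of "\<lambda>t. cpt t i"] i b[OF T1] by simp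
    show "pr2 Q \<cdot> ((?s \<cdot> cpt e i) \<cdot> cpt t i) = cpt u2 i \<cdot> bang E pt (fob T2 i)"
      unfolding x[OF q(2)] s using arg_cong[OF t2, of "\<lambda>t. cpt t i"] i b[OF T2] by simp
  qed
  ultimately show ?thesis using A.E.cmp_hom[OF ei s(1)] by blast
qed

end

section \<open>Iterated gluing\<close>

lemma category_op_cat:
  assumes "category C"
  shows "category (op_cat C)"
proof -
  interpret C: category C by fact
  have h: "f \<in> hom (op_cat C) x y \<longleftrightarrow> f \<in> hom C y x" for f x y by (auto simp: hom_def op_cat_def)
  have c: "g \<cdot>\<^bsub>op_cat C\<^esub> f = f \<cdot>\<^bsub>C\<^esub> g" "idt (op_cat C) = idt C" "ob (op_cat C) = ob C" "ar (op_cat C) =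
    ar C"
    "src (op_cat C) = tgt C" "tgt (op_cat C) = src C" for f g by (simp_all add: op_cat_def)
  show ?thesis
    by unfold_locales
      (auto simp: h c C.src_ob C.tgt_ob C.idt_hom C.idt_left C.idt_right C.assoc intro: C.cmp_hom)
qed

lemma category_full_subcat:
  assumes "category C"
  shows "category (full_subcat C S)"
proof -
  interpret C: category C by fact
  have h: "f \<in> hom (full_subcat C S) x y \<longleftrightarrow> f \<in> hom C x y \<and> x \<in> S \<and> y \<in> S" for f x y
    by (auto simp: hom_def full_subcat_def)
  have c: "g \<cdot>\<^bsub>full_subcat C S\<^esub> f = g \<cdot>\<^bsub>C\<^esub> f" "idt (full_subcat C S) = idt C" "ob (full_subcat C S) =
    ob C \<inter> S"
    "src (full_subcat C S) = src C" "tgt (full_subcat C S) = tgt C"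
    "ar (full_subcat C S) = {f \<in> ar C. src C f \<in> S \<and> tgt C f \<in> S}" for f g
    by (simp_all add: full_subcat_def)
  show ?thesis
    by unfold_locales
      (auto simp: h c C.src_ob C.tgt_ob C.idt_hom C.idt_left C.idt_right C.assoc intro: C.cmp_hom)
qed

lemma category_coslice:
  assumes "category C"
  shows "category (coslice C x)"
proof -
  interpret C: category C by fact
  have h: "a \<in> hom (coslice C x) f g \<longleftrightarrow>
      (\<exists>h. a = (f, h, g) \<and> f \<in> hom C x (tgt C f) \<and> h \<in> hom C (tgt C f) (tgt C h) \<and> g = h \<cdot>\<^bsub>C\<^esub> f)"
        for a f g
    by (auto simp: hom_def coslice_def)
  have o: "f \<in> ob (coslice C x) \<longleftrightarrow> f \<in> hom C x (tgt C f)" for f by (auto simp: coslice_def hom_def)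
  have c: "(g, k, g') \<cdot>\<^bsub>coslice C x\<^esub> (f, h, g) = (f, k \<cdot>\<^bsub>C\<^esub> h, g')"
    "idt (coslice C x) f = (f, idt C (tgt C f), f)" for f g h k g' by (simp_all add: coslice_def)
  show ?thesis
  proof
    fix a assume "a \<in> ar (coslice C x)"
    then have "a \<in> hom (coslice C x) (src (coslice C x) a) (tgt (coslice C x) a)" by (simp add: hom_def)
    then obtain f h where a: "src (coslice C x) a = f" "tgt (coslice C x) a = h \<cdot>\<^bsub>C\<^esub> f"
      and fh: "f \<in> hom C x (tgt C f)" "h \<in> hom C (tgt C f) (tgt C h)" unfolding h by blast
    show "src (coslice C x) a \<in> ob (coslice C x)" "tgt (coslice C x) a \<in> ob (coslice C x)"
      unfolding a o using fh C.cmp_hom[OF fh] C.homD(3)[OF C.cmp_hom[OF fh]] by simp_all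
  next
    fix f assume "f \<in> ob (coslice C x)"
    then have f: "f \<in> hom C x (tgt C f)" by (simp add: o)
    note i = C.idt_hom[OF C.hom_ob(2)[OF f]]
    show "idt (coslice C x) f \<in> hom (coslice C x) f f"
      unfolding h c using f i C.idt_left[OF f] C.homD(3)[OF i] by simp
  next
    fix a b f g g' assume a: "a \<in> hom (coslice C x) f g" and b: "b \<in> hom (coslice C x) g g'"
    obtain h1 where h1: "a = (f, h1, g)" "f \<in> hom C x (tgt C f)" "h1 \<in> hom C (tgt C f) (tgt C h1)" "g =
      h1 \<cdot>\<^bsub>C\<^esub> f"
      using a unfolding h by blast
    obtain h2 where h2: "b = (g, h2, g')" "h2 \<in> hom C (tgt C g) (tgt C h2)" "g' = h2 \<cdot>\<^bsub>C\<^esub> g"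
      using b unfolding h by blast
    have "tgt C g = tgt C h1" using C.homD(3)[OF C.cmp_hom[OF h1(2,3)]] h1(4) by simp
    then have h2': "h2 \<in> hom C (tgt C h1) (tgt C h2)" using h2 by simp
    show "b \<cdot>\<^bsub>coslice C x\<^esub> a \<in> hom (coslice C x) f g'"
      unfolding h h1(1) h2(1) c
      using h1 h2 C.cmp_hom[OF h1(3) h2'] C.homD(3)[OF C.cmp_hom[OF h1(3) h2']] C.assoc[OF h1(2,3) h2']
        by simp
  next
    fix a f g assume a: "a \<in> hom (coslice C x) f g"
    obtain h1 where h1: "a = (f, h1, g)" "f \<in> hom C x (tgt C f)" "h1 \<in> hom C (tgt C f) (tgt C h1)" "g =
      h1 \<cdot>\<^bsub>C\<^esub> f"
      using a unfolding h by blast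
    have "tgt C g = tgt C h1" using C.homD(3)[OF C.cmp_hom[OF h1(2,3)]] h1(4) by simp
    then show "idt (coslice C x) g \<cdot>\<^bsub>coslice C x\<^esub> a = a" unfolding h1(1) c using C.idt_left[OF h1(3)]
      by simp
    show "a \<cdot>\<^bsub>coslice C x\<^esub> idt (coslice C x) f = a" unfolding h1(1) c using C.idt_right[OF h1(3)]
      by simp
  next
    fix a b d f g g' g'' assume a: "a \<in> hom (coslice C x) f g" and b: "b \<in> hom (coslice C x) g g'"
      and d: "d \<in> hom (coslice C x) g' g''"
    obtain h1 where h1: "a = (f, h1, g)" "f \<in> hom C x (tgt C f)" "h1 \<in> hom C (tgt C f) (tgt C h1)" "g =
      h1 \<cdot>\<^bsub>C\<^esub> f"
      using a unfolding h by blast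
    obtain h2 where h2: "b = (g, h2, g')" "g \<in> hom C x (tgt C g)" "h2 \<in> hom C (tgt C g) (tgt C h2)"
      "g' = h2 \<cdot>\<^bsub>C\<^esub> g"
      using b unfolding h by blast
    obtain h3 where h3: "d = (g', h3, g'')" "h3 \<in> hom C (tgt C g') (tgt C h3)"
      using d unfolding h by blast
    have "tgt C g = tgt C h1" "tgt C g' = tgt C h2"
      using C.homD(3)[OF C.cmp_hom[OF h1(2,3)]] h1(4) C.homD(3)[OF C.cmp_hom[OF h2(2,3)]] h2(4)
        by simp_all
    then have "(h3 \<cdot>\<^bsub>C\<^esub> h2) \<cdot>\<^bsub>C\<^esub> h1 = h3 \<cdot>\<^bsub>C\<^esub> h2 \<cdot>\<^bsub>C\<^esub> h1"
      using C.assoc[of h1 "tgt C f" "tgt C h1" h2 "tgt C h2" h3 "tgt C h3"] h1 h2 h3 by simp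
    then show "(d \<cdot>\<^bsub>coslice C x\<^esub> b) \<cdot>\<^bsub>coslice C x\<^esub> a = d \<cdot>\<^bsub>coslice C x\<^esub> b \<cdot>\<^bsub>coslice C x\<^esub> a"
      unfolding h1(1) h2(1) h3(1) c by simp
  qed
qed

section \<open>The recursion on the degree\<close>

locale gluing_diagram = E: finitely_complete E pt for E :: "('p, 'b) cat" (structure) and pt +
  fixes G :: "('n, 'm, 'o, 'a, 'd, 'e, 'u) gluing"
    and l :: "('n, 'm, 'o, 'a, 'd, 'u, 'p, 'b) gluing_lims"
    and one Om :: "'n \<Rightarrow> ('d, 'e, 'p, 'b) fctr"
    and tr :: "'n \<Rightarrow> ('d, 'e, 'p, 'b) ntrans"
  assumes gluing: "iterated_gluing G"
    and lims: "\<And>n i. \<lbrakk>n \<in> ob (idx G); i \<in> ob (bdry G n)\<rbrakk> \<Longrightarrow>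
      limit_choice (gluing_elements G n i) E (l n i)"
    and classifiers: "\<And>n. n \<in> ob (idx G) \<Longrightarrow> subobject_classifier (fun_cat (bdry G n) E) (one n) (Om n)
      (tr n)"
begin

abbreviation "N \<equiv> idx G"

abbreviation const :: "('x, 'y) cat \<Rightarrow> ('x, 'y, 'p, 'b) fctr" where
  "const C \<equiv> const_fctr C E pt"

text \<open>The formula of the theorem phrased for a functor on \<open>cats G n\<close> instead of
  the glued category, so that it can be established as soon as stage \<open>n\<close> exists. The
  terminal functor of the glued category restricts to the constant functor \<open>const B\<close>
  appearing here.\<close>

definition boundary_formula :: "'n \<Rightarrow> ('o, 'a, 'p, 'b) fctr \<Rightarrow> ('o, 'a, 'p, 'b) ntrans \<Rightarrow> bool" where
  "boundary_formula n X t \<longleftrightarrow> (\<forall>i \<in> ob (bdry G n).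
    let A = bdry G n; B = below G n; W = prof G n; En = fun_cat A E;
        M1 = matching_ob A B W E (l n) (const B);
        MOm = matching_ob A B W E (l n) (comp_fctr B X (below_incl G n));
        Mtr = matching_ar A B W E (l n) (whisker B t (below_incl G n));
        chi = char_map En (one n) (Om n) (tr n) (Mtr \<cdot>\<^bsub>En\<^esub> bang En (one n) M1);
        x = fob (bdry_incl G n) i
    in \<forall>R Q. is_product En (Om n) (Om n) R \<longrightarrow> is_product E (fob (Om n) i) (fob MOm i) Q \<longrightarrow>
      (\<exists>e \<in> hom E (fob X x) (vertex Q).
         is_equaliser E e (pr1 Q)
           (cpt (meet En (one n) (Om n) (tr n) R) i \<cdot>
            prod_map E Q (span_at R i) (idt E (fob (Om n) i)) (cpt chi i)) \<and>
         pr1 Q \<cdot> (e \<cdot> cpt t x) = cpt (tr n) i \<cdot> bang E pt (fob (one n) i) \<and>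
         pr2 Q \<cdot> (e \<cdot> cpt t x) = cpt Mtr i \<cdot> bang E pt (fob M1 i)))"

text \<open>Here \<open>f\<close> records the earlier stages and \<open>r\<close> is a candidate for
  stage \<open>n\<close>. Only proper arrows out of \<open>n\<close> are consulted, and their
  targets have smaller degree, so the condition depends on \<open>f\<close> below \<open>n\<close>
  alone. Outside the objects of \<open>N\<close> it is vacuous, which lets \<open>f\<close> be
  total.\<close>

definition stage :: "('n \<Rightarrow> ('o, 'a, 'p, 'b) fctr \<times> ('o, 'a, 'p, 'b) ntrans) \<Rightarrow> 'n
    \<Rightarrow> ('o, 'a, 'p, 'b) fctr \<times> ('o, 'a, 'p, 'b) ntrans \<Rightarrow> bool" where
  "stage f n r \<longleftrightarrow> (n \<in> ob N \<longrightarrow>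
     subobject_classifier (fun_cat (cats G n) E) (const (cats G n)) (fst r) (snd r) \<and>
     boundary_formula n (fst r) (snd r) \<and>
     (\<forall>a \<in> ob (punctured_coslice N n).
        comp_fctr (cats G (tgt N a)) (fst r) (tran G a) = fst (f (tgt N a)) \<and>
        whisker (cats G (tgt N a)) (snd r) (tran G a) = snd (f (tgt N a))))"

lemma N: "category N"
  using gluing by (simp add: iterated_gluing_def strict_inverse_category_def)

sublocale N: category N by (rule N)

lemma deg_less: "\<lbrakk>a \<in> ar N; a \<noteq> idt N (src N a)\<rbrakk> \<Longrightarrow> deg G (tgt N a) < deg G (src N a)"
  using gluing by (auto simp: iterated_gluing_def strict_inverse_category_def)

lemma op_diagram: "is_cat_diagram (op_cat N) (cats G) (tran G)"
  using gluing by (simp add: iterated_gluing_def)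

lemma cats: "n \<in> ob N \<Longrightarrow> category (cats G n)"
  and tran: "a \<in> hom N n n' \<Longrightarrow> is_functor (cats G n') (cats G n) (tran G a)"
  and tran_idt: "n \<in> ob N \<Longrightarrow> tran G (idt N n) = id_fctr (cats G n)"
  and tran_cmp: "\<lbrakk>a \<in> hom N n n'; b \<in> hom N n' n''\<rbrakk> \<Longrightarrow>
    tran G (b \<cdot>\<^bsub>N\<^esub> a) = comp_fctr (cats G n'') (tran G a) (tran G b)"
  using op_diagram by (auto simp: is_cat_diagram_def op_cat_def hom_def)

lemma ob_punctured_coslice: "a \<in> ob (punctured_coslice N n) \<longleftrightarrow> a \<in> ar N \<and> src N a = n \<and> a \<noteq> idt N n"
  by (auto simp: punctured_coslice_def full_subcat_def coslice_def)

lemma ar_punctured_coslice: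
  assumes "x \<in> ar (punctured_coslice N n)"
  obtains a b where "x = (a, b, b \<cdot>\<^bsub>N\<^esub> a)" "a \<in> ob (punctured_coslice N n)"
    "b \<in> hom N (tgt N a) (tgt N (b \<cdot>\<^bsub>N\<^esub> a))" "b \<cdot>\<^bsub>N\<^esub> a \<in> ob (punctured_coslice N n)"
proof -
  obtain a b where x: "x = (a, b, b \<cdot>\<^bsub>N\<^esub> a)" and a: "a \<in> ar N" "src N a = n"
    and b: "b \<in> ar N" "src N b = tgt N a"
    and ne: "a \<noteq> idt N n" "b \<cdot>\<^bsub>N\<^esub> a \<noteq> idt N n"
    using assms by (auto simp: punctured_coslice_def full_subcat_def coslice_def)
  have "b \<cdot>\<^bsub>N\<^esub> a \<in> hom N n (tgt N b)" by (rule N.cmp_hom[of a n "tgt N a"])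
    (use a b in \<open>auto simp: hom_def\<close>)
  then show ?thesis using that[OF x] a b ne by (simp add: ob_punctured_coslice) (simp add: hom_def)
qed

lemma comp_fctr_idt: "\<lbrakk>n \<in> ob N; is_functor (cats G n) E X\<rbrakk> \<Longrightarrow>
  comp_fctr (cats G n) X (tran G (idt N n)) = X"
  by (simp add: tran_idt comp_fctr_id_fctr)

lemma whisker_idt:
  assumes n: "n \<in> ob N" and t: "t \<in> hom (fun_cat (cats G n) E) X Y"
  shows "whisker (cats G n) t (tran G (idt N n)) = t"
proof (rule nt_eqI[OF _ t])
  have i: "is_functor (cats G n) (cats G n) (tran G (idt N n))" by (rule tran[OF N.idt_hom[OF n]])
  show "whisker (cats G n) t (tran G (idt N n)) \<in> hom (fun_cat (cats G n) E) X Y"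
    using whisker_hom[OF cats[OF n] i t] comp_fctr_idt[OF n] nt_functor[OF t] by simp
  show "cpt (whisker (cats G n) t (tran G (idt N n))) x = cpt t x" if "x \<in> ob (cats G n)" for x
    using that by (simp add: tran_idt[OF n]) (simp add: id_fctr_def)
qed

abbreviation "index n \<equiv> op_cat (punctured_coslice N n)"
abbreviation "lower_cats a \<equiv> cats G (tgt N a)"
abbreviation "lower_tran \<equiv> \<lambda>(_, b, _). tran G b"

text \<open>A coslice arrow \<open>(a, b, b \<cdot> a)\<close> runs in the opposite index from
  \<open>b \<cdot> a\<close> to \<open>a\<close>, in agreement with the contravariance of
  \<open>tran G b\<close>.\<close>

lemma below_diagram: "cat_diagram (index n) lower_cats lower_tran"
proof -
  have c: "category (punctured_coslice N n)"
    unfolding punctured_coslice_def by (rule category_full_subcat[OF category_coslice[OF N]])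
  have sel: "src (index n) (a, b, c) = c" "tgt (index n) (a, b, c) = a" "idt (index n) a =
    (a, idt N (tgt N a), a)"
    "x \<cdot>\<^bsub>index n\<^esub> y = y \<cdot>\<^bsub>coslice N n\<^esub> x" for a b c x y
    by (simp_all add: op_cat_def punctured_coslice_def full_subcat_def coslice_def)
  have ob: "ob (index n) = ob (punctured_coslice N n)" "ar (index n) = ar (punctured_coslice N n)"
    by (simp_all add: op_cat_def)
  have "is_cat_diagram (index n) lower_cats lower_tran"
    unfolding is_cat_diagram_def ob
  proof (intro conjI ballI impI)
    show "category (lower_cats a)" if "a \<in> ob (punctured_coslice N n)" for a
      using that N.tgt_ob by (intro cats) (simp add: ob_punctured_coslice)
    show "lower_tran (idt (index n) a) = id_fctr (lower_cats a)" if "a \<in> ob (punctured_coslice N n)"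
      for a
      using that N.tgt_ob by (simp add: sel tran_idt ob_punctured_coslice)
    show "is_functor (lower_cats (src (index n) x)) (lower_cats (tgt (index n) x)) (lower_tran x)"
      if "x \<in> ar (punctured_coslice N n)" for x
      using that by (rule ar_punctured_coslice) (simp add: sel tran)
    fix x y assume x: "x \<in> ar (punctured_coslice N n)" and y: "y \<in> ar (punctured_coslice N n)"
      and xy: "src (index n) y = tgt (index n) x"
    obtain a b where ab: "x = (a, b, b \<cdot>\<^bsub>N\<^esub> a)" "b \<in> hom N (tgt N a) (tgt N (b \<cdot>\<^bsub>N\<^esub> a))"
      using x by (rule ar_punctured_coslice)
    obtain a' b' where ab': "y = (a', b', b' \<cdot>\<^bsub>N\<^esub> a')" "b' \<in> hom N (tgt N a') (tgt N (b' \<cdot>\<^bsub>N\<^esub> a'))"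
      using y by (rule ar_punctured_coslice)
    have a: "b' \<cdot>\<^bsub>N\<^esub> a' = a" using xy by (simp add: ab ab' sel)
    have "y \<cdot>\<^bsub>index n\<^esub> x = (a', b \<cdot>\<^bsub>N\<^esub> b', b \<cdot>\<^bsub>N\<^esub> a)" by (simp add: sel ab ab' coslice_def)
    then show "lower_tran (y \<cdot>\<^bsub>index n\<^esub> x) = comp_fctr (lower_cats (src (index n) x)) (lower_tran y)
      (lower_tran x)"
      using tran_cmp[OF ab'(2)[unfolded a] ab(2)] by (simp add: ab ab' sel a)
  qed
  then show ?thesis
    using category_op_cat[OF c] by (simp add: cat_diagram_def cat_diagram_axioms_def)
qed

lemma below_eq: "below G n = colim_cat (index n) lower_cats lower_tran"
  and below_in_eq: "below_in G n = colim_in (index n) lower_cats lower_tran"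
  by (simp_all add: below_def below_in_def)

text \<open>The classifiers at the targets of proper arrows out of \<open>n\<close> glue to one on
  the lower part, which then extends across the boundary of \<open>n\<close>. Strict compatibility
  of the new stage holds because each transition functor into it factors through the lower
  part.\<close>

lemma stage_exists:
  fixes f :: "'n \<Rightarrow> ('o, 'a, 'p, 'b) fctr \<times> ('o, 'a, 'p, 'b) ntrans"
  assumes IH: "\<And>n'. deg G n' < deg G n \<Longrightarrow> stage f n' (f n')"
  shows "\<exists>r. stage f n r"
proof (cases "n \<in> ob N")
  case n: True
  interpret D: cat_diagram "index n" lower_cats lower_tran by (rule below_diagram)
  let ?Om = "\<lambda>a. fst (f (tgt N a))" and ?tr = "\<lambda>a. snd (f (tgt N a))"
  have ob: "ob (index n) = ob (punctured_coslice N n)" "ar (index n) = ar (punctured_coslice N n)"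
    by (simp_all add: op_cat_def)
  have st: "tgt N a \<in> ob N" "stage f (tgt N a) (f (tgt N a))" if "a \<in> ob (punctured_coslice N n)" for a
    using that deg_less[of a] IH N.tgt_ob by (auto simp: ob_punctured_coslice)
  have cl: "subobject_classifier (fun_cat (lower_cats a) E) (const (lower_cats a)) (?Om a) (?tr a)"
    if "a \<in> ob (punctured_coslice N n)" for a
    using st[OF that] by (simp add: stage_def)
  \<comment> \<open>The stage condition covers proper arrows \<open>b\<close> only. When
    \<open>b\<close> is an identity, restriction along it is trivial because \<open>tran G\<close>
    sends identities to identity functors.\<close>
  have compat: "comp_fctr (lower_cats (b \<cdot>\<^bsub>N\<^esub> a)) (?Om a) (tran G b) = ?Om (b \<cdot>\<^bsub>N\<^esub> a) \<and>
      whisker (lower_cats (b \<cdot>\<^bsub>N\<^esub> a)) (?tr a) (tran G b) = ?tr (b \<cdot>\<^bsub>N\<^esub> a)"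
    if a: "a \<in> ob (punctured_coslice N n)" and b: "b \<in> hom N (tgt N a) (tgt N (b \<cdot>\<^bsub>N\<^esub> a))" for a b
  proof (cases "b = idt N (tgt N a)")
    case True
    have t: "tgt N (b \<cdot>\<^bsub>N\<^esub> a) = tgt N a" using N.homD(3)[OF b] N.homD(3)[OF N.idt_hom[OF st(1)[OF a]]]
      True by simp
    have "?Om a \<in> ob (fun_cat (lower_cats a) E)"
      "?tr a \<in> hom (fun_cat (lower_cats a) E) (const (lower_cats a)) (?Om a)"
      using cl[OF a] by (simp_all add: subobject_classifier_def)
    then show ?thesis
      unfolding t using comp_fctr_idt[OF st(1)[OF a]] whisker_idt[OF st(1)[OF a]] True
        by (simp add: ob_fun_cat)
  next
    case False
    then have "b \<in> ob (punctured_coslice N (tgt N a))" using N.homD[OF b]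
      by (simp add: ob_punctured_coslice)
    then show ?thesis using st[OF a] N.homD(3)[OF b] by (auto simp: stage_def)
  qed
  have compat': "comp_fctr (lower_cats (src (index n) x)) (?Om (tgt (index n) x)) (lower_tran x) =
    ?Om (src (index n) x)"
    "whisker (lower_cats (src (index n) x)) (?tr (tgt (index n) x)) (lower_tran x) =
      ?tr (src (index n) x)"
    if x: "x \<in> ar (punctured_coslice N n)" for x
  proof -
    obtain a b where ab: "x = (a, b, b \<cdot>\<^bsub>N\<^esub> a)" "a \<in> ob (punctured_coslice N n)"
      "b \<in> hom N (tgt N a) (tgt N (b \<cdot>\<^bsub>N\<^esub> a))"
      using x by (rule ar_punctured_coslice)
    have st: "src (index n) x = b \<cdot>\<^bsub>N\<^esub> a" "tgt (index n) x = a" "lower_tran x = tran G b"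
      by (simp_all add: ab op_cat_def punctured_coslice_def full_subcat_def coslice_def)
    show "comp_fctr (lower_cats (src (index n) x)) (?Om (tgt (index n) x)) (lower_tran x) =
      ?Om (src (index n) x)"
      "whisker (lower_cats (src (index n) x)) (?tr (tgt (index n) x)) (lower_tran x) =
        ?tr (src (index n) x)"
      unfolding st using compat[OF ab(2,3)] by blast+
  qed
  \<comment> \<open>The classifier on the lower part, as a colimit of those at the lower
    stages.\<close>
  obtain OmB trB where clB: "subobject_classifier (fun_cat (below G n) E) (const (below G n)) OmB trB"
    and OmB_in: "\<And>a. a \<in> ob (punctured_coslice N n) \<Longrightarrow>
      comp_fctr (lower_cats a) OmB (below_in G n a) = ?Om a"
    and trB_in: "\<And>a. a \<in> ob (punctured_coslice N n) \<Longrightarrow>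
      whisker (lower_cats a) trB (below_in G n a) = ?tr a"
    unfolding below_eq below_in_eq
    by (rule D.colim_classifier[OF E.finitely_complete_axioms, of ?Om ?tr, unfolded ob, OF cl compat'],
      assumption+,
        rule that[unfolded below_eq below_in_eq])
  note gl = gluing[unfolded iterated_gluing_def, THEN conjunct2, THEN conjunct2, rule_format, OF n]
  have B: "category (below G n)" unfolding below_eq by (rule D.L.category_axioms)
  have A: "category (bdry G n)" using gl by blast
  interpret glued_collage "bdry G n" "below G n" E pt "prof G n" "l n" "cats G n" "glue G n"
    using A B cats[OF n] gl lims[OF n] E.finitely_complete_axioms
    by (simp add: glued_collage_def glued_collage_axioms_def matching_def matching_axioms_def
      complete_functor_category_def)
  have base: "below_incl G n = base" and bd: "bdry_incl G n = bd"
    by (simp_all add: below_incl_def bdry_incl_def)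
  let ?A = "fun_cat (bdry G n) E"
  let ?chi = "char_map ?A (one n) (Om n) (tr n) (Mt trB \<cdot>\<^bsub>?A\<^esub> bang ?A (one n) (M B.unit))"
  obtain OmI trI e P where I: "subobject_classifier (fun_cat (cats G n) E) I.unit OmI trI"
    and OmI_B: "comp_fctr (below G n) OmI base = OmB" and trI_B: "whisker (below G n) trI base = trB"
    and P: "is_product ?A (Om n) (M OmB) P" and e: "e \<in> hom ?A (comp_fctr (bdry G n) OmI bd) (vertex P)"
    and eq: "\<And>R. is_product ?A (Om n) (Om n) R \<Longrightarrow> is_equaliser ?A e (pr1 P)
      (meet ?A (one n) (Om n) (tr n) R \<cdot>\<^bsub>?A\<^esub> pairing ?A R (pr1 P) (?chi \<cdot>\<^bsub>?A\<^esub> pr2 P))"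
    and t1: "(pr1 P \<cdot>\<^bsub>?A\<^esub> e) \<cdot>\<^bsub>?A\<^esub> whisker (bdry G n) trI bd = tr n \<cdot>\<^bsub>?A\<^esub> bang ?A A.unit (one n)"
    and t2: "(pr2 P \<cdot>\<^bsub>?A\<^esub> e) \<cdot>\<^bsub>?A\<^esub> whisker (bdry G n) trI bd = Mt trB \<cdot>\<^bsub>?A\<^esub> bang ?A A.unit (M B.unit)"
    and chi: "?chi \<in> hom ?A (M OmB) (Om n)"
    by (rule glued_classifier[OF clB classifiers[OF n]]) (rule that)
  interpret CA: category_with_classifier ?A "one n" "Om n" "tr n"
    by unfold_locales (rule classifiers[OF n])
  have trI: "trI \<in> hom (fun_cat (cats G n) E) I.unit OmI" using I
    by (simp add: subobject_classifier_def)
  have t: "whisker (bdry G n) trI bd \<in> hom ?A A.unit (comp_fctr (bdry G n) OmI bd)"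
    using whisker_hom[OF A functor_bd trI] unfolding comp_const_fctr[OF functor_bd] .
  have "boundary_formula n OmI trI"
    unfolding boundary_formula_def Let_def base bd OmI_B trI_B
  proof (intro ballI allI impI)
    fix i R Q assume i: "i \<in> ob (bdry G n)" and R: "is_product ?A (Om n) (Om n) R"
      and Q: "is_product E (fob (Om n) i) (fob (M OmB) i) Q"
    have x: "fob OmI (fob bd i) = fob (comp_fctr (bdry G n) OmI bd) i" "cpt trI (fob bd i) =
      cpt (whisker (bdry G n) trI bd) i"
      using i by (simp_all del: fob_comp_fctr add: fob_comp_fctr[of i "bdry G n" OmI])
    show "\<exists>e\<in>hom E (fob OmI (fob bd i)) (vertex Q).
        is_equaliser E e (pr1 Q) (cpt (meet ?A (one n) (Om n) (tr n) R) i \<cdot>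
          prod_map E Q (span_at R i) (idt E (fob (Om n) i)) (cpt ?chi i)) \<and>
        pr1 Q \<cdot> e \<cdot> cpt trI (fob bd i) = cpt (tr n) i \<cdot> bang E pt (fob (one n) i) \<and>
        pr2 Q \<cdot> e \<cdot> cpt trI (fob bd i) = cpt (Mt trB) i \<cdot> bang E pt (fob (M B.unit) i)"
      unfolding x
      by (rule glued_classifier_pointwise[OF P e R CA.meet_hom[OF R] chi eq[OF R]
        t t1 t2 CA.one terminal_M i Q])
  qed
  \<comment> \<open>By the definition of an iterated gluing diagram, \<open>tran G a\<close> is the
    inclusion of the lower part after the colimit inclusion at \<open>a\<close>. Restricting along
    the former gives \<open>OmB\<close>, and along the latter the stage at the target of
    \<open>a\<close>.\<close>
  moreover have "comp_fctr (lower_cats a) OmI (tran G a) = ?Om a \<and>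
    whisker (lower_cats a) trI (tran G a) = ?tr a"
    if a: "a \<in> ob (punctured_coslice N n)" for a
  proof -
    have c: "category (lower_cats a)" using cats st(1)[OF a] .
    have i: "is_functor (lower_cats a) (below G n) (below_in G n a)"
      using D.inc[of a] a unfolding below_eq below_in_eq ob by blast
    have "tran G a = comp_fctr (lower_cats a) (below_incl G n) (below_in G n a)" using gl a by simp
    then show ?thesis
      using comp_fctr_assoc[OF c i, of OmI base] whisker_comp[OF c i, of trI base] OmB_in[OF a]
        trB_in[OF a]
      unfolding base OmI_B trI_B by simp
  qed
  ultimately have "stage f n (OmI, trI)" using I by (simp add: stage_def)
  then show ?thesis by blast
qed (simp add: stage_def)

text \<open>Each stage is known only to exist, so the family is obtained by dependent choice along
  the degree.\<close>

lemma stages_exist: "\<exists>f. \<forall>n. stage f n (f n)"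
proof (rule dependent_wf_choice[of "measure (deg G)"])
  \<comment> \<open>The locality condition of the recursion: functions agreeing in smaller degrees
    give the same stage condition at \<open>n\<close>.\<close>
  fix f g :: "'n \<Rightarrow> ('o, 'a, 'p, 'b) fctr \<times> ('o, 'a, 'p, 'b) ntrans" and n r
  assume "\<And>z. (z, n) \<in> measure (deg G) \<Longrightarrow> f z = g z"
  then have "f (tgt N a) = g (tgt N a)" if "a \<in> ob (punctured_coslice N n)" for a
    using that deg_less[of a] by (auto simp: ob_punctured_coslice)
  then show "stage f n r = stage g n r" by (simp add: stage_def)
next
  fix n and f :: "'n \<Rightarrow> ('o, 'a, 'p, 'b) fctr \<times> ('o, 'a, 'p, 'b) ntrans"
  assume "\<And>y. (y, n) \<in> measure (deg G) \<Longrightarrow> stage f y (f y)"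
  then show "\<exists>r. stage f n r" using stage_exists by simp
qed simp

lemma glued_eq: "glued G = colim_cat (op_cat N) (cats G) (tran G)"
  and glued_in_eq: "glued_in G = colim_in (op_cat N) (cats G) (tran G)"
  by (simp_all add: glued_def glued_in_def)

text \<open>The stages now cover all of \<open>N\<close>, so their classifiers glue once more. As
  the glued classifier restricts exactly to stage \<open>n\<close>, the boundary formula proved
  there holds for its restriction.\<close>

theorem glued_category_classifier:
  obtains X t where "subobject_classifier (fun_cat (glued G) E) (const (glued G)) X t"
    "\<And>n. n \<in> ob N \<Longrightarrow> boundary_formula n (comp_fctr (cats G n) X (glued_in G n)) (whisker (cats G n) t
      (glued_in G n))"
proof -
  obtain f where f: "\<And>n. stage f n (f n)" using stages_exist by blast
  interpret D: cat_diagram "op_cat N" "cats G" "tran G"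
    using category_op_cat[OF N] op_diagram by (simp add: cat_diagram_def cat_diagram_axioms_def)
  have sel: "ob (op_cat N) = ob N" "ar (op_cat N) = ar N" "src (op_cat N) = tgt N" "tgt (op_cat N) =
    src N"
    by (simp_all add: op_cat_def)
  have cl: "subobject_classifier (fun_cat (cats G n) E) (const (cats G n)) (fst (f n)) (snd (f n))"
    if "n \<in> ob N" for n
    using f[of n] that by (simp add: stage_def)
  \<comment> \<open>As within a stage, identities are treated apart because a stage only speaks of
    proper arrows.\<close>
  have compat: "comp_fctr (cats G (tgt N a)) (fst (f (src N a))) (tran G a) = fst (f (tgt N a)) \<and>
      whisker (cats G (tgt N a)) (snd (f (src N a))) (tran G a) = snd (f (tgt N a))" if a: "a \<in> ar N"
        for a
  proof (cases "a = idt N (src N a)")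
    case True
    note s = N.src_ob[OF a]
    have t: "tgt N a = src N a" using N.homD(3)[OF N.idt_hom[OF s]] True by simp
    have tr: "tran G a = tran G (idt N (src N a))" using True by simp
    have "fst (f (src N a)) \<in> ob (fun_cat (cats G (src N a)) E)"
      "snd (f (src N a)) \<in> hom (fun_cat (cats G (src N a)) E) (const (cats G (src N a))) (fst (f
        (src N a)))"
      using cl[OF s] by (simp_all add: subobject_classifier_def)
    then show ?thesis
      unfolding t tr using comp_fctr_idt[OF s] whisker_idt[OF s] by (simp add: ob_fun_cat)
  next
    case False
    then have "a \<in> ob (punctured_coslice N (src N a))" using a by (simp add: ob_punctured_coslice)
    then show ?thesis using f[of "src N a"] N.src_ob[OF a] by (simp add: stage_def)
  qed
  obtain X t where X: "subobject_classifier (fun_cat (glued G) E) (const (glued G)) X t"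
    and X_in: "\<And>n. n \<in> ob N \<Longrightarrow> comp_fctr (cats G n) X (glued_in G n) = fst (f n)"
    and t_in: "\<And>n. n \<in> ob N \<Longrightarrow> whisker (cats G n) t (glued_in G n) = snd (f n)"
    unfolding glued_eq glued_in_eq
    by (rule D.colim_classifier[OF E.finitely_complete_axioms, of "\<lambda>n. fst (f n)"
      "\<lambda>n. snd (f n)", unfolded sel,
          OF cl compat[THEN conjunct1] compat[THEN conjunct2]], assumption+,
        rule that[unfolded glued_eq glued_in_eq])
  show ?thesis
  proof (rule that[OF X])
    fix n assume n: "n \<in> ob N"
    show "boundary_formula n (comp_fctr (cats G n) X (glued_in G n)) (whisker (cats G n) t
      (glued_in G n))"
      using f[of n] n unfolding X_in[OF n] t_in[OF n] by (simp add: stage_def)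
  qed
qed

end

theorem theorem5p2:
  fixes G :: "('n, 'm, 'o, 'a, 'd, 'e, 'u) gluing"
    and E :: "('p, 'b) cat"
    and l :: "('n, 'm, 'o, 'a, 'd, 'u, 'p, 'b) gluing_lims"
    and one Om :: "'n \<Rightarrow> ('d, 'e, 'p, 'b) fctr"
    and tr :: "'n \<Rightarrow> ('d, 'e, 'p, 'b) ntrans"
  assumes "iterated_gluing G"
    and "category E"
    and "\<And>n i. \<lbrakk>n \<in> ob (idx G); i \<in> ob (bdry G n)\<rbrakk> \<Longrightarrow> limit_choice (gluing_elements G n i) E (l n i)"
    and "has_finite_limits E"
    and "\<And>n. n \<in> ob (idx G) \<Longrightarrow> subobject_classifier (fun_cat (bdry G n) E) (one n) (Om n) (tr n)"
  shows "\<exists>one_inf Om_inf tr_inf.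
    subobject_classifier (fun_cat (glued G) E) one_inf Om_inf tr_inf \<and>
    (\<forall>n \<in> ob (idx G). \<forall>i \<in> ob (bdry G n).
      let En = fun_cat (bdry G n) E;
          M1 = Match_ob G E l n one_inf;
          MOm = Match_ob G E l n Om_inf;
          Mtr = Match_ar G E l n tr_inf;
          chi = char_map En (one n) (Om n) (tr n) (Mtr \<cdot>\<^bsub>En\<^esub> bang En (one n) M1)
      in \<forall>R Q. is_product En (Om n) (Om n) R \<longrightarrow>
               is_product E (fob (Om n) i) (fob MOm i) Q \<longrightarrow>
        (\<exists>e \<in> hom E (fob Om_inf (bdry_pt G n i)) (vertex Q).
           is_equaliser E e (pr1 Q)
             (cpt (meet En (one n) (Om n) (tr n) R) i \<cdot>\<^bsub>E\<^esub>
              prod_map E Q (span_at R i) (idt E (fob (Om n) i)) (cpt chi i)) \<and>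
           pr1 Q \<cdot>\<^bsub>E\<^esub> (e \<cdot>\<^bsub>E\<^esub> cpt tr_inf (bdry_pt G n i)) =
             cpt (tr n) i \<cdot>\<^bsub>E\<^esub> bang E (fob one_inf (bdry_pt G n i)) (fob (one n) i) \<and>
           pr2 Q \<cdot>\<^bsub>E\<^esub> (e \<cdot>\<^bsub>E\<^esub> cpt tr_inf (bdry_pt G n i)) =
             cpt Mtr i \<cdot>\<^bsub>E\<^esub> bang E (fob one_inf (bdry_pt G n i)) (fob M1 i)))"
proof -
  obtain pt where "finitely_complete E pt"
    by (rule finitely_complete_if_finite_limits[OF assms(2,4)])
  then interpret gluing_diagram E pt G l one Om tr
    using assms(1,3,5) by (simp add: gluing_diagram_def gluing_diagram_axioms_def)
  obtain X t where X: "subobject_classifier (fun_cat (glued G) E) (const (glued G)) X t"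
    and formula: "\<And>n. n \<in> ob N \<Longrightarrow>
      boundary_formula n (comp_fctr (cats G n) X (glued_in G n)) (whisker (cats G n) t (glued_in G n))"
    by (rule glued_category_classifier) (rule that)
  \<comment> \<open>Restricting along \<open>below_glued\<close> is restricting to
    \<open>cats G n\<close> and then along \<open>below_incl\<close>, so the matching objects of the
    glued classifier are the ones in \<open>boundary_formula\<close>. Its value at the point of
    \<open>i\<close> is likewise the value of the restriction.\<close>
  have Match: "Match_ob G E l n (const (glued G)) =
    matching_ob (bdry G n) (below G n) (prof G n) E (l n) (const (below G n))"
    "Match_ob G E l n X = matching_ob (bdry G n) (below G n) (prof G n) E (l n)
      (comp_fctr (below G n) (comp_fctr (cats G n) X (glued_in G n)) (below_incl G n))"
    "Match_ar G E l n t = matching_ar (bdry G n) (below G n) (prof G n) E (l n)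
      (whisker (below G n) (whisker (cats G n) t (glued_in G n)) (below_incl G n))"
    and pt: "\<And>i. i \<in> ob (bdry G n) \<Longrightarrow>
      fob X (bdry_pt G n i) = fob (comp_fctr (cats G n) X (glued_in G n)) (fob (bdry_incl G n) i) \<and>
      cpt t (bdry_pt G n i) = cpt (whisker (cats G n) t (glued_in G n)) (fob (bdry_incl G n) i) \<and>
      fob (const (glued G)) (bdry_pt G n i) = pt"
    if n: "n \<in> ob N" for n
  proof -
    interpret D: cat_diagram "op_cat N" "cats G" "tran G"
      using category_op_cat[OF N] op_diagram by (simp add: cat_diagram_def cat_diagram_axioms_def)
    interpret B: cat_diagram "index n" lower_cats lower_tran by (rule below_diagram)
    have gi: "is_functor (cats G n) (glued G) (glued_in G n)"
      using D.inc[of n] n unfolding glued_eq glued_in_eq by (simp add: op_cat_def)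
    have B: "category (below G n)" unfolding below_eq by (rule B.L.category_axioms)
    note gl = gluing[unfolded iterated_gluing_def, THEN conjunct2, THEN conjunct2, rule_format, OF n]
    interpret glued_collage "bdry G n" "below G n" E pt "prof G n" "l n" "cats G n" "glue G n"
      using gl B cats[OF n] lims[OF n] E.finitely_complete_axioms
      by (simp add: glued_collage_def glued_collage_axioms_def matching_def matching_axioms_def
        complete_functor_category_def)
    have bi: "is_functor (below G n) (cats G n) (below_incl G n)"
      and bd: "is_functor (bdry G n) (cats G n) (bdry_incl G n)"
      using functor_base functor_bd by (simp_all add: below_incl_def bdry_incl_def)
    have bg: "is_functor (below G n) (glued G) (below_glued G n)"
      unfolding below_glued_def by (rule is_functor_comp_fctr[OF B bi gi])
    show "Match_ob G E l n (const (glued G)) =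
      matching_ob (bdry G n) (below G n) (prof G n) E (l n) (const (below G n))"
      by (simp add: Match_ob_def comp_const_fctr[OF bg])
    show "Match_ob G E l n X = matching_ob (bdry G n) (below G n) (prof G n) E (l n)
      (comp_fctr (below G n) (comp_fctr (cats G n) X (glued_in G n)) (below_incl G n))"
      by (simp add: Match_ob_def below_glued_def comp_fctr_assoc[OF B bi])
    show "Match_ar G E l n t = matching_ar (bdry G n) (below G n) (prof G n) E (l n)
      (whisker (below G n) (whisker (cats G n) t (glued_in G n)) (below_incl G n))"
      by (simp add: Match_ar_def below_glued_def whisker_comp[OF B bi])
    show "fob X (bdry_pt G n i) = fob (comp_fctr (cats G n) X (glued_in G n)) (fob (bdry_incl G n) i) \<and>
      cpt t (bdry_pt G n i) = cpt (whisker (cats G n) t (glued_in G n)) (fob (bdry_incl G n) i) \<and>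
      fob (const (glued G)) (bdry_pt G n i) = pt" if i: "i \<in> ob (bdry G n)" for i
      using functor_ob[OF bd i] functor_ob[OF gi functor_ob[OF bd i]] by (simp add: bdry_pt_def)
  qed
  show ?thesis
  proof (rule exI[of _ "const (glued G)"], rule exI[of _ X], rule exI[of _ t], intro conjI X ballI,
    goal_cases)
    case (1 n i)
    note pt = pt[OF 1, THEN conjunct1] pt[OF 1, THEN conjunct2, THEN conjunct1]
      pt[OF 1, THEN conjunct2, THEN conjunct2]
    show ?case
      using formula[OF 1(1), unfolded boundary_formula_def, THEN bspec, OF 1(2)]
      unfolding Let_def Match[OF 1(1)] pt .
  qed
qed

end
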